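(* Let $X=\mathbf{R}/\mathbf{Z}$ and let $H$ be a subgroup of $G=\mathrm{PC}_{\mathbf{Proj}}(X)$ such that $(G,H)$ has relative Property FW. Then there exist a projectively modeled curve $X'$ and a piecewise projective isomorphism $\varphi:X\dashrightarrow X'$ such that the induced embedding of $H$ into $\mathrm{PC}_{\mathbf{Proj}}(X')$, $h\mapsto\varphi h\varphi^{-1}$, maps $H$ into $\mathrm{Aut}_{\mathbf{Proj}}(X')$. If in addition $H\subset\mathrm{PC}^0_{\mathbf{Proj}}(X)$, then $X'$ and $\varphi$ can be chosen so that, in addition, there is an $H$-invariant finite subset $F\subset X$ such that $\varphi$ is given by a piecewise projective homeomorphism $X\smallsetminus F\to X'$.
   Context: A homeomorphism between open intervals of the projective line $\mathbf{P}^1_{\mathbf{R}}$ is projective if it is the restriction of an element of $\mathrm{PGL}_2(\mathbf{R})$. A projectively modeled curve is a Hausdorff topological space endowed with an atlas of charts valued in open intervals of $\mathbf{P}^1_{\mathbf{R}}$, with locally projective changes of charts. The circle $\mathbf{R}/\mathbf{Z}$ carries the projective structure inherited from $\mathbf{R}\subset\mathbf{P}^1_{\mathbf{R}}$: local inverses of $\mathbf{R}\to\mathbf{R}/\mathbf{Z}$ are charts. A projective isomorphism is a homeomorphism that is locally projective in charts; $\mathrm{Aut}_{\mathbf{Proj}}(X')$ is the group of projective automorphisms of $X'$. A piecewise projective isomorphism $X\dashrightarrow X'$ is a projective isomorphism $X\smallsetminus F\to X'\smallsetminus F'$ with $F,F'$ finite, two of these being identified if they agree on a cofinite subset; $\mathrm{PC}_{\mathbf{Proj}}(X)$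 is the group of piecewise projective isomorphisms from $X$ to itself. $\mathrm{PC}^0_{\mathbf{Proj}}(X)$ is the subgroup of elements represented by self-homeomorphisms of $X$. A piecewise projective homeomorphism is a homeomorphism that restricts to a projective isomorphism between cofinite subsets. Relative Property FW: given a group $G$ acting on a set $Y$, a subset $M\subset Y$ is commensurated if $M\bigtriangleup gM$ is finite for every $g\in G$. For a subgroup $H\le G$, the pair $(G,H)$ has relative Property FW if for every $G$-set $Y$ and every $G$-commensurated subset $M\subset Y$ there is an $H$-invariant subset $M_0\subset Y$ with $M\bigtriangleup M_0$ finite. (Groups are considered as discrete groups.) *)

theory Defs
  imports "HOL-Analysis.Analysis" "HOL-Algebra.Group_Action"
begin

section \<open>The real projective line\<close>

text \<open>Points of the projective line are the lines of the plane; the topology is the quotient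
  topology from the nonzero vectors.\<close>

definition P1 :: "(real^2) set topology" where
  "P1 = topology (\<lambda>U. U \<subseteq> {span {v} | v. v \<noteq> 0} \<and> open {v. v \<noteq> 0 \<and> span {v} \<in> U})"

definition affine_point :: "real \<Rightarrow> (real^2) set" where
  "affine_point x = span {vector [x, 1]}"

definition open_interval :: "(real^2) set set \<Rightarrow> bool" where
  "open_interval I \<longleftrightarrow> openin P1 I \<and> connectedin P1 I \<and> I \<noteq> {} \<and> I \<noteq> topspace P1"

text \<open>The class of an invertible matrix in the projective linear group acts on lines by direct
  image.\<close>

definition projective_on :: "(real^2) set set \<Rightarrow> ((real^2) set \<Rightarrow> (real^2) set) \<Rightarrow> bool" where
  "projective_on S f \<longleftrightarrow> (\<exists>A::real^2^2. invertible A \<and> (\<forall>L\<in>S. f L = ((*v) A) ` L))"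

definition locally_projective_on ::
    "(real^2) set set \<Rightarrow> ((real^2) set \<Rightarrow> (real^2) set) \<Rightarrow> bool" where
  "locally_projective_on S f \<longleftrightarrow>
    (\<forall>L\<in>S. \<exists>W. openin P1 W \<and> L \<in> W \<and> projective_on (S \<inter> W) f)"


section \<open>Projectively modeled curves\<close>

type_synonym 'a proj_chart = "'a set \<times> ('a \<Rightarrow> (real^2) set)"

record 'a pcurve =
  ctop :: "'a topology"
  atlas :: "'a proj_chart set"

abbreviation points :: "'a pcurve \<Rightarrow> 'a set" where
  "points X \<equiv> topspace (ctop X)"

definition is_chart :: "'a topology \<Rightarrow> 'a proj_chart \<Rightarrow> bool" where
  "is_chart T c \<longleftrightarrow> (case c of (U, \<phi>) \<Rightarrow>
     openin T U \<and> open_interval (\<phi> ` U) \<and>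
     homeomorphic_map (subtopology T U) (subtopology P1 (\<phi> ` U)) \<phi>)"

text \<open>The map \<open>f\<close> read in the charts \<open>c\<close> (source) and \<open>d\<close> (target), on the part of the source
  chart where this makes sense. For \<open>f = id\<close> this is a change of charts.\<close>

definition projective_in_charts :: "('a \<Rightarrow> 'b) \<Rightarrow> 'a proj_chart \<Rightarrow> 'b proj_chart \<Rightarrow> bool" where
  "projective_in_charts f c d \<longleftrightarrow> (case (c, d) of ((U, \<phi>), (V, \<psi>)) \<Rightarrow>
     locally_projective_on (\<phi> ` {x \<in> U. f x \<in> V}) (\<psi> \<circ> f \<circ> inv_into U \<phi>))"

definition projective_curve :: "'a pcurve \<Rightarrow> bool" where
  "projective_curve X \<longleftrightarrow>
     Hausdorff_space (ctop X) \<and>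
     (\<forall>c\<in>atlas X. is_chart (ctop X) c) \<and>
     (\<Union>c\<in>atlas X. fst c) = points X \<and>
     (\<forall>c\<in>atlas X. \<forall>d\<in>atlas X. projective_in_charts id c d)"

definition projective_iso :: "'a pcurve \<Rightarrow> 'b pcurve \<Rightarrow> ('a \<Rightarrow> 'b) \<Rightarrow> bool" where
  "projective_iso X Y f \<longleftrightarrow>
     homeomorphic_map (ctop X) (ctop Y) f \<and>
     (\<forall>c\<in>atlas X. \<forall>d\<in>atlas Y. projective_in_charts f c d)"

definition remove_points :: "'a pcurve \<Rightarrow> 'a set \<Rightarrow> 'a pcurve" where
  "remove_points X F =
     \<lparr>ctop = subtopology (ctop X) (points X - F),
      atlas = {(W, \<phi>) | W \<phi>. openin (ctop X) W \<and> W \<inter> F = {} \<and> open_interval (\<phi> ` W) \<and>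
                          (\<exists>U. (U, \<phi>) \<in> atlas X \<and> W \<subseteq> U)}\<rparr>"


section \<open>The circle \<open>R/Z\<close>\<close>

definition coset :: "real \<Rightarrow> real set" where
  "coset x = {x + of_int k | k. True}"

definition circle :: "real set pcurve" where
  "circle =
     \<lparr>ctop = topology (\<lambda>U. U \<subseteq> range coset \<and> open (coset -` U)),
      atlas = {(coset ` {a<..<b}, \<lambda>z. affine_point (inv_into {a<..<b} coset z)) | a b.
                 a < b \<and> b \<le> a + 1}\<rparr>"


section \<open>Piecewise projective isomorphisms\<close>

text \<open>A piecewise projective isomorphism is represented by a total function, whose values at
  finitely many points (and outside the curve) are irrelevant; two such representatives are
  identified when they agree at all but finitely many points of the curve.\<close>

definition pw_rep :: "'a pcurve \<Rightarrow> 'b pcurve \<Rightarrow> ('a \<Rightarrow> 'b) \<Rightarrow> bool" where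
  "pw_rep X Y f \<longleftrightarrow> (\<exists>F F'. finite F \<and> F \<subseteq> points X \<and> finite F' \<and> F' \<subseteq> points Y \<and>
     projective_iso (remove_points X F) (remove_points Y F') f)"

definition agree :: "'a pcurve \<Rightarrow> ('a \<Rightarrow> 'b) \<Rightarrow> ('a \<Rightarrow> 'b) \<Rightarrow> bool" where
  "agree X f g \<longleftrightarrow> finite {x \<in> points X. f x \<noteq> g x}"

definition pw_class :: "'a pcurve \<Rightarrow> 'b pcurve \<Rightarrow> ('a \<Rightarrow> 'b) \<Rightarrow> ('a \<Rightarrow> 'b) set" where
  "pw_class X Y f = {g. pw_rep X Y g \<and> agree X f g}"

definition pw_isos :: "'a pcurve \<Rightarrow> 'b pcurve \<Rightarrow> ('a \<Rightarrow> 'b) set set" where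
  "pw_isos X Y = {pw_class X Y f | f. pw_rep X Y f}"

definition pw_comp ::
    "'a pcurve \<Rightarrow> 'c pcurve \<Rightarrow> ('b \<Rightarrow> 'c) set \<Rightarrow> ('a \<Rightarrow> 'b) set \<Rightarrow> ('a \<Rightarrow> 'c) set" where
  "pw_comp X Z B A = {h. pw_rep X Z h \<and> (\<exists>g\<in>B. \<exists>f\<in>A. agree X h (g \<circ> f))}"

definition pw_inverse :: "'a pcurve \<Rightarrow> 'b pcurve \<Rightarrow> ('a \<Rightarrow> 'b) set \<Rightarrow> ('b \<Rightarrow> 'a) set" where
  "pw_inverse X Y A = {g. pw_rep Y X g \<and> (\<exists>f\<in>A. agree X (g \<circ> f) id)}"

definition PC_Proj :: "'a pcurve \<Rightarrow> ('a \<Rightarrow> 'a) set monoid" where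
  "PC_Proj X = \<lparr>carrier = pw_isos X X, mult = pw_comp X X, one = pw_class X X id\<rparr>"

definition PC0_Proj :: "'a pcurve \<Rightarrow> ('a \<Rightarrow> 'a) set set" where
  "PC0_Proj X = {h \<in> pw_isos X X. \<exists>f\<in>h. homeomorphic_map (ctop X) (ctop X) f}"

text \<open>The image in the group of piecewise projective automorphisms of the group of projective
  automorphisms.\<close>

definition Aut_Proj :: "'a pcurve \<Rightarrow> ('a \<Rightarrow> 'a) set set" where
  "Aut_Proj X = {pw_class X X f | f. projective_iso X X f}"

definition pw_projective_homeo :: "'a pcurve \<Rightarrow> 'b pcurve \<Rightarrow> ('a \<Rightarrow> 'b) \<Rightarrow> bool" where
  "pw_projective_homeo X Y f \<longleftrightarrow> homeomorphic_map (ctop X) (ctop Y) f \<and> pw_rep X Y f"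

definition conj_class ::
    "'a pcurve \<Rightarrow> 'b pcurve \<Rightarrow> ('a \<Rightarrow> 'b) set \<Rightarrow> ('a \<Rightarrow> 'a) set \<Rightarrow> ('b \<Rightarrow> 'b) set" where
  "conj_class X Y \<Phi> h = pw_comp Y Y (pw_comp X Y \<Phi> h) (pw_inverse X Y \<Phi>)"

text \<open>A class \<open>h\<close> in \<open>PC0_Proj X\<close> acts on the points of \<open>X\<close> through its representatives that are
  self-homeomorphisms of \<open>X\<close> (they all agree on \<open>X\<close>, which has no isolated points).\<close>

definition PC0_invariant :: "'a pcurve \<Rightarrow> ('a \<Rightarrow> 'a) set set \<Rightarrow> 'a set \<Rightarrow> bool" where
  "PC0_invariant X H F \<longleftrightarrow>
     (\<forall>h\<in>H. \<forall>f\<in>h. homeomorphic_map (ctop X) (ctop X) f \<longrightarrow> f ` F = F)"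


section \<open>Relative Property FW\<close>

definition commensurated ::
    "('g, 'm) monoid_scheme \<Rightarrow> ('g \<Rightarrow> 'y \<Rightarrow> 'y) \<Rightarrow> 'y set \<Rightarrow> 'y set \<Rightarrow> bool" where
  "commensurated G act Y M \<longleftrightarrow> M \<subseteq> Y \<and> (\<forall>g\<in>carrier G. finite (sym_diff M (act g ` M)))"

definition relative_FW_on :: "'y itself \<Rightarrow> ('g, 'm) monoid_scheme \<Rightarrow> 'g set \<Rightarrow> bool" where
  "relative_FW_on _ G H \<longleftrightarrow>
     (\<forall>(Y::'y set) act M. group_action G Y act \<and> commensurated G act Y M \<longrightarrow>
        (\<exists>M0\<subseteq>Y. (\<forall>h\<in>H. act h ` M0 = M0) \<and> finite (sym_diff M M0)))"

text \<open>The property quantifies over all \<open>G\<close>-sets. As one cannot quantify over types inside a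
  formula, the \<open>G\<close>-sets are taken inside one type depending on \<open>G\<close>, which is large enough for the
  property to follow for \<open>G\<close>-sets of any type: this is lemma \<open>relative_FW_imp_on\<close> below.\<close>

definition relative_FW :: "('g, 'm) monoid_scheme \<Rightarrow> 'g set \<Rightarrow> bool" where
  "relative_FW G H \<longleftrightarrow> relative_FW_on TYPE('g \<times> nat \<times> 'g) G H"

lemma orbit_subset:
  assumes "group_action G Y act" "y \<in> Y"
  shows "orbit G act y \<subseteq> Y"
  using assms by (auto simp: orbit_def intro: group_action.element_image)

lemma relative_FW_imp_on:
  fixes G :: "('g, 'm) monoid_scheme"
  assumes FW: "relative_FW G H" and H: "H \<subseteq> carrier G"
  shows "relative_FW_on TYPE('y) G H"
  unfolding relative_FW_on_def
proof (intro allI impI, elim conjE)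
  fix Y :: "'y set" and act M
  assume ga: "group_action G Y act" and com: "commensurated G act Y M"
  interpret group_action G Y act by (fact ga)
  interpret G: group G using group_hom group_hom.axioms(1) by blast
  have MY: "M \<subseteq> Y" and fin: "\<And>g. g \<in> carrier G \<Longrightarrow> finite (sym_diff M (act g ` M))"
    using com by (auto simp: commensurated_def)
  define moves where "moves g O' \<longleftrightarrow> g \<in> carrier G \<and> (\<exists>y\<in>O'. y \<in> sym_diff M (act g ` M))"
    for g O'
  define R where "R = {O' \<in> orbits G Y act. \<exists>g. moves g O'}"
  define gO where "gO O' = (SOME g. moves g O')" for O'
  have gO: "moves (gO O') O'" if "O' \<in> R" for O'
    using that unfolding R_def gO_def by (auto intro: someI)
  define orb where "orb = orbit G act"
  have orb_orbit: "O' = orb y" if "O' \<in> orbits G Y act" "y \<in> O'" for O' y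
  proof -
    from that(1) obtain x where x: "x \<in> Y" "O' = orbit G act x" by (auto simp: orbits_def)
    have yY: "y \<in> Y" using orbit_subset[OF ga x(1)] that(2) x(2) by auto
    have 1: "y \<in> orbit G act x" using that x by simp
    have 2: "x \<in> orbit G act y" using orbit_sym[OF x(1) yY 1] .
    show ?thesis unfolding orb_def x(2)
    proof (intro equalityI subsetI)
      fix z assume z: "z \<in> orbit G act x"
      then have "z \<in> Y" using orbit_subset[OF ga x(1)] by auto
      with orbit_trans[OF yY x(1) _ 2 z] show "z \<in> orbit G act y" by simp
    next
      fix z assume z: "z \<in> orbit G act y"
      then have "z \<in> Y" using orbit_subset[OF ga yY] by auto
      with orbit_trans[OF x(1) yY _ 1 z] show "z \<in> orbit G act x" by simp
    qed
  qed
  have fin_g: "finite {O' \<in> R. moves g O'}" for g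
  proof (cases "g \<in> carrier G")
    case True
    have "{O' \<in> R. moves g O'} \<subseteq> orb ` sym_diff M (act g ` M)"
      using orb_orbit unfolding moves_def R_def by blast
    then show ?thesis by (rule finite_subset) (rule finite_imageI[OF fin[OF True]])
  qed (simp add: moves_def)
  define nO where "nO O' = to_nat_on {O'' \<in> R. moves (gO O') O''} O'" for O'
  have inj_idx: "O1 = O2" if "O1 \<in> R" "O2 \<in> R" "gO O1 = gO O2" "nO O1 = nO O2" for O1 O2
  proof -
    have c: "inj_on (to_nat_on {O'' \<in> R. moves (gO O1) O''}) {O'' \<in> R. moves (gO O1) O''}"
      by (rule inj_on_to_nat_on[OF countable_finite[OF fin_g]])
    show ?thesis
      using inj_onD[OF c, of O1 O2] that gO[of O1] gO[of O2] by (auto simp: nO_def)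
  qed
  define base where "base O' = (SOME x. x \<in> O')" for O' :: "'y set"
  define rep where "rep y = (SOME g. g \<in> carrier G \<and> act g (base (orb y)) = y)" for y
  have self: "y \<in> orb y" if "y \<in> Y" for y using orbit_refl[OF that] by (simp add: orb_def)
  have orb_in: "orb y \<in> orbits G Y act" if "y \<in> Y" for y using that by (auto simp: orbits_def orb_def)
  have base_in: "base (orb y) \<in> orb y" if "y \<in> Y" for y
    unfolding base_def using self[OF that] by (rule someI)
  have rep: "rep y \<in> carrier G \<and> act (rep y) (base (orb y)) = y" if "y \<in> Y" for y
  proof -
    have b: "base (orb y) \<in> orb y" by (rule base_in[OF that])
    then have bY: "base (orb y) \<in> Y" using orbit_subset[OF ga that] by (auto simp: orb_def)
    have "y \<in> orbit G act (base (orb y))" using orbit_sym[OF that bY] b by (simp add: orb_def)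
    then show ?thesis unfolding rep_def orbit_def
      by - (rule someI_ex, auto)
  qed
  define Y' where "Y' = {y \<in> Y. orb y \<in> R}"
  define e where "e y = (gO (orb y), nO (orb y), rep y)" for y
  have inj_e: "inj_on e Y'"
  proof (rule inj_onI)
    fix y z assume yz: "y \<in> Y'" "z \<in> Y'" "e y = e z"
    then have "orb y = orb z" using inj_idx by (auto simp: e_def Y'_def)
    with yz rep show "y = z" by (metis (no_types, lifting) Y'_def e_def mem_Collect_eq prod.inject)
  qed
  have orb_act: "orb (act g y) = orb y" if "g \<in> carrier G" "y \<in> Y" for g y
  proof -
    have "act g y \<in> orb y" using that by (auto simp: orb_def orbit_def)
    then show ?thesis using orb_orbit[OF orb_in[OF that(2)]] by auto
  qed
  have actY: "act g y \<in> Y" if "g \<in> carrier G" "y \<in> Y" for g y using element_image that by blast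
  have actY': "act g y \<in> Y'" if "g \<in> carrier G" "y \<in> Y'" for g y
    using that orb_act actY by (auto simp: Y'_def)
  define Z where "Z = e ` Y'"
  define d where "d = inv_into Y' e"
  have de [simp]: "d (e y) = y" if "y \<in> Y'" for y using inj_e that by (simp add: d_def)
  have dZ: "d z \<in> Y'" "e (d z) = z" if "z \<in> Z" for z
    using that by (auto simp: Z_def)
  define act' where "act' g = (\<lambda>z\<in>Z. e (act g (d z)))" for g
  have comp: "act (g \<otimes>\<^bsub>G\<^esub> h) y = act g (act h y)" if "g \<in> carrier G" "h \<in> carrier G" "y \<in> Y" for g h y
    using composition_rule that by blast
  have one: "act \<one>\<^bsub>G\<^esub> y = y" if "y \<in> Y" for y using id_eq_one that by (metis restrict_apply')
  have eZ: "e y \<in> Z" if "y \<in> Y'" for y using that by (simp add: Z_def)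
  have comp': "act' (g \<otimes>\<^bsub>G\<^esub> h) z = act' g (act' h z)"
    if "g \<in> carrier G" "h \<in> carrier G" "z \<in> Z" for g h z
    using that actY' dZ[OF that(3)] eZ comp by (simp add: act'_def Y'_def)
  have one': "act' \<one>\<^bsub>G\<^esub> z = z" if "z \<in> Z" for z
    using that dZ[OF that] one by (simp add: act'_def Y'_def)
  have act'Z: "act' g z \<in> Z" if "g \<in> carrier G" "z \<in> Z" for g z
    using that dZ[OF that(2)] actY' eZ by (simp add: act'_def)
  have Bij': "act' g \<in> Bij Z" if g: "g \<in> carrier G" for g
    unfolding Bij_def
  proof (intro IntI CollectI)
    show "act' g \<in> extensional Z" by (simp add: act'_def)
    have "act' (inv\<^bsub>G\<^esub> g) (act' g z) = z" "act' g (act' (inv\<^bsub>G\<^esub> g) z) = z" if "z \<in> Z" for z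
      using that g comp' one' by (metis G.inv_closed G.l_inv G.r_inv)+
    then show "bij_betw (act' g) Z Z"
      using g act'Z by (intro bij_betwI[where g = "act' (inv\<^bsub>G\<^esub> g)"]) auto
  qed
  have ga': "group_action G Z act'"
  proof (intro group_action.intro group_hom.intro group_hom_axioms.intro homI)
    show "group G" "group (BijGroup Z)" by (simp_all add: G.is_group group_BijGroup)
    show "act' g \<in> carrier (BijGroup Z)" if "g \<in> carrier G" for g
      using Bij'[OF that] by (simp add: BijGroup_def)
    fix g h assume gh: "g \<in> carrier G" "h \<in> carrier G"
    show "act' (g \<otimes>\<^bsub>G\<^esub> h) = act' g \<otimes>\<^bsub>BijGroup Z\<^esub> act' h"
    proof
      fix z show "act' (g \<otimes>\<^bsub>G\<^esub> h) z = (act' g \<otimes>\<^bsub>BijGroup Z\<^esub> act' h) z"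
        using gh Bij' comp' by (cases "z \<in> Z") (auto simp: BijGroup_def compose_def act'_def)
    qed
  qed
  define M' where "M' = e ` (M \<inter> Y')"
  have act'_img: "act' g ` e ` S = e ` act g ` S" if "S \<subseteq> Y'" for S g
    unfolding image_image
  proof (rule image_cong[OF refl])
    fix y assume "y \<in> S"
    then have "y \<in> Y'" using that by auto
    then show "act' g (e y) = e (act g y)" using eZ by (simp add: act'_def)
  qed
  have act_int: "act g ` (S \<inter> Y') = act g ` S \<inter> Y'" if "g \<in> carrier G" "S \<subseteq> Y" for g S
    using that orb_act actY by (auto simp: Y'_def)
  have "commensurated G act' Z M'"
    unfolding commensurated_def
  proof (intro conjI ballI)
    show "M' \<subseteq> Z" by (auto simp: M'_def Z_def)
    fix g assume g: "g \<in> carrier G"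
    have "act' g ` M' = e ` (act g ` M \<inter> Y')"
      using act'_img[of "M \<inter> Y'" g] act_int[OF g MY] by (simp add: M'_def)
    then have "sym_diff M' (act' g ` M') \<subseteq> e ` sym_diff M (act g ` M)"
      by (auto simp: M'_def)
    then show "finite (sym_diff M' (act' g ` M'))"
      by (rule finite_subset) (rule finite_imageI[OF fin[OF g]])
  qed
  then have "\<exists>N\<subseteq>Z. (\<forall>h\<in>H. act' h ` N = N) \<and> finite (sym_diff M' N)"
    using FW[unfolded relative_FW_def relative_FW_on_def, rule_format, OF conjI, OF ga'] by simp
  then obtain N where N: "N \<subseteq> Z" "\<And>h. h \<in> H \<Longrightarrow> act' h ` N = N" "finite (sym_diff M' N)"
    by (elim exE conjE) (rule that, auto)
  define M0 where "M0 = d ` N \<union> (M - Y')"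
  have NY: "d ` N \<subseteq> Y'" using N(1) dZ by auto
  have edN: "e ` d ` N = N" using N(1) dZ(2) unfolding image_image by (metis (no_types, lifting) image_cong image_ident subsetD)
  have inv_out: "act g ` (M - Y') \<subseteq> M - Y'" if g: "g \<in> carrier G" for g
  proof
    fix z assume "z \<in> act g ` (M - Y')"
    then obtain y where y: "y \<in> M" "y \<notin> Y'" "z = act g y" by auto
    have yY: "y \<in> Y" using y MY by auto
    have "orb y \<notin> R" using y yY by (simp add: Y'_def)
    then have "\<not> moves g (orb y)" using orb_in[OF yY] by (auto simp: R_def)
    moreover have "z \<in> orb y" using y g by (auto simp: orb_def orbit_def)
    ultimately have "z \<notin> sym_diff M (act g ` M)" using g by (auto simp: moves_def)
    then have "z \<in> M" using y by auto
    moreover have "z \<notin> Y'" using y orb_act[OF g yY] yY by (auto simp: Y'_def)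
    ultimately show "z \<in> M - Y'" by simp
  qed
  have inv_out': "act g ` (M - Y') = M - Y'" if g: "g \<in> carrier G" for g
  proof (rule equalityI[OF inv_out[OF g]], rule subsetI)
    fix z assume z: "z \<in> M - Y'"
    then have "act (inv\<^bsub>G\<^esub> g) z \<in> M - Y'" using inv_out[of "inv\<^bsub>G\<^esub> g"] g by auto
    moreover have "z = act g (act (inv\<^bsub>G\<^esub> g) z)"
      using z MY g comp[of g "inv\<^bsub>G\<^esub> g" z] one by auto
    ultimately show "z \<in> act g ` (M - Y')" by blast
  qed
  show "\<exists>M0\<subseteq>Y. (\<forall>h\<in>H. act h ` M0 = M0) \<and> finite (sym_diff M M0)"
  proof (intro exI[of _ M0] conjI ballI)
    show "M0 \<subseteq> Y" using NY MY by (auto simp: M0_def Y'_def)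
    show "act h ` M0 = M0" if h: "h \<in> H" for h
    proof -
      have hG: "h \<in> carrier G" using h H by auto
      have "e ` act h ` d ` N = e ` d ` N" using act'_img[OF NY, of h] edN N(2)[OF h] by simp
      moreover have "act h ` d ` N \<subseteq> Y'" using NY actY'[OF hG] by auto
      ultimately have "act h ` d ` N = d ` N" using inj_on_image_eq_iff[OF inj_e] NY by metis
      then show ?thesis using inv_out'[OF hG] by (simp add: M0_def image_Un)
    qed
    have sub: "M \<inter> Y' - d ` N \<subseteq> Y'" "d ` N - M \<inter> Y' \<subseteq> Y'" using NY by auto
    have "e ` (M \<inter> Y' - d ` N) = M' - N" "e ` (d ` N - M \<inter> Y') = N - M'"
      using inj_on_image_set_diff[OF inj_e sub(1) NY] inj_on_image_set_diff[OF inj_e sub(2)] edN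
      unfolding M'_def by simp_all
    then have "finite (e ` sym_diff (M \<inter> Y') (d ` N))" using N(3) by (simp add: image_Un)
    then have "finite (sym_diff (M \<inter> Y') (d ` N))"
      by (rule finite_imageD) (rule inj_on_subset[OF inj_e], use sub in auto)
    moreover have "sym_diff M M0 = sym_diff (M \<inter> Y') (d ` N)" using NY by (auto simp: M0_def)
    ultimately show "finite (sym_diff M M0)" by simp
  qed
qed


section \<open>The topology of the projective line\<close>

lemma span1: "span {v::real^2} = range (\<lambda>c. c *\<^sub>R v)"
  by (simp add: span_singleton)

lemma span1_eq_iff:
  fixes v w :: "real^2"
  assumes "v \<noteq> 0"
  shows "span {v} = span {w} \<longleftrightarrow> (\<exists>c. c \<noteq> 0 \<and> w = c *\<^sub>R v)"
proof
  assume eq: "span {v} = span {w}"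
  have "w \<in> span {v}" using eq by (simp add: span_base)
  then obtain c where c: "w = c *\<^sub>R v" by (auto simp: span1)
  have "w \<noteq> 0" using eq assms by (metis singletonD span_0 span_base span_singleton insertCI span_insert_0 span_empty)
  then show "\<exists>c. c \<noteq> 0 \<and> w = c *\<^sub>R v" using c by auto
next
  assume "\<exists>c. c \<noteq> 0 \<and> w = c *\<^sub>R v"
  then obtain c where c: "c \<noteq> 0" "w = c *\<^sub>R v" by auto
  show "span {v} = span {w}"
  proof (intro equalityI subsetI)
    fix x assume "x \<in> span {v}"
    then obtain d where "x = d *\<^sub>R v" by (auto simp: span1)
    then have "x = (d / c) *\<^sub>R w" using c by simp
    then show "x \<in> span {w}" by (auto simp: span1)
  next
    fix x assume "x \<in> span {w}"
    then show "x \<in> span {v}" using c by (auto simp: span1)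
  qed
qed

lemma openin_P1: "openin P1 U \<longleftrightarrow> U \<subseteq> {span {v} | v. v \<noteq> 0} \<and> open {v. v \<noteq> 0 \<and> span {v} \<in> U}"
proof -
  have "istopology (\<lambda>U. U \<subseteq> {span {v} | v::real^2. v \<noteq> 0} \<and> open {v. v \<noteq> 0 \<and> span {v} \<in> U})"
    unfolding istopology_def
  proof (intro conjI allI impI)
    fix S T :: "(real^2) set set"
    assume S: "S \<subseteq> {span {v} |v. v \<noteq> 0} \<and> open {v. v \<noteq> 0 \<and> span {v} \<in> S}"
      and T: "T \<subseteq> {span {v} |v. v \<noteq> 0} \<and> open {v. v \<noteq> 0 \<and> span {v} \<in> T}"
    show "S \<inter> T \<subseteq> {span {v} |v. v \<noteq> 0}" using S by auto
    have "{v. v \<noteq> 0 \<and> span {v} \<in> S \<inter> T} = {v. v \<noteq> 0 \<and> span {v} \<in> S} \<inter> {v. v \<noteq> 0 \<and> span {v} \<in> T}"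
      by auto
    then show "open {v. v \<noteq> 0 \<and> span {v} \<in> S \<inter> T}" using S T by (simp add: open_Int)
  next
    fix K :: "(real^2) set set set"
    assume K: "\<forall>S\<in>K. S \<subseteq> {span {v} |v. v \<noteq> 0} \<and> open {v. v \<noteq> 0 \<and> span {v} \<in> S}"
    show "\<Union>K \<subseteq> {span {v} |v. v \<noteq> 0}" using K by blast
    have "{v. v \<noteq> 0 \<and> span {v} \<in> \<Union>K} = (\<Union>S\<in>K. {v. v \<noteq> 0 \<and> span {v} \<in> S})" by auto
    then show "open {v. v \<noteq> 0 \<and> span {v} \<in> \<Union>K}" using K by auto
  qed
  then show ?thesis unfolding P1_def by simp
qed

lemma topspace_P1: "topspace P1 = {span {v} | v. v \<noteq> 0}"
proof -
  have "{v. v \<noteq> 0 \<and> span {v} \<in> {span {v} |v::real^2. v \<noteq> 0}} = - {0}" by auto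
  then have "openin P1 {span {v} | v. v \<noteq> 0}" by (simp add: openin_P1 open_Compl)
  from openin_subset[OF this] show ?thesis
    using openin_topspace[of P1] unfolding openin_P1[of "topspace P1"] by (intro equalityI) simp_all
qed

lemma continuous_map_span: "continuous_map (top_of_set (- {0})) P1 (\<lambda>v. span {v})"
  unfolding continuous_map_def
proof (intro conjI allI impI)
  show "(\<lambda>v. span {v}) \<in> topspace (top_of_set (- {0})) \<rightarrow> topspace P1" by (auto simp: topspace_P1)
  fix U assume "openin P1 U"
  then have "open {v. v \<noteq> 0 \<and> span {v} \<in> U}" by (simp add: openin_P1)
  moreover have "{x \<in> topspace (top_of_set (- {0})). span {x} \<in> U} = {v. v \<noteq> 0 \<and> span {v} \<in> U}" by auto
  ultimately show "openin (top_of_set (- {0})) {x \<in> topspace (top_of_set (- {0})). span {x} \<in> U}"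
    by (auto intro!: open_subset)
qed

lemma openin_P1_span:
  assumes "open S" "0 \<notin> S"
  shows "openin P1 ((\<lambda>v. span {v}) ` S)"
  unfolding openin_P1
proof
  show "(\<lambda>v. span {v}) ` S \<subseteq> {span {v} |v. v \<noteq> 0}" using assms by auto
  have "{v. v \<noteq> 0 \<and> span {v} \<in> (\<lambda>v. span {v}) ` S} = (\<Union>c\<in>-{0}. (\<lambda>v. c *\<^sub>R v) ` S)" (is "?L = ?R")
  proof (intro equalityI subsetI)
    fix v assume "v \<in> ?L"
    then obtain s where "s \<in> S" "span {s} = span {v}" by auto
    then show "v \<in> ?R" using span1_eq_iff[of s v] assms by auto
  next
    fix v assume "v \<in> ?R"
    then obtain s c where s: "s \<in> S" "c \<noteq> 0" "v = c *\<^sub>R s" by auto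
    then have "s \<noteq> 0" using assms by auto
    moreover have "span {s} = span {v}" using \<open>s \<noteq> 0\<close> s(2,3) span1_eq_iff[of s v] by blast
    moreover have "v \<noteq> 0" using s \<open>s \<noteq> 0\<close> by simp
    ultimately show "v \<in> ?L" using s(1) by (metis (mono_tags, lifting) image_eqI mem_Collect_eq)
  qed
  moreover have "open ?R" using assms by (intro open_UN ballI open_scaling) auto
  ultimately show "open {v. v \<noteq> 0 \<and> span {v} \<in> (\<lambda>v. span {v}) ` S}" by simp
qed

lemma open_interval_nbhd:
  assumes "openin P1 N" "L \<in> N"
  shows "\<exists>I. open_interval I \<and> L \<in> I \<and> I \<subseteq> N"
proof -
  obtain v where v: "v \<noteq> 0" "L = span {v}" using assms openin_P1 by blast
  have op: "open {v. v \<noteq> 0 \<and> span {v} \<in> N}" using assms openin_P1 by blast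
  then obtain r where r: "r > 0" "ball v r \<subseteq> {v. v \<noteq> 0 \<and> span {v} \<in> N}"
    using v assms(2) unfolding open_contains_ball by blast
  let ?I = "(\<lambda>v. span {v}) ` ball v r"
  have 0: "0 \<notin> ball v r" using r(2) by blast
  have "openin P1 ?I" by (rule openin_P1_span[OF open_ball 0])
  moreover have "connectedin P1 ?I"
    using connectedin_continuous_map_image[OF continuous_map_span, of "ball v r"] 0
    by (auto simp: connectedin_subtopology connectedin_iff_connected)
  moreover have "L \<in> ?I" using v r by auto
  moreover have "?I \<subseteq> N" using r by auto
  moreover have "?I \<noteq> topspace P1"
  proof
    assume eq: "?I = topspace P1"
    define w :: "real^2" where "w = vector [- v$2, v$1]"
    have w: "w \<noteq> 0" using v by (auto simp: w_def vec_eq_iff forall_2)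
    have "span {w} \<in> ?I" unfolding eq topspace_P1 using w by auto
    then obtain u where u: "u \<in> ball v r" "span {w} = span {u}" by auto
    then obtain c where c: "u = c *\<^sub>R w" using span1_eq_iff[OF w] by auto
    have "inner v w = 0" by (simp add: inner_vec_def sum_2 w_def)
    then have "(norm (v - u))^2 = (norm v)^2 + (norm u)^2"
      unfolding c power2_norm_eq_inner by (simp add: inner_diff inner_commute)
    then have "norm v \<le> norm (v - u)" by (metis le_add_same_cancel1 norm_ge_zero power2_le_imp_le zero_le_power2)
    also have "\<dots> < r" using u by (simp add: dist_norm)
    finally have "0 \<in> ball v r" by (simp add: dist_norm)
    with 0 show False by simp
  qed
  ultimately show ?thesis unfolding open_interval_def by blast
qed

lemma affine_point_eq: "affine_point x = affine_point y \<longleftrightarrow> x = y"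
proof -
  have "(vector [x, 1] :: real^2) \<noteq> 0" by (simp add: vec_eq_iff forall_2)
  then show ?thesis unfolding affine_point_def
    by (subst span1_eq_iff) (auto simp: vec_eq_iff forall_2)
qed

lemma affine_point_homeo:
  assumes "a < b"
  shows "homeomorphic_map (top_of_set {a<..<b}) (subtopology P1 (affine_point ` {a<..<b})) affine_point"
    and "open_interval (affine_point ` {a<..<b})"
proof -
  have nz: "(vector [x, 1] :: real^2) \<noteq> 0" for x by (simp add: vec_eq_iff forall_2)
  have vec: "(vector [x, 1] :: real^2) = x *\<^sub>R axis 1 1 + axis 2 1" for x :: real
    by (simp add: vec_eq_iff forall_2 axis_def)
  have "continuous_map euclideanreal (top_of_set (- {0})) (\<lambda>x. vector [x, 1] :: real^2)"
    using nz by (auto simp: continuous_map_in_subtopology vec intro!: continuous_intros)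
  from continuous_map_compose[OF this continuous_map_span]
  have cont: "continuous_map euclideanreal P1 affine_point"
    by (simp add: comp_def affine_point_def[abs_def])
  have opn: "openin P1 (affine_point ` U)" if U: "open U" for U
  proof -
    have eq: "affine_point ` U = (\<lambda>v. span {v}) ` {v. v$2 \<noteq> 0 \<and> v$1 / v$2 \<in> U}"
    proof (intro equalityI subsetI)
      fix L assume "L \<in> affine_point ` U"
      then show "L \<in> (\<lambda>v. span {v}) ` {v. v$2 \<noteq> 0 \<and> v$1 / v$2 \<in> U}"
        unfolding affine_point_def by force
    next
      fix L assume "L \<in> (\<lambda>v::real^2. span {v}) ` {v. v$2 \<noteq> 0 \<and> v$1 / v$2 \<in> U}"
      then obtain v where v: "L = span {v}" "v$2 \<noteq> 0" "v$1 / v$2 \<in> U" by auto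
      have "v = (v$2) *\<^sub>R vector [v$1 / v$2, 1]" using v by (simp add: vec_eq_iff forall_2)
      then have "span {vector [v$1 / v$2, 1]} = span {v}"
        using span1_eq_iff[OF nz] v(2) by blast
      then show "L \<in> affine_point ` U" using v unfolding affine_point_def by blast
    qed
    have "open ({v. v$2 \<noteq> 0} :: (real^2) set)"
      by (intro open_Collect_neq continuous_intros)
    moreover have "continuous_on {v::real^2. v$2 \<noteq> 0} (\<lambda>v. v$1 / v$2)"
      by (intro continuous_intros) auto
    ultimately have "open ((\<lambda>v. v$1 / v$2) -` U \<inter> {v::real^2. v$2 \<noteq> 0})"
      using U continuous_on_open_vimage by blast
    moreover have "(\<lambda>v. v$1 / v$2) -` U \<inter> {v::real^2. v$2 \<noteq> 0} = {v. v$2 \<noteq> 0 \<and> v$1 / v$2 \<in> U}" by auto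
    ultimately show ?thesis unfolding eq by (intro openin_P1_span) auto
  qed
  let ?J = "{a<..<b}"
  have "open_map euclideanreal P1 affine_point" using opn by (simp add: open_map_def)
  then have om: "open_map (top_of_set ?J) (subtopology P1 (affine_point ` ?J)) affine_point"
    unfolding open_map_def
  proof (intro allI impI)
    fix U assume "openin (top_of_set ?J) U"
    then have U: "open U" "U \<subseteq> ?J"
      using openin_open_eq[OF open_greaterThanLessThan] by auto
    then have "affine_point ` U = affine_point ` U \<inter> affine_point ` ?J" by blast
    then show "openin (subtopology P1 (affine_point ` ?J)) (affine_point ` U)"
      unfolding openin_subtopology using opn[OF U(1)] by blast
  qed
  show "homeomorphic_map (top_of_set ?J) (subtopology P1 (affine_point ` ?J)) affine_point"
    using om cont affine_point_eq
    by (intro bijective_open_imp_homeomorphic_map)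
       (auto simp: continuous_map_in_subtopology continuous_map_from_subtopology inj_on_def topspace_P1 affine_point_def nz intro!: exI)
  have 1: "openin P1 (affine_point ` ?J)" by (rule opn) simp
  have 2: "connectedin P1 (affine_point ` ?J)"
    by (rule connectedin_continuous_map_image[OF cont]) (simp add: connectedin_iff_connected)
  have "b \<notin> ?J" by simp
  then have "affine_point b \<notin> affine_point ` ?J" using affine_point_eq by auto
  moreover have "affine_point b \<in> topspace P1" using nz by (auto simp: topspace_P1 affine_point_def)
  ultimately show "open_interval (affine_point ` ?J)" using 1 2 assms unfolding open_interval_def by auto
qed


section \<open>Piecewise projective automorphisms form a group\<close>

lemma projective_in_charts_iff:
  assumes c: "is_chart T (U, \<phi>)"
  shows "projective_in_charts f (U, \<phi>) (V, \<psi>) \<longleftrightarrow>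
    (\<forall>x\<in>U. f x \<in> V \<longrightarrow> (\<exists>W A. openin T W \<and> x \<in> W \<and> invertible A \<and>
       (\<forall>y\<in>W \<inter> U. f y \<in> V \<longrightarrow> \<psi> (f y) = ((*v) A) ` \<phi> y)))"
proof -
  have U: "openin T U" and I: "openin P1 (\<phi> ` U)"
    and h: "homeomorphic_map (subtopology T U) (subtopology P1 (\<phi> ` U)) \<phi>"
    using c by (auto simp: is_chart_def open_interval_def)
  have tU: "topspace (subtopology T U) = U" using openin_subset[OF U] by (simp add: Int_absorb1)
  have inj: "inj_on \<phi> U" using homeomorphic_imp_injective_map[OF h] tU by simp
  have inv: "inv_into U \<phi> (\<phi> y) = y" if "y \<in> U" for y using inj that by simp
  have cont: "continuous_map (subtopology T U) P1 \<phi>"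
    using homeomorphic_imp_continuous_map[OF h] continuous_map_in_subtopology by blast
  have pre: "openin T {y \<in> U. \<phi> y \<in> W'}" if "openin P1 W'" for W'
  proof -
    have "openin (subtopology T U) {y \<in> topspace (subtopology T U). \<phi> y \<in> W'}"
      using cont that by (rule openin_continuous_map_preimage)
    then show ?thesis unfolding tU using openin_open_subtopology[OF U] by blast
  qed
  have img: "openin P1 (\<phi> ` (W \<inter> U))" if "openin T W" for W
  proof -
    have "openin (subtopology T U) (W \<inter> U)" using that openin_subtopology by blast
    then have "openin (subtopology P1 (\<phi> ` U)) (\<phi> ` (W \<inter> U))"
      using homeomorphic_imp_open_map[OF h] by (simp add: open_map_def)
    then show ?thesis using openin_open_subtopology[OF I] by blast
  qed
  show ?thesis (is "?L \<longleftrightarrow> ?R")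
  proof
    assume L: ?L
    show ?R
    proof (intro ballI impI)
      fix x assume x: "x \<in> U" "f x \<in> V"
      then have "\<phi> x \<in> \<phi> ` {x \<in> U. f x \<in> V}" by blast
      with L obtain W' where W': "openin P1 W'" "\<phi> x \<in> W'"
        "projective_on (\<phi> ` {x \<in> U. f x \<in> V} \<inter> W') (\<psi> \<circ> f \<circ> inv_into U \<phi>)"
        unfolding projective_in_charts_def locally_projective_on_def by auto
      then obtain A :: "real^2^2" where A: "invertible A"
        "\<And>K. K \<in> \<phi> ` {x \<in> U. f x \<in> V} \<inter> W' \<Longrightarrow> (\<psi> \<circ> f \<circ> inv_into U \<phi>) K = ((*v) A) ` K"
        unfolding projective_on_def by auto
      have "\<psi> (f y) = ((*v) A) ` \<phi> y" if "y \<in> {y \<in> U. \<phi> y \<in> W'} \<inter> U" "f y \<in> V" for y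
        using A(2)[of "\<phi> y"] that inv[of y] by auto
      then show "\<exists>W A. openin T W \<and> x \<in> W \<and> invertible A \<and>
         (\<forall>y\<in>W \<inter> U. f y \<in> V \<longrightarrow> \<psi> (f y) = ((*v) A) ` \<phi> y)"
        using pre[OF W'(1)] W'(2) x A(1) by (intro exI[of _ "{y \<in> U. \<phi> y \<in> W'}"] exI[of _ A]) auto
    qed
  next
    assume R: ?R
    show ?L unfolding projective_in_charts_def prod.case locally_projective_on_def
    proof
      fix K assume "K \<in> \<phi> ` {x \<in> U. f x \<in> V}"
      then obtain x where x: "x \<in> U" "f x \<in> V" "K = \<phi> x" by auto
      with R obtain W A where W: "openin T W" "x \<in> W" "invertible A"
        "\<And>y. y \<in> W \<inter> U \<Longrightarrow> f y \<in> V \<Longrightarrow> \<psi> (f y) = ((*v) A) ` \<phi> y" by metis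
      have "projective_on (\<phi> ` {x \<in> U. f x \<in> V} \<inter> \<phi> ` (W \<inter> U)) (\<psi> \<circ> f \<circ> inv_into U \<phi>)"
        unfolding projective_on_def
      proof (intro exI[of _ A] conjI ballI)
        fix M assume "M \<in> \<phi> ` {x \<in> U. f x \<in> V} \<inter> \<phi> ` (W \<inter> U)"
        then obtain y z where yz: "y \<in> U" "f y \<in> V" "M = \<phi> y" "z \<in> W \<inter> U" "M = \<phi> z" by auto
        then have "y = z" using inj by (auto dest: inj_onD)
        then show "(\<psi> \<circ> f \<circ> inv_into U \<phi>) M = ((*v) A) ` M" using yz W(4) inv by simp
      qed (rule W(3))
      then show "\<exists>W. openin P1 W \<and> K \<in> W \<and>
          projective_on (\<phi> ` {x \<in> U. f x \<in> V} \<inter> W) (\<psi> \<circ> f \<circ> inv_into U \<phi>)"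
        using img[OF W(1)] W(2) x by (intro exI[of _ "\<phi> ` (W \<inter> U)"]) auto
    qed
  qed
qed

text \<open>Pointwise form of local projectivity in charts, independent of the sets removed.\<close>

definition lproj :: "'a pcurve \<Rightarrow> 'b pcurve \<Rightarrow> ('a \<Rightarrow> 'b) \<Rightarrow> 'a \<Rightarrow> bool" where
  "lproj X Y f x \<longleftrightarrow> (\<forall>U \<phi> V \<psi>. (U, \<phi>) \<in> atlas X \<longrightarrow> (V, \<psi>) \<in> atlas Y \<longrightarrow> x \<in> U \<longrightarrow> f x \<in> V \<longrightarrow>
     (\<exists>W A. openin (ctop X) W \<and> x \<in> W \<and> invertible A \<and>
       (\<forall>y\<in>W \<inter> U. f y \<in> V \<longrightarrow> \<psi> (f y) = ((*v) A) ` \<phi> y)))"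

lemma projective_iso_lproj:
  assumes "\<And>c. c \<in> atlas X \<Longrightarrow> is_chart (ctop X) c"
  shows "projective_iso X Y f \<longleftrightarrow>
     homeomorphic_map (ctop X) (ctop Y) f \<and> (\<forall>x\<in>points X. lproj X Y f x)"
proof -
  have sub: "U \<subseteq> points X" if "(U, \<phi>) \<in> atlas X" for U \<phi>
    using assms[OF that] by (auto simp: is_chart_def dest: openin_subset)
  have "(\<forall>c\<in>atlas X. \<forall>d\<in>atlas Y. projective_in_charts f c d) \<longleftrightarrow>
    (\<forall>U \<phi>. (U, \<phi>) \<in> atlas X \<longrightarrow> (\<forall>V \<psi>. (V, \<psi>) \<in> atlas Y \<longrightarrow> projective_in_charts f (U, \<phi>) (V, \<psi>)))"
    by auto
  also have "\<dots> \<longleftrightarrow> (\<forall>x\<in>points X. lproj X Y f x)"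
    unfolding lproj_def using sub
    by (simp add: projective_in_charts_iff[OF assms] cong: imp_cong) (meson subsetD)
  finally show ?thesis unfolding projective_iso_def by simp
qed

lemma projective_curveD:
  assumes "projective_curve X"
  shows "Hausdorff_space (ctop X)" "\<And>c. c \<in> atlas X \<Longrightarrow> is_chart (ctop X) c"
    "\<And>x. x \<in> points X \<Longrightarrow> \<exists>U \<phi>. (U, \<phi>) \<in> atlas X \<and> x \<in> U"
proof -
  show "Hausdorff_space (ctop X)" "\<And>c. c \<in> atlas X \<Longrightarrow> is_chart (ctop X) c"
    using assms unfolding projective_curve_def by simp_all
  fix x assume "x \<in> points X"
  moreover have "(\<Union>c\<in>atlas X. fst c) = points X" using assms unfolding projective_curve_def by simp
  ultimately obtain c where "c \<in> atlas X" "x \<in> fst c" by blast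
  then show "\<exists>U \<phi>. (U, \<phi>) \<in> atlas X \<and> x \<in> U" by (cases c) auto
qed

lemma lproj_id:
  assumes "projective_curve X" "x \<in> points X"
  shows "lproj X X id x"
proof -
  have "projective_iso X X id"
    using assms by (auto simp: projective_iso_def projective_curve_def homeomorphic_map_id)
  with assms show ?thesis using projective_iso_lproj[OF projective_curveD(2)] by blast
qed

lemma openin_cofinite:
  assumes "projective_curve X" "finite F"
  shows "openin (ctop X) (points X - F)"
proof -
  have "closedin (ctop X) (F \<inter> points X)"
    using assms by (intro closedin_Hausdorff_finite projective_curveD) auto
  then have "openin (ctop X) (points X - F \<inter> points X)" by (rule openin_diff[OF openin_topspace])
  then show ?thesis by (simp add: Diff_Int_distrib Diff_Int)
qed

lemma is_chart_smaller:
  assumes "is_chart T (U, \<phi>)" "openin T W" "W \<subseteq> U" "open_interval (\<phi> ` W)" "W \<subseteq> S"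
  shows "is_chart (subtopology T S) (W, \<phi>)"
proof -
  have h: "homeomorphic_map (subtopology T U) (subtopology P1 (\<phi> ` U)) \<phi>"
    and UT: "U \<subseteq> topspace T"
    using assms by (auto simp: is_chart_def dest: openin_subset)
  have PU: "\<phi> ` U \<subseteq> topspace P1"
    using assms(1) by (auto simp: is_chart_def open_interval_def dest: openin_subset)
  have inj: "inj_on \<phi> U" using homeomorphic_imp_injective_map[OF h] UT by (simp add: Int_absorb1)
  have "\<phi> ` (topspace (subtopology T U) \<inter> W) = topspace (subtopology P1 (\<phi> ` U)) \<inter> \<phi> ` W"
    using UT PU assms(3) by auto
  from homeomorphic_map_subtopologies[OF h this]
  have "homeomorphic_map (subtopology T W) (subtopology P1 (\<phi> ` W)) \<phi>"
    using assms(3) by (simp add: subtopology_subtopology Int_absorb1 image_mono)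
  moreover have "openin (subtopology T S) W"
    using assms(2,5) by (metis inf.absorb1 openin_subtopology)
  ultimately show ?thesis
    using assms by (simp add: is_chart_def subtopology_subtopology Int_absorb1)
qed

lemma small_chart:
  assumes "is_chart T (U, \<phi>)" "openin T S" "x \<in> U" "x \<in> S"
  shows "\<exists>W. openin T W \<and> x \<in> W \<and> W \<subseteq> U \<and> W \<subseteq> S \<and> open_interval (\<phi> ` W)"
proof -
  have U: "openin T U" and I: "openin P1 (\<phi> ` U)"
    and h: "homeomorphic_map (subtopology T U) (subtopology P1 (\<phi> ` U)) \<phi>"
    using assms by (auto simp: is_chart_def open_interval_def)
  have tU: "topspace (subtopology T U) = U" using openin_subset[OF U] by (simp add: Int_absorb1)
  have "openin (subtopology T U) (S \<inter> U)" using assms(2) openin_subtopology by blast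
  then have "openin (subtopology P1 (\<phi> ` U)) (\<phi> ` (S \<inter> U))"
    using homeomorphic_imp_open_map[OF h] by (simp add: open_map_def)
  then have "openin P1 (\<phi> ` (S \<inter> U))" using openin_open_subtopology[OF I] by blast
  from open_interval_nbhd[OF this, of "\<phi> x"] assms(3,4)
  obtain J where J: "open_interval J" "\<phi> x \<in> J" "J \<subseteq> \<phi> ` (S \<inter> U)" by blast
  have cont: "continuous_map (subtopology T U) P1 \<phi>"
    using homeomorphic_imp_continuous_map[OF h] continuous_map_in_subtopology by blast
  have inj: "inj_on \<phi> U" using homeomorphic_imp_injective_map[OF h] tU by simp
  let ?W = "{y \<in> U. \<phi> y \<in> J}"
  have "openin (subtopology T U) {y \<in> topspace (subtopology T U). \<phi> y \<in> J}"
    using cont by (rule openin_continuous_map_preimage) (use J(1) in \<open>simp add: open_interval_def\<close>)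
  then have "openin T ?W" unfolding tU using openin_open_subtopology[OF U] by blast
  moreover have "\<phi> ` ?W = J" using J(3) by auto
  moreover have "?W \<subseteq> S" using J(3) inj by (auto dest: inj_onD)
  ultimately show ?thesis using J assms(3) by (intro exI[of _ ?W]) auto
qed

definition pw_iso_on :: "'a pcurve \<Rightarrow> 'b pcurve \<Rightarrow> 'a set \<Rightarrow> 'b set \<Rightarrow> ('a \<Rightarrow> 'b) \<Rightarrow> bool" where
  "pw_iso_on X Y S S' f \<longleftrightarrow>
     homeomorphic_map (subtopology (ctop X) S) (subtopology (ctop Y) S') f \<and> (\<forall>x\<in>S. lproj X Y f x)"

lemma remove_points_simps [simp]:
  "ctop (remove_points X F) = subtopology (ctop X) (points X - F)"
  "points (remove_points X F) = points X - F"
  by (auto simp: remove_points_def)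

lemma atlas_remove_points:
  "(W, \<phi>) \<in> atlas (remove_points X F) \<longleftrightarrow>
    openin (ctop X) W \<and> W \<inter> F = {} \<and> open_interval (\<phi> ` W) \<and> (\<exists>U. (U, \<phi>) \<in> atlas X \<and> W \<subseteq> U)"
  by (auto simp: remove_points_def)

lemma is_chart_remove_points:
  assumes "projective_curve X" "c \<in> atlas (remove_points X F)"
  shows "is_chart (ctop (remove_points X F)) c"
proof -
  obtain W \<phi> where c: "c = (W, \<phi>)" by force
  with assms(2) obtain U where U: "openin (ctop X) W" "W \<inter> F = {}" "open_interval (\<phi> ` W)"
    "(U, \<phi>) \<in> atlas X" "W \<subseteq> U" by (auto simp: atlas_remove_points)
  show ?thesis unfolding c remove_points_simps
    using U openin_subset[OF U(1)]
    by (intro is_chart_smaller[OF projective_curveD(2)[OF assms(1) U(4)]]) auto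
qed

lemma lproj_remove_points:
  assumes X: "projective_curve X" and Y: "projective_curve Y" and F: "finite F" "finite F'"
    and cont: "continuous_map (subtopology (ctop X) (points X - F)) (subtopology (ctop Y) (points Y - F')) f"
    and x: "x \<in> points X - F"
  shows "lproj (remove_points X F) (remove_points Y F') f x \<longleftrightarrow> lproj X Y f x"
proof
  note opS = openin_cofinite[OF X F(1)] and opS' = openin_cofinite[OF Y F(2)]
  have fx: "f x \<in> points Y - F'"
    using continuous_map_funspace[OF cont] x by auto
  assume L: "lproj (remove_points X F) (remove_points Y F') f x"
  show "lproj X Y f x" unfolding lproj_def
  proof (intro allI impI)
    fix U \<phi> V \<psi> assume c: "(U, \<phi>) \<in> atlas X" "(V, \<psi>) \<in> atlas Y" "x \<in> U" "f x \<in> V"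
    obtain W0 where W0: "openin (ctop X) W0" "x \<in> W0" "W0 \<subseteq> U" "W0 \<subseteq> points X - F" "open_interval (\<phi> ` W0)"
      using small_chart[OF projective_curveD(2)[OF X c(1)] opS c(3) x] by blast
    obtain V0 where V0: "openin (ctop Y) V0" "f x \<in> V0" "V0 \<subseteq> V" "V0 \<subseteq> points Y - F'" "open_interval (\<psi> ` V0)"
      using small_chart[OF projective_curveD(2)[OF Y c(2)] opS' c(4) fx] by blast
    have a: "(W0, \<phi>) \<in> atlas (remove_points X F)" "(V0, \<psi>) \<in> atlas (remove_points Y F')"
      using W0 V0 c by (auto simp: atlas_remove_points)
    obtain W A where W: "openin (ctop (remove_points X F)) W" "x \<in> W" "invertible A"
       "\<And>y. y\<in>W \<inter> W0 \<Longrightarrow> f y \<in> V0 \<Longrightarrow> \<psi> (f y) = ((*v) A) ` \<phi> y"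
      using L[unfolded lproj_def, rule_format, OF a W0(2) V0(2)] by blast
    have opW: "openin (ctop X) W" using W(1) openin_open_subtopology[OF opS] by auto
    have "openin (subtopology (ctop Y) (points Y - F')) V0"
      using V0(1,4) openin_open_subtopology[OF opS'] by blast
    from openin_continuous_map_preimage[OF cont this]
    have "openin (ctop X) {y \<in> points X - F. f y \<in> V0}"
      using openin_open_subtopology[OF opS] by (simp add: Int_absorb1)
    then have "openin (ctop X) (W \<inter> W0 \<inter> {y \<in> points X - F. f y \<in> V0})"
      using opW W0(1) by (intro openin_Int)
    then show "\<exists>W A. openin (ctop X) W \<and> x \<in> W \<and> invertible A \<and>
       (\<forall>y\<in>W \<inter> U. f y \<in> V \<longrightarrow> \<psi> (f y) = ((*v) A) ` \<phi> y)"
      using W W0 V0 x by (intro exI[of _ "W \<inter> W0 \<inter> {y \<in> points X - F. f y \<in> V0}"] exI[of _ A]) auto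
  qed
next
  assume L: "lproj X Y f x"
  show "lproj (remove_points X F) (remove_points Y F') f x" unfolding lproj_def
  proof (intro allI impI)
    fix W0 \<phi> V0 \<psi> assume c: "(W0, \<phi>) \<in> atlas (remove_points X F)"
      "(V0, \<psi>) \<in> atlas (remove_points Y F')" "x \<in> W0" "f x \<in> V0"
    then obtain U V where UV: "(U, \<phi>) \<in> atlas X" "W0 \<subseteq> U" "(V, \<psi>) \<in> atlas Y" "V0 \<subseteq> V"
      by (auto simp: atlas_remove_points)
    have xU: "x \<in> U" "f x \<in> V" using c UV by auto
    obtain W A where W: "openin (ctop X) W" "x \<in> W" "invertible A"
       "\<And>y. y\<in>W \<inter> U \<Longrightarrow> f y \<in> V \<Longrightarrow> \<psi> (f y) = ((*v) A) ` \<phi> y"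
      using L[unfolded lproj_def, rule_format, OF UV(1,3) xU] by blast
    have "openin (ctop (remove_points X F)) (W \<inter> (points X - F))"
      using W(1) unfolding remove_points_simps openin_subtopology by blast
    then show "\<exists>W A. openin (ctop (remove_points X F)) W \<and> x \<in> W \<and> invertible A \<and>
       (\<forall>y\<in>W \<inter> W0. f y \<in> V0 \<longrightarrow> \<psi> (f y) = ((*v) A) ` \<phi> y)"
      using W x UV by (intro exI[of _ "W \<inter> (points X - F)"] exI[of _ A]) auto
  qed
qed

lemma projective_iso_remove_points:
  assumes X: "projective_curve X" and Y: "projective_curve Y" and F: "finite F" "finite F'"
  shows "projective_iso (remove_points X F) (remove_points Y F') f \<longleftrightarrow>
    pw_iso_on X Y (points X - F) (points Y - F') f"
proof -
  have iff: "projective_iso (remove_points X F) (remove_points Y F') f \<longleftrightarrow>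
    homeomorphic_map (ctop (remove_points X F)) (ctop (remove_points Y F')) f \<and>
    (\<forall>x\<in>points (remove_points X F). lproj (remove_points X F) (remove_points Y F') f x)"
    by (rule projective_iso_lproj) (rule is_chart_remove_points[OF X])
  show ?thesis
  proof (cases "homeomorphic_map (subtopology (ctop X) (points X - F))
      (subtopology (ctop Y) (points Y - F')) f")
    case True
    note eq = lproj_remove_points[OF X Y F homeomorphic_imp_continuous_map[OF True]]
    show ?thesis unfolding iff remove_points_simps(2) unfolding remove_points_simps(1) pw_iso_on_def
      using True eq by simp
  next
    case False
    then show ?thesis
      unfolding iff remove_points_simps(2) unfolding remove_points_simps(1) pw_iso_on_def by simp
  qed
qed

definition cofin :: "'a pcurve \<Rightarrow> 'a set \<Rightarrow> bool" where
  "cofin X S \<longleftrightarrow> S \<subseteq> points X \<and> finite (points X - S)"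

lemma openin_cofin: "projective_curve X \<Longrightarrow> cofin X S \<Longrightarrow> openin (ctop X) S"
proof -
  assume X: "projective_curve X" and S: "cofin X S"
  have "finite (points X - S)" "points X - (points X - S) = S" using S by (auto simp: cofin_def)
  with openin_cofinite[OF X this(1)] show "openin (ctop X) S" by (simp only:)
qed

lemma pw_rep_iff:
  assumes "projective_curve X" "projective_curve Y"
  shows "pw_rep X Y f \<longleftrightarrow> (\<exists>S S'. cofin X S \<and> cofin Y S' \<and> pw_iso_on X Y S S' f)"
proof
  assume "pw_rep X Y f"
  then obtain F F' where F: "finite F" "F \<subseteq> points X" "finite F'" "F' \<subseteq> points Y"
    "projective_iso (remove_points X F) (remove_points Y F') f" unfolding pw_rep_def by blast
  then have "pw_iso_on X Y (points X - F) (points Y - F') f"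
    using projective_iso_remove_points[OF assms] by blast
  moreover have "cofin X (points X - F)" "cofin Y (points Y - F')"
    using F by (auto simp: cofin_def double_diff)
  ultimately show "\<exists>S S'. cofin X S \<and> cofin Y S' \<and> pw_iso_on X Y S S' f" by blast
next
  assume "\<exists>S S'. cofin X S \<and> cofin Y S' \<and> pw_iso_on X Y S S' f"
  then obtain S S' where S: "cofin X S" "cofin Y S'" "pw_iso_on X Y S S' f" by blast
  then have "points X - (points X - S) = S" "points Y - (points Y - S') = S'"
    by (auto simp: cofin_def)
  then have "projective_iso (remove_points X (points X - S)) (remove_points Y (points Y - S')) f"
    using projective_iso_remove_points[OF assms, of "points X - S" "points Y - S'"] S
    by (simp add: cofin_def)
  with S show "pw_rep X Y f" unfolding pw_rep_def cofin_def
    by (intro exI[of _ "points X - S"] exI[of _ "points Y - S'"]) auto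
qed

lemma pw_iso_onD:
  assumes "pw_iso_on X Y S S' f" "S \<subseteq> points X" "S' \<subseteq> points Y"
  shows "inj_on f S" "f ` S = S'"
proof -
  have h: "homeomorphic_map (subtopology (ctop X) S) (subtopology (ctop Y) S') f"
    using assms(1) by (simp add: pw_iso_on_def)
  have t: "topspace (subtopology (ctop X) S) = S" "topspace (subtopology (ctop Y) S') = S'"
    using assms by auto
  show "inj_on f S" using homeomorphic_imp_injective_map[OF h] unfolding t .
  show "f ` S = S'" using homeomorphic_imp_surjective_map[OF h] unfolding t .
qed

lemma pw_iso_on_restrict:
  assumes "pw_iso_on X Y S S' f" "S \<subseteq> points X" "S' \<subseteq> points Y" "R \<subseteq> S" "R' = f ` R"
  shows "pw_iso_on X Y R R' f"
proof -
  have R': "R' \<subseteq> S'" using pw_iso_onD(2)[OF assms(1-3)] assms by auto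
  have h: "homeomorphic_map (subtopology (ctop X) S) (subtopology (ctop Y) S') f"
    using assms by (simp add: pw_iso_on_def)
  have "f ` (topspace (subtopology (ctop X) S) \<inter> R) = topspace (subtopology (ctop Y) S') \<inter> R'"
    using assms R' by auto
  from homeomorphic_map_subtopologies[OF h this]
  show ?thesis using assms R' by (auto simp: pw_iso_on_def subtopology_subtopology Int_absorb1)
qed

lemma cofin_image:
  assumes "pw_iso_on X Y S S' f" "cofin X S" "cofin Y S'" "cofin X R" "R \<subseteq> S"
  shows "cofin Y (f ` R)"
proof -
  have f: "f ` S = S'" using assms by (intro pw_iso_onD(2)) (auto simp: cofin_def)
  then have "points Y - f ` R \<subseteq> (points Y - S') \<union> f ` (points X - R)"
    using assms by (auto simp: cofin_def)
  then have "finite (points Y - f ` R)"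
    using assms by (meson cofin_def finite_Un finite_imageI finite_subset)
  then show ?thesis using f assms by (auto simp: cofin_def)
qed

lemma cofin_preimage:
  assumes "pw_iso_on X Y S S' f" "cofin X S" "cofin Y S'" "cofin Y R"
  shows "cofin X {x \<in> S. f x \<in> R}"
proof -
  have sub: "S \<subseteq> points X" "S' \<subseteq> points Y" using assms by (auto simp: cofin_def)
  have f: "inj_on f S" "f ` S = S'" using pw_iso_onD[OF assms(1) sub] by auto
  have "finite {x \<in> S. f x \<in> points Y - R}"
    using finite_vimage_IntI[OF _ f(1), of "points Y - R"] assms
    by (simp add: cofin_def vimage_def Int_def conj_commute)
  moreover have "points X - {x \<in> S. f x \<in> R} \<subseteq> (points X - S) \<union> {x \<in> S. f x \<in> points Y - R}"
    using f assms by (auto simp: cofin_def)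
  ultimately have "finite (points X - {x \<in> S. f x \<in> R})"
    using assms by (meson cofin_def finite_Un finite_subset)
  then show ?thesis using assms by (auto simp: cofin_def)
qed

lemma lproj_compose:
  assumes Y: "projective_curve Y" and f: "lproj X Y f x" and g: "lproj Y Z g (f x)"
    and S: "openin (ctop X) S" "x \<in> S" and cont: "continuous_map (subtopology (ctop X) S) (ctop Y) f"
  shows "lproj X Z (g \<circ> f) x"
  unfolding lproj_def
proof (intro allI impI)
  fix U \<phi> V \<psi> assume c: "(U, \<phi>) \<in> atlas X" "(V, \<psi>) \<in> atlas Z" "x \<in> U" "(g \<circ> f) x \<in> V"
  have SX: "S \<subseteq> points X" using openin_subset[OF S(1)] .
  have "f x \<in> points Y" using continuous_map_funspace[OF cont] S SX by auto
  then obtain C \<xi> where C: "(C, \<xi>) \<in> atlas Y" "f x \<in> C" using projective_curveD(3)[OF Y] by blast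
  have opC: "openin (ctop Y) C" using projective_curveD(2)[OF Y C(1)] by (simp add: is_chart_def)
  obtain W1 A1 where W1: "openin (ctop X) W1" "x \<in> W1" "invertible A1"
    "\<And>y. y\<in>W1 \<inter> U \<Longrightarrow> f y \<in> C \<Longrightarrow> \<xi> (f y) = ((*v) A1) ` \<phi> y"
    using f[unfolded lproj_def, rule_format, OF c(1) C(1) c(3) C(2)] by blast
  obtain W2 A2 where W2: "openin (ctop Y) W2" "f x \<in> W2" "invertible A2"
    "\<And>y. y\<in>W2 \<inter> C \<Longrightarrow> g y \<in> V \<Longrightarrow> \<psi> (g y) = ((*v) A2) ` \<xi> y"
    using g[unfolded lproj_def, rule_format, OF C(1) c(2) C(2)] c(4) unfolding comp_def by blast
  let ?W = "W1 \<inter> {y \<in> S. f y \<in> W2 \<inter> C}"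
  have "openin (subtopology (ctop X) S) {y \<in> topspace (subtopology (ctop X) S). f y \<in> W2 \<inter> C}"
    using cont by (rule openin_continuous_map_preimage) (rule openin_Int[OF W2(1) opC])
  then have "openin (ctop X) {y \<in> S. f y \<in> W2 \<inter> C}"
    using openin_open_subtopology[OF S(1)] SX by (simp add: Int_absorb1)
  then have "openin (ctop X) ?W" using W1(1) by (rule openin_Int[rotated])
  moreover have "\<psi> ((g \<circ> f) y) = ((*v) (A2 ** A1)) ` \<phi> y" if "y \<in> ?W \<inter> U" "(g \<circ> f) y \<in> V" for y
  proof -
    have "\<psi> (g (f y)) = ((*v) A2) ` ((*v) A1) ` \<phi> y"
      using that W1(4)[of y] W2(4)[of "f y"] by simp
    then show ?thesis by (simp add: image_image matrix_vector_mul_assoc)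
  qed
  moreover have "invertible (A2 ** A1)" using W1(3) W2(3) by (rule invertible_mult[rotated])
  ultimately show "\<exists>W A. openin (ctop X) W \<and> x \<in> W \<and> invertible A \<and>
       (\<forall>y\<in>W \<inter> U. (g \<circ> f) y \<in> V \<longrightarrow> \<psi> ((g \<circ> f) y) = ((*v) A) ` \<phi> y)"
    using W1(2) W2(2) S(2) C(2) by (intro exI[of _ ?W] exI[of _ "A2 ** A1"]) auto
qed

lemma lproj_cong:
  assumes "lproj X Y f x" "openin (ctop X) S" "x \<in> S" "\<And>y. y \<in> S \<Longrightarrow> f y = g y"
  shows "lproj X Y g x"
  unfolding lproj_def
proof (intro allI impI)
  fix U \<phi> V \<psi> assume c: "(U, \<phi>) \<in> atlas X" "(V, \<psi>) \<in> atlas Y" "x \<in> U" "g x \<in> V"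
  have "f x \<in> V" using c assms by simp
  then obtain W A where W: "openin (ctop X) W" "x \<in> W" "invertible A"
    "\<And>y. y\<in>W \<inter> U \<Longrightarrow> f y \<in> V \<Longrightarrow> \<psi> (f y) = ((*v) A) ` \<phi> y"
    using assms(1)[unfolded lproj_def, rule_format, OF c(1-3)] by blast
  then show "\<exists>W A. openin (ctop X) W \<and> x \<in> W \<and> invertible A \<and>
       (\<forall>y\<in>W \<inter> U. g y \<in> V \<longrightarrow> \<psi> (g y) = ((*v) A) ` \<phi> y)"
    using assms(2,3) assms(4)[symmetric] by (intro exI[of _ "W \<inter> S"] exI[of _ A]) auto
qed

lemma pw_rep_compose:
  assumes X: "projective_curve X" and Y: "projective_curve Y" and Z: "projective_curve Z"
    and f: "pw_rep X Y f" and g: "pw_rep Y Z g"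
  shows "pw_rep X Z (g \<circ> f)"
proof -
  obtain S S' where S: "cofin X S" "cofin Y S'" "pw_iso_on X Y S S' f"
    using f pw_rep_iff[OF X Y] by blast
  obtain T T' where T: "cofin Y T" "cofin Z T'" "pw_iso_on Y Z T T' g"
    using g pw_rep_iff[OF Y Z] by blast
  have sub: "S \<subseteq> points X" "S' \<subseteq> points Y" "T \<subseteq> points Y" "T' \<subseteq> points Z"
    using S T by (auto simp: cofin_def)
  define R where "R = {x \<in> S. f x \<in> T}"
  have R: "cofin X R" unfolding R_def by (rule cofin_preimage[OF S(3,1,2) T(1)])
  have fR: "cofin Y (f ` R)" by (rule cofin_image[OF S(3,1,2) R]) (auto simp: R_def)
  have fRT: "f ` R \<subseteq> T" by (auto simp: R_def)
  have gfR: "cofin Z (g ` f ` R)" by (rule cofin_image[OF T(3,1,2) fR fRT])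
  have 1: "pw_iso_on X Y R (f ` R) f"
    using pw_iso_on_restrict[OF S(3) sub(1,2)] by (auto simp: R_def)
  have 2: "pw_iso_on Y Z (f ` R) (g ` f ` R) g"
    by (rule pw_iso_on_restrict[OF T(3) sub(3,4) fRT refl])
  have cont: "continuous_map (subtopology (ctop X) R) (ctop Y) f"
    using 1 homeomorphic_imp_continuous_map continuous_map_in_subtopology
    unfolding pw_iso_on_def by blast
  have "pw_iso_on X Z R (g ` f ` R) (g \<circ> f)"
    unfolding pw_iso_on_def
  proof (intro conjI ballI)
    show "homeomorphic_map (subtopology (ctop X) R) (subtopology (ctop Z) (g ` f ` R)) (g \<circ> f)"
      using 1 2 homeomorphic_map_compose unfolding pw_iso_on_def by blast
    show "lproj X Z (g \<circ> f) x" if "x \<in> R" for x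
      using that 1 2 by (intro lproj_compose[OF Y _ _ openin_cofin[OF X R] _ cont])
        (auto simp: pw_iso_on_def)
  qed
  then show ?thesis using pw_rep_iff[OF X Z] R gfR by blast
qed

lemma agree_cofin: "agree X f g \<longleftrightarrow> cofin X {x \<in> points X. f x = g x}"
proof -
  have "points X - {x \<in> points X. f x = g x} = {x \<in> points X. f x \<noteq> g x}" by auto
  then show ?thesis by (auto simp: agree_def cofin_def)
qed

lemma cofin_Int: "cofin X S \<Longrightarrow> cofin X T \<Longrightarrow> cofin X (S \<inter> T)"
  by (auto simp: cofin_def Diff_Int)

lemma cofin_mono: "cofin X S \<Longrightarrow> S \<subseteq> T \<Longrightarrow> T \<subseteq> points X \<Longrightarrow> cofin X T"
  unfolding cofin_def by (auto elim: finite_subset[rotated])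

lemma agreeI: "cofin X S \<Longrightarrow> (\<And>x. x \<in> S \<Longrightarrow> f x = g x) \<Longrightarrow> agree X f g"
  unfolding agree_cofin by (rule cofin_mono, assumption) (auto simp: cofin_def)

lemma agree_refl [simp]: "agree X f f" by (simp add: agree_def)
lemma agree_sym: "agree X f g \<Longrightarrow> agree X g f" by (simp add: agree_def eq_commute)
lemma agree_trans: "agree X f g \<Longrightarrow> agree X g h \<Longrightarrow> agree X f h"
  unfolding agree_cofin[of X f g] agree_cofin[of X g h]
  by (drule (1) cofin_Int, erule agreeI) simp

lemma pw_rep_agree:
  assumes X: "projective_curve X" and Y: "projective_curve Y"
    and f: "pw_rep X Y f" and fg: "agree X f g"
  shows "pw_rep X Y g"
proof -
  obtain S S' where S: "cofin X S" "cofin Y S'" "pw_iso_on X Y S S' f"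
    using f pw_rep_iff[OF X Y] by blast
  have sub: "S \<subseteq> points X" "S' \<subseteq> points Y" using S by (auto simp: cofin_def)
  define R where "R = S \<inter> {x \<in> points X. f x = g x}"
  have R: "cofin X R" unfolding R_def using cofin_Int[OF S(1)] fg agree_cofin by blast
  have RS: "R \<subseteq> S" and eq: "\<And>x. x \<in> R \<Longrightarrow> f x = g x" by (auto simp: R_def)
  have 1: "pw_iso_on X Y R (f ` R) f" by (rule pw_iso_on_restrict[OF S(3) sub RS refl])
  have "pw_iso_on X Y R (f ` R) g" unfolding pw_iso_on_def
  proof (intro conjI ballI)
    have "homeomorphic_map (subtopology (ctop X) R) (subtopology (ctop Y) (f ` R)) f"
      using 1 by (simp add: pw_iso_on_def)
    then show "homeomorphic_map (subtopology (ctop X) R) (subtopology (ctop Y) (f ` R)) g"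
      by (rule homeomorphic_map_eq) (simp add: eq)
    show "lproj X Y g x" if "x \<in> R" for x
    proof (rule lproj_cong[OF _ openin_cofin[OF X R] that])
      show "lproj X Y f x" using 1 that by (simp add: pw_iso_on_def)
    qed (rule eq)
  qed
  then show ?thesis using pw_rep_iff[OF X Y] R cofin_image[OF S(3,1,2) R RS] by blast
qed

lemma agree_compose:
  assumes X: "projective_curve X" and Y: "projective_curve Y"
    and f: "pw_rep X Y f" and ff: "agree X f f'" and gg: "agree Y g g'"
  shows "agree X (g \<circ> f) (g' \<circ> f')"
proof -
  obtain S S' where S: "cofin X S" "cofin Y S'" "pw_iso_on X Y S S' f"
    using f pw_rep_iff[OF X Y] by blast
  have "cofin X ({x \<in> S. f x \<in> {y \<in> points Y. g y = g' y}} \<inter> {x \<in> points X. f x = f' x})"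
    using cofin_Int cofin_preimage[OF S(3,1,2)] ff gg unfolding agree_cofin by blast
  then show ?thesis by (rule agreeI) auto
qed

lemma pw_rep_inverse:
  assumes X: "projective_curve X" and Y: "projective_curve Y" and f: "pw_rep X Y f"
  shows "\<exists>g. pw_rep Y X g \<and> agree X (g \<circ> f) id \<and> agree Y (f \<circ> g) id"
proof -
  obtain S S' where S: "cofin X S" "cofin Y S'" "pw_iso_on X Y S S' f"
    using f pw_rep_iff[OF X Y] by blast
  have sub: "S \<subseteq> points X" "S' \<subseteq> points Y" using S by (auto simp: cofin_def)
  have f: "inj_on f S" "f ` S = S'" using pw_iso_onD[OF S(3) sub] by auto
  have h: "homeomorphic_map (subtopology (ctop X) S) (subtopology (ctop Y) S') f"
    using S by (simp add: pw_iso_on_def)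
  then obtain g where g: "homeomorphic_maps (subtopology (ctop X) S) (subtopology (ctop Y) S') f g"
    using homeomorphic_map_maps by blast
  have gf: "\<And>x. x \<in> S \<Longrightarrow> g (f x) = x" and fg: "\<And>y. y \<in> S' \<Longrightarrow> f (g y) = y"
    using g sub by (auto simp: homeomorphic_maps_def)
  have opS: "openin (ctop X) S" and opS': "openin (ctop Y) S'"
    using openin_cofin S X Y by auto
  have "pw_iso_on Y X S' S g" unfolding pw_iso_on_def
  proof (intro conjI ballI)
    show "homeomorphic_map (subtopology (ctop Y) S') (subtopology (ctop X) S) g"
      using g homeomorphic_maps_sym homeomorphic_maps_map by blast
    fix y assume "y \<in> S'"
    then obtain x where x: "x \<in> S" "y = f x" using f by blast
    then have gy: "g y = x" using gf by simp
    have l: "lproj X Y f x" using S(3) x by (simp add: pw_iso_on_def)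
    show "lproj Y X g y" unfolding lproj_def
    proof (intro allI impI)
      fix V \<psi> U \<phi> assume c: "(V, \<psi>) \<in> atlas Y" "(U, \<phi>) \<in> atlas X" "y \<in> V" "g y \<in> U"
      have xU: "x \<in> U" "f x \<in> V" using c x gy by auto
      obtain W A where W: "openin (ctop X) W" "x \<in> W" "invertible A"
        "\<And>z. z\<in>W \<inter> U \<Longrightarrow> f z \<in> V \<Longrightarrow> \<psi> (f z) = ((*v) A) ` \<phi> z"
        using l[unfolded lproj_def, rule_format, OF c(2,1) xU] by blast
      have opU: "openin (ctop X) U" using projective_curveD(2)[OF X c(2)] by (simp add: is_chart_def)
      have "openin (subtopology (ctop X) S) (W \<inter> U \<inter> S)"
        using W(1) opU by (meson openin_Int openin_subtopology)
      then have "openin (subtopology (ctop Y) S') (f ` (W \<inter> U \<inter> S))"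
        using homeomorphic_imp_open_map[OF h] by (simp add: open_map_def)
      then have op: "openin (ctop Y) (f ` (W \<inter> U \<inter> S))"
        using openin_open_subtopology[OF opS'] by blast
      obtain B where B: "B ** A = mat 1" "A ** B = mat 1" using W(3) unfolding invertible_def by blast
      have iB: "invertible B" using B unfolding invertible_def by blast
      have "\<phi> (g z) = ((*v) B) ` \<psi> z" if "z \<in> f ` (W \<inter> U \<inter> S)" "z \<in> V" for z
      proof -
        obtain u where u: "u \<in> W \<inter> U \<inter> S" "z = f u" using \<open>z \<in> f ` (W \<inter> U \<inter> S)\<close> by blast
        have "\<psi> z = ((*v) A) ` \<phi> u" using W(4)[of u] u \<open>z \<in> V\<close> by auto
        moreover have "g z = u" using u gf by auto
        ultimately show ?thesis by (simp add: image_image matrix_vector_mul_assoc B)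
      qed
      then show "\<exists>W A. openin (ctop Y) W \<and> y \<in> W \<and> invertible A \<and>
          (\<forall>z\<in>W \<inter> V. g z \<in> U \<longrightarrow> \<phi> (g z) = ((*v) A) ` \<psi> z)"
        using op iB x W(2) c(4) gy by (intro exI[of _ "f ` (W \<inter> U \<inter> S)"] exI[of _ B]) auto
    qed
  qed
  then have "pw_rep Y X g" using pw_rep_iff[OF Y X] S by blast
  moreover have "agree X (g \<circ> f) id" by (rule agreeI[OF S(1)]) (simp add: gf)
  moreover have "agree Y (f \<circ> g) id" by (rule agreeI[OF S(2)]) (simp add: fg)
  ultimately show ?thesis by blast
qed

lemma pw_rep_id:
  assumes "projective_curve X" shows "pw_rep X X id"
proof -
  have "pw_iso_on X X (points X) (points X) id"
    using lproj_id[OF assms] by (simp add: pw_iso_on_def homeomorphic_map_id)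
  moreover have "cofin X (points X)" by (simp add: cofin_def)
  ultimately show ?thesis using pw_rep_iff[OF assms assms] by blast
qed

lemma pw_class_cong: "agree X f g \<Longrightarrow> pw_class X Y f = pw_class X Y g"
  unfolding pw_class_def by (auto intro: agree_trans agree_sym)

lemma pw_class_eq_iff:
  assumes "pw_rep X Y f"
  shows "pw_class X Y f = pw_class X Y g \<longleftrightarrow> agree X f g"
proof
  have "f \<in> pw_class X Y f" using assms by (simp add: pw_class_def)
  moreover assume "pw_class X Y f = pw_class X Y g"
  ultimately have "f \<in> pw_class X Y g" by (simp only:)
  then have "agree X g f" by (simp add: pw_class_def)
  then show "agree X f g" by (rule agree_sym)
qed (rule pw_class_cong)

lemma pw_comp_class:
  assumes X: "projective_curve X" and Y: "projective_curve Y" and Z: "projective_curve Z"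
    and f: "pw_rep X Y f" and g: "pw_rep Y Z g"
  shows "pw_comp X Z (pw_class Y Z g) (pw_class X Y f) = pw_class X Z (g \<circ> f)"
proof (intro equalityI subsetI)
  fix h assume "h \<in> pw_comp X Z (pw_class Y Z g) (pw_class X Y f)"
  then obtain g' f' where h: "pw_rep X Z h" "agree Y g g'" "agree X f f'" "agree X h (g' \<circ> f')"
    by (auto simp: pw_comp_def pw_class_def)
  have "agree X (g \<circ> f) (g' \<circ> f')" by (rule agree_compose[OF X Y f h(3,2)])
  with h show "h \<in> pw_class X Z (g \<circ> f)"
    by (auto simp: pw_class_def intro: agree_trans agree_sym)
next
  fix h assume "h \<in> pw_class X Z (g \<circ> f)"
  then show "h \<in> pw_comp X Z (pw_class Y Z g) (pw_class X Y f)"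
    using f g unfolding pw_comp_def pw_class_def by (auto dest: agree_sym) (meson agree_refl agree_sym)
qed

lemma pw_inverse_class:
  assumes X: "projective_curve X" and Y: "projective_curve Y"
    and f: "pw_rep X Y f" and g: "pw_rep Y X g" and gf: "agree X (g \<circ> f) id"
  shows "pw_inverse X Y (pw_class X Y f) = pw_class Y X g"
proof -
  obtain k where k: "pw_rep Y X k" "agree X (k \<circ> f) id" "agree Y (f \<circ> k) id"
    using pw_rep_inverse[OF X Y f] by blast
  have uniq: "agree Y k g'" if g': "agree X (g' \<circ> f') id" and ff: "agree X f f'" for g' f'
  proof -
    have "agree X (g' \<circ> f) (g' \<circ> f')" by (rule agree_compose[OF X Y f ff agree_refl])
    then have "agree X (g' \<circ> f) id" using g' agree_trans by blast
    then have "agree Y (g' \<circ> f \<circ> k) (id \<circ> k)" by (rule agree_compose[OF Y X k(1) agree_refl])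
    moreover obtain S S' where S: "cofin Y S" "cofin X S'" "pw_iso_on Y X S S' k"
      using k pw_rep_iff[OF Y X] by blast
    moreover have "agree Y (g' \<circ> f \<circ> k) g'"
      using k(3) unfolding agree_cofin[of Y "f \<circ> k"] by (rule agreeI) auto
    ultimately show ?thesis using agree_trans agree_sym by (metis id_o)
  qed
  have kg: "agree Y k g" using uniq[OF gf agree_refl] .
  show ?thesis
  proof (intro equalityI subsetI)
    fix g' assume "g' \<in> pw_inverse X Y (pw_class X Y f)"
    then obtain f' where "pw_rep Y X g'" "agree X f f'" "agree X (g' \<circ> f') id"
      by (auto simp: pw_inverse_def pw_class_def)
    then show "g' \<in> pw_class Y X g"
      using uniq kg by (auto simp: pw_class_def intro: agree_trans agree_sym)
  next
    fix g' assume "g' \<in> pw_class Y X g"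
    then have g': "pw_rep Y X g'" "agree Y g g'" by (auto simp: pw_class_def)
    have "agree X (g \<circ> f) (g' \<circ> f)" by (rule agree_compose[OF X Y f agree_refl g'(2)])
    then have "agree X (g' \<circ> f) id" using gf by (blast intro: agree_trans agree_sym)
    then show "g' \<in> pw_inverse X Y (pw_class X Y f)"
      using g' f by (auto simp: pw_inverse_def pw_class_def)
  qed
qed

lemma group_PC_Proj:
  assumes X: "projective_curve X"
  shows "group (PC_Proj X)"
proof (rule groupI)
  note comp = pw_comp_class[OF X X X] and rep = pw_rep_compose[OF X X X]
  fix x y assume "x \<in> carrier (PC_Proj X)" "y \<in> carrier (PC_Proj X)"
  then obtain f g where fg: "pw_rep X X f" "pw_rep X X g" "x = pw_class X X f" "y = pw_class X X g"
    by (auto simp: PC_Proj_def pw_isos_def)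
  then show "x \<otimes>\<^bsub>PC_Proj X\<^esub> y \<in> carrier (PC_Proj X)"
    using comp rep by (auto simp: PC_Proj_def pw_isos_def)
  fix z assume "z \<in> carrier (PC_Proj X)"
  then obtain h where h: "pw_rep X X h" "z = pw_class X X h"
    by (auto simp: PC_Proj_def pw_isos_def)
  show "x \<otimes>\<^bsub>PC_Proj X\<^esub> y \<otimes>\<^bsub>PC_Proj X\<^esub> z = x \<otimes>\<^bsub>PC_Proj X\<^esub> (y \<otimes>\<^bsub>PC_Proj X\<^esub> z)"
    using fg h by (simp add: PC_Proj_def comp rep comp_assoc)
next
  show "\<one>\<^bsub>PC_Proj X\<^esub> \<in> carrier (PC_Proj X)"
    using pw_rep_id[OF X] by (auto simp: PC_Proj_def pw_isos_def)
next
  fix x assume "x \<in> carrier (PC_Proj X)"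
  then obtain f where f: "pw_rep X X f" "x = pw_class X X f"
    by (auto simp: PC_Proj_def pw_isos_def)
  show "\<one>\<^bsub>PC_Proj X\<^esub> \<otimes>\<^bsub>PC_Proj X\<^esub> x = x"
    using f pw_rep_id[OF X] by (simp add: PC_Proj_def pw_comp_class[OF X X X])
  obtain g where "pw_rep X X g" "agree X (g \<circ> f) id" using pw_rep_inverse[OF X X f(1)] by blast
  then show "\<exists>y\<in>carrier (PC_Proj X). y \<otimes>\<^bsub>PC_Proj X\<^esub> x = \<one>\<^bsub>PC_Proj X\<^esub>"
    using f by (intro bexI[of _ "pw_class X X g"])
      (auto simp: PC_Proj_def pw_comp_class[OF X X X] pw_isos_def pw_class_cong)
qed


section \<open>The circle is a projectively modeled curve\<close>

lemma coset_eq_iff: "coset x = coset y \<longleftrightarrow> (\<exists>k::int. y = x + of_int k)"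
proof
  assume "coset x = coset y"
  moreover have "y \<in> coset y" unfolding coset_def by (auto intro!: exI[of _ 0])
  ultimately show "\<exists>k::int. y = x + of_int k" by (auto simp: coset_def)
next
  assume "\<exists>k::int. y = x + of_int k"
  then obtain k :: int where k: "y = x + of_int k" by blast
  show "coset x = coset y"
  proof (intro equalityI subsetI)
    fix z assume "z \<in> coset x"
    then obtain j :: int where "z = x + of_int j" by (auto simp: coset_def)
    then have "z = y + of_int (j - k)" using k by simp
    then show "z \<in> coset y" unfolding coset_def by blast
  next
    fix z assume "z \<in> coset y"
    then obtain j :: int where "z = y + of_int j" by (auto simp: coset_def)
    then have "z = x + of_int (j + k)" using k by simp
    then show "z \<in> coset x" unfolding coset_def by blast
  qed
qed

lemma openin_circle: "openin (ctop circle) U \<longleftrightarrow> U \<subseteq> range coset \<and> open (coset -` U)"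
proof -
  have "istopology (\<lambda>U. U \<subseteq> range coset \<and> open (coset -` U))"
    unfolding istopology_def
  proof (intro conjI allI impI)
    fix S T :: "real set set"
    assume "S \<subseteq> range coset \<and> open (coset -` S)" "T \<subseteq> range coset \<and> open (coset -` T)"
    then show "S \<inter> T \<subseteq> range coset" "open (coset -` (S \<inter> T))" by (auto simp: vimage_Int)
  next
    fix K :: "real set set set"
    assume K: "\<forall>S\<in>K. S \<subseteq> range coset \<and> open (coset -` S)"
    then show "\<Union>K \<subseteq> range coset" "open (coset -` \<Union>K)" by (auto simp: vimage_Union)
  qed
  then show ?thesis unfolding circle_def by simp
qed

lemma points_circle: "points circle = range coset"
proof
  show "points circle \<subseteq> range coset" using openin_topspace[of "ctop circle"] openin_circle by blast
  have "coset -` range coset = UNIV" by auto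
  then have "openin (ctop circle) (range coset)" unfolding openin_circle by simp
  then show "range coset \<subseteq> points circle" by (rule openin_subset)
qed

lemma openin_circle_image:
  assumes "open S" shows "openin (ctop circle) (coset ` S)"
proof -
  have "coset -` coset ` S = (\<Union>k::int. (\<lambda>x. x + of_int k) ` S)"
  proof (intro equalityI subsetI)
    fix x assume "x \<in> coset -` coset ` S"
    then obtain y where y: "y \<in> S" "coset y = coset x" by auto
    then show "x \<in> (\<Union>k::int. (\<lambda>x. x + of_int k) ` S)" unfolding coset_eq_iff by blast
  next
    fix x assume "x \<in> (\<Union>k::int. (\<lambda>x. x + of_int k) ` S)"
    then obtain y and k :: int where y: "y \<in> S" "x = y + of_int k" by blast
    then have "coset y = coset x" unfolding coset_eq_iff by blast
    then show "x \<in> coset -` coset ` S" using y(1) by (metis image_eqI vimageI)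
  qed
  moreover have "open (\<Union>k::int. (\<lambda>x. x + of_int k) ` S)"
    using open_translation[OF assms] by (intro open_UN ballI) (simp add: add.commute[of _ "real_of_int _"])
  ultimately show ?thesis by (auto simp: openin_circle)
qed

lemma inj_on_coset:
  assumes "b \<le> a + 1" shows "inj_on coset {a<..<b}"
proof (rule inj_onI)
  fix x y assume xy: "x \<in> {a<..<b}" "y \<in> {a<..<b}" "coset x = coset y"
  then obtain k :: int where k: "y = x + of_int k" by (auto simp: coset_eq_iff)
  then have "\<bar>of_int k :: real\<bar> < 1" using xy assms by auto
  then have "k = 0" by linarith
  then show "x = y" using k by simp
qed

lemma coset_homeo:
  assumes "a < b" "b \<le> a + 1"
  shows "homeomorphic_map (top_of_set {a<..<b}) (subtopology (ctop circle) (coset ` {a<..<b})) coset"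
proof (rule bijective_open_imp_homeomorphic_map)
  have "continuous_map euclideanreal (ctop circle) coset"
    by (auto simp: continuous_map_def points_circle openin_circle vimage_def)
  then show "continuous_map (top_of_set {a<..<b}) (subtopology (ctop circle) (coset ` {a<..<b})) coset"
    by (auto simp: continuous_map_in_subtopology continuous_map_from_subtopology)
  show "open_map (top_of_set {a<..<b}) (subtopology (ctop circle) (coset ` {a<..<b})) coset"
    unfolding open_map_def
  proof (intro allI impI)
    fix U assume "openin (top_of_set {a<..<b}) U"
    then have U: "open U" "U \<subseteq> {a<..<b}"
      using openin_open_eq[OF open_greaterThanLessThan] by auto
    then have "coset ` U = coset ` U \<inter> coset ` {a<..<b}" by blast
    then show "openin (subtopology (ctop circle) (coset ` {a<..<b})) (coset ` U)"
      unfolding openin_subtopology using openin_circle_image[OF U(1)] by blast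
  qed
  show "coset ` topspace (top_of_set {a<..<b}) = topspace (subtopology (ctop circle) (coset ` {a<..<b}))"
    by (auto simp: points_circle)
  show "inj_on coset (topspace (top_of_set {a<..<b}))" using inj_on_coset assms by simp
qed

lemma is_chart_circle:
  assumes "a < b" "b \<le> a + 1"
  shows "is_chart (ctop circle) (coset ` {a<..<b}, \<lambda>z. affine_point (inv_into {a<..<b} coset z))"
proof -
  let ?J = "{a<..<b}" and ?inv = "inv_into {a<..<b} coset"
  have inv: "?inv (coset x) = x" if "x \<in> ?J" for x using inj_on_coset[OF assms(2)] that by simp
  have img: "(\<lambda>z. affine_point (?inv z)) ` coset ` ?J = affine_point ` ?J"
    using inv by (simp add: image_image)
  obtain g where g: "homeomorphic_maps (top_of_set ?J) (subtopology (ctop circle) (coset ` ?J)) coset g"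
    using coset_homeo[OF assms] homeomorphic_map_maps by blast
  then have gh: "homeomorphic_map (subtopology (ctop circle) (coset ` ?J)) (top_of_set ?J) g"
    using homeomorphic_maps_sym homeomorphic_maps_map by blast
  have gc: "g (coset x) = x" if "x \<in> ?J" for x using g that by (simp add: homeomorphic_maps_def)
  have "homeomorphic_map (subtopology (ctop circle) (coset ` ?J)) (top_of_set ?J) ?inv"
    by (rule homeomorphic_map_eq[OF gh]) (use gc inv in \<open>auto simp: points_circle\<close>)
  from homeomorphic_map_compose[OF this affine_point_homeo(1)[OF assms(1)]]
  have "homeomorphic_map (subtopology (ctop circle) (coset ` ?J)) (subtopology P1 (affine_point ` ?J))
     (\<lambda>z. affine_point (?inv z))" by (simp add: comp_def)
  then show ?thesis
    using openin_circle_image[of ?J] affine_point_homeo(2)[OF assms(1)] img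
    by (simp add: is_chart_def)
qed

lemma affine_point_translate:
  "\<exists>A::real^2^2. invertible A \<and> (\<forall>x. affine_point (x + t) = ((*v) A) ` affine_point x)"
proof -
  define A where "A t = (vector [vector [1, t], vector [0, 1]] :: real^2^2)" for t
  have Av: "A t *v v = vector [v$1 + t * v$2, v$2]" for t and v :: "real^2"
    by (simp add: A_def matrix_vector_mult_def vec_eq_iff forall_2 sum_2)
  have "A t ** A s = A (t + s)" for t s
    by (simp add: A_def matrix_matrix_mult_def vec_eq_iff forall_2 sum_2)
  moreover have "A 0 = mat 1" by (simp add: A_def mat_def vec_eq_iff forall_2)
  ultimately have "invertible (A t)" unfolding invertible_def
    by (intro exI[of _ "A (- t)"]) simp
  moreover have "affine_point (x + t) = ((*v) (A t)) ` affine_point x" for x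
  proof -
    have "((*v) (A t)) ` span {vector [x, 1]} = span (((*v) (A t)) ` {vector [x, 1]})"
      by (rule linear_span_image[symmetric]) (rule matrix_vector_mul_linear)
    then show ?thesis by (simp add: affine_point_def Av)
  qed
  ultimately show ?thesis by blast
qed

lemma projective_curve_circle: "projective_curve circle"
  unfolding projective_curve_def
proof (intro conjI ballI)
  show "Hausdorff_space (ctop circle)"
    unfolding Hausdorff_space_def
  proof (intro allI impI, elim conjE)
    fix p q assume "p \<in> points circle" "q \<in> points circle" "p \<noteq> q"
    then obtain x y0 where p: "p = coset x" and q0: "q = coset y0" by (auto simp: points_circle)
    define y where "y = y0 + of_int (- \<lfloor>y0 - x\<rfloor>)"
    have q: "q = coset y" unfolding q0 y_def coset_eq_iff by blast
    have "x \<noteq> y" using p q \<open>p \<noteq> q\<close> by auto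
    then have y: "x < y" "y < x + 1" unfolding y_def by linarith+
    define r where "r = min (y - x) (x + 1 - y) / 3"
    have r: "r > 0" "3 * r \<le> y - x" "3 * r \<le> x + 1 - y" using y by (auto simp: r_def)
    have "coset ` {x - r<..<x + r} \<inter> coset ` {y - r<..<y + r} = {}"
    proof (rule ccontr)
      assume "\<not> ?thesis"
      then obtain u v where uv: "u \<in> {x - r<..<x + r}" "v \<in> {y - r<..<y + r}" "coset u = coset v" by blast
      then obtain k :: int where k: "v = u + of_int k" by (auto simp: coset_eq_iff)
      have "(0::real) < of_int k" "(of_int k :: real) < 1" using uv(1,2) k r by simp_all
      then have "0 < k" "k < 1" by simp_all
      then show False by simp
    qed
    then have "disjnt (coset ` {x - r<..<x + r}) (coset ` {y - r<..<y + r})" by (simp add: disjnt_def)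
    moreover have "p \<in> coset ` {x - r<..<x + r}" "q \<in> coset ` {y - r<..<y + r}" using p q r by simp_all
    ultimately show "\<exists>U V. openin (ctop circle) U \<and> openin (ctop circle) V \<and> p \<in> U \<and> q \<in> V \<and> disjnt U V"
      using openin_circle_image[OF open_greaterThanLessThan] by blast
  qed
  show "is_chart (ctop circle) c" if "c \<in> atlas circle" for c
  proof -
    from that obtain a b where "a < b" "b \<le> a + 1"
      "c = (coset ` {a<..<b}, \<lambda>z. affine_point (inv_into {a<..<b} coset z))"
      unfolding circle_def by auto
    with is_chart_circle[OF this(1,2)] show ?thesis by (simp only:)
  qed
  show "(\<Union>c\<in>atlas circle. fst c) = points circle"
  proof
    show "(\<Union>c\<in>atlas circle. fst c) \<subseteq> points circle" by (auto simp: points_circle) (auto simp: circle_def)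
    show "points circle \<subseteq> (\<Union>c\<in>atlas circle. fst c)"
    proof
      fix p assume "p \<in> points circle"
      then obtain x where x: "p = coset x" by (auto simp: points_circle)
      have "(coset ` {x - 1/2<..<x + 1/2}, \<lambda>z. affine_point (inv_into {x - 1/2<..<x + 1/2} coset z)) \<in> atlas circle"
        unfolding circle_def by force
      moreover have "p \<in> coset ` {x - 1/2<..<x + 1/2}" using x by auto
      ultimately show "p \<in> (\<Union>c\<in>atlas circle. fst c)" by force
    qed
  qed
  fix c d assume "c \<in> atlas circle" "d \<in> atlas circle"
  then obtain a b a' b' where ab: "a < b" "b \<le> a + 1" "a' < b'" "b' \<le> a' + 1"
    and c: "c = (coset ` {a<..<b}, \<lambda>z. affine_point (inv_into {a<..<b} coset z))"
    and d: "d = (coset ` {a'<..<b'}, \<lambda>z. affine_point (inv_into {a'<..<b'} coset z))"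
    unfolding circle_def by auto
  have inv: "inv_into {a<..<b} coset (coset x) = x" if "x \<in> {a<..<b}" for x
    using inj_on_coset[OF ab(2)] that by simp
  have inv': "inv_into {a'<..<b'} coset (coset x) = x" if "x \<in> {a'<..<b'}" for x
    using inj_on_coset[OF ab(4)] that by simp
  show "projective_in_charts id c d"
    unfolding c d projective_in_charts_iff[OF is_chart_circle[OF ab(1,2)]]
  proof (intro ballI impI)
    fix p assume p: "p \<in> coset ` {a<..<b}" "id p \<in> coset ` {a'<..<b'}"
    then obtain x y where x: "x \<in> {a<..<b}" "p = coset x" and y: "y \<in> {a'<..<b'}" "p = coset y" by auto
    then have "coset x = coset y" by simp
    then obtain k :: int where k: "y = x + of_int k" unfolding coset_eq_iff by blast
    define J where "J = {a<..<b} \<inter> {a' - of_int k<..<b' - of_int k}"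
    obtain A :: "real^2^2" where A: "invertible A" "\<And>x. affine_point (x + of_int k) = ((*v) A) ` affine_point x"
      using affine_point_translate by blast
    have "open J" "x \<in> J" using x y k by (auto simp: J_def)
    moreover have "affine_point (inv_into {a'<..<b'} coset (coset u)) =
        ((*v) A) ` affine_point (inv_into {a<..<b} coset (coset u))" if "u \<in> J" for u
    proof -
      have "coset u = coset (u + of_int k)" unfolding coset_eq_iff by blast
      moreover have "inv_into {a'<..<b'} coset (coset (u + of_int k)) = u + of_int k"
        using that by (intro inv') (auto simp: J_def)
      moreover have "inv_into {a<..<b} coset (coset u) = u"
        using that by (intro inv) (auto simp: J_def)
      ultimately show ?thesis using A(2) by simp
    qed
    ultimately show "\<exists>W A. openin (ctop circle) W \<and> p \<in> W \<and> invertible A \<and>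
      (\<forall>q\<in>W \<inter> coset ` {a<..<b}. id q \<in> coset ` {a'<..<b'} \<longrightarrow>
        affine_point (inv_into {a'<..<b'} coset (id q)) =
        ((*v) A) ` affine_point (inv_into {a<..<b} coset q))"
      using openin_circle_image[of J] A(1) x(2) by (intro exI[of _ "coset ` J"] exI[of _ A]) auto
  qed
qed

end

theory Submission
  imports Defs
begin

text \<open>Let \<open>G\<close> be the group of piecewise projective automorphisms of \<open>X\<close>. Its partial action on \<open>X\<close>
  (\<open>g\<close> is defined at \<open>x\<close> if a representative is projective near \<open>x\<close>) has a universal globalization
  \<open>Y\<close>, a possibly non-Hausdorff projective curve containing \<open>X\<close> on which \<open>G\<close> acts by
  automorphisms, and \<open>X\<close> is commensurated in \<open>Y\<close>. Relative Property FW gives an \<open>H\<close>-invariant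
  subset commensurate to \<open>X\<close>; after removal of its finitely many nonseparated points it is open and
  Hausdorff, and it is the required curve. If \<open>H\<close> acts by homeomorphisms of \<open>X\<close>, the
  points of \<open>Y\<close> that are topologically regular, that is, given by a germ \<open>(g, x)\<close> for which \<open>g\<close>
  extends to a local homeomorphism at \<open>x\<close>, are preserved by \<open>H\<close> and inject into \<open>X\<close>; this
  identifies the model with an open cofinite subset of \<open>X\<close> carrying a new projective structure.\<close>

section \<open>Local isomorphisms\<close>

text \<open>With \<open>b = False\<close> the projective structure is ignored, so that both topological and
  projective regularity are covered.\<close>

definition liso :: "bool \<Rightarrow> 'a pcurve \<Rightarrow> 'b pcurve \<Rightarrow> ('a \<Rightarrow> 'b) \<Rightarrow> 'a set \<Rightarrow> bool" where
  "liso b X Y f W \<longleftrightarrow> openin (ctop X) W \<and> inj_on f W \<and>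
     (\<forall>V. V \<subseteq> W \<longrightarrow> openin (ctop X) V \<longrightarrow> openin (ctop Y) (f ` V)) \<and>
     (\<forall>V. openin (ctop Y) V \<longrightarrow> openin (ctop X) {x \<in> W. f x \<in> V}) \<and>
     (b \<longrightarrow> (\<forall>x\<in>W. lproj X Y f x))"

lemma lisoD:
  assumes "liso b X Y f W"
  shows "openin (ctop X) W" "inj_on f W" "W \<subseteq> points X" "f ` W \<subseteq> points Y"
    "\<And>V. V \<subseteq> W \<Longrightarrow> openin (ctop X) V \<Longrightarrow> openin (ctop Y) (f ` V)"
    "\<And>V. openin (ctop Y) V \<Longrightarrow> openin (ctop X) {x \<in> W. f x \<in> V}"
    "\<And>x. b \<Longrightarrow> x \<in> W \<Longrightarrow> lproj X Y f x"
proof -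
  show 1: "openin (ctop X) W" "inj_on f W" using assms unfolding liso_def by simp_all
  show 2: "openin (ctop Y) (f ` V)" if "V \<subseteq> W" "openin (ctop X) V" for V
    using assms that unfolding liso_def by simp
  show "W \<subseteq> points X" "f ` W \<subseteq> points Y" using openin_subset[OF 1(1)] openin_subset[OF 2[OF order_refl 1(1)]] .
  show "openin (ctop X) {x \<in> W. f x \<in> V}" if "openin (ctop Y) V" for V
    using assms that unfolding liso_def by simp
  show "lproj X Y f x" if b "x \<in> W" for x using assms that unfolding liso_def by simp
qed

lemma liso_forget: "liso b X Y f W \<Longrightarrow> liso False X Y f W"
  by (auto simp: liso_def)

lemma liso_restrict:
  assumes "liso b X Y f W" "openin (ctop X) V" "V \<subseteq> W"
  shows "liso b X Y f V"
  unfolding liso_def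
proof (intro conjI allI impI ballI)
  note f = assms(1)
  show "inj_on f V" using lisoD(2)[OF f] assms(3) by (rule inj_on_subset)
  show "openin (ctop X) {x \<in> V. f x \<in> U}" if "openin (ctop Y) U" for U
  proof -
    have "{x \<in> V. f x \<in> U} = V \<inter> {x \<in> W. f x \<in> U}" using assms(3) by auto
    then show ?thesis using openin_Int[OF assms(2) lisoD(6)[OF f that]] by simp
  qed
  show "openin (ctop Y) (f ` U)" if "U \<subseteq> V" "openin (ctop X) U" for U
    using that assms(3) by (intro lisoD(5)[OF f]) auto
  show "lproj X Y f x" if b "x \<in> V" for x using that assms(3) by (intro lisoD(7)[OF f]) auto
qed (rule assms(2))

lemma liso_cong:
  assumes f: "liso b X Y f W" and eq: "\<And>x. x \<in> W \<Longrightarrow> f x = g x"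
  shows "liso b X Y g W"
  unfolding liso_def
proof (intro conjI allI impI ballI)
  show "inj_on g W" using lisoD(2)[OF f] eq by (simp cong: inj_on_cong)
  show "openin (ctop X) {x \<in> W. g x \<in> U}" if "openin (ctop Y) U" for U
  proof -
    have "{x \<in> W. g x \<in> U} = {x \<in> W. f x \<in> U}" using eq by auto
    then show ?thesis using lisoD(6)[OF f that] by simp
  qed
  show "openin (ctop Y) (g ` V)" if "V \<subseteq> W" "openin (ctop X) V" for V
  proof -
    have "g ` V = f ` V" using eq that(1) by (intro image_cong) auto
    then show ?thesis using lisoD(5)[OF f that] by simp
  qed
  show "lproj X Y g x" if b "x \<in> W" for x
    using lisoD(7)[OF f that] lisoD(1)[OF f] that(2) eq by (rule lproj_cong)
qed (rule lisoD(1)[OF f])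

text \<open>The clauses of \<open>liso\<close> restrict and compose without mentioning subspace
  topologies. They amount to a homeomorphism onto an open image, which is the form taken by
  isomorphisms of curves.\<close>

lemma liso_homeo_iff:
  assumes "openin (ctop X) W"
  shows "liso b X Y f W \<longleftrightarrow> openin (ctop Y) (f ` W) \<and>
    homeomorphic_map (subtopology (ctop X) W) (subtopology (ctop Y) (f ` W)) f \<and>
    (b \<longrightarrow> (\<forall>x\<in>W. lproj X Y f x))" (is "?L \<longleftrightarrow> ?R")
proof
  have t: "topspace (subtopology (ctop X) W) = W"
    using openin_subset[OF assms] by (simp add: Int_absorb1)
  assume L: ?L
  have o: "openin (ctop Y) (f ` W)" using lisoD(1,5)[OF L] by simp
  have "homeomorphic_map (subtopology (ctop X) W) (subtopology (ctop Y) (f ` W)) f"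
  proof (rule bijective_open_imp_homeomorphic_map)
    show "continuous_map (subtopology (ctop X) W) (subtopology (ctop Y) (f ` W)) f"
      unfolding continuous_map_def t openin_open_subtopology[OF o] openin_open_subtopology[OF assms]
      using lisoD(4,6)[OF L] by (simp add: image_subset_iff_funcset[symmetric])
    show "open_map (subtopology (ctop X) W) (subtopology (ctop Y) (f ` W)) f"
      unfolding open_map_def openin_open_subtopology[OF o] openin_open_subtopology[OF assms]
      using lisoD(5)[OF L] by auto
    show "f ` topspace (subtopology (ctop X) W) = topspace (subtopology (ctop Y) (f ` W))"
      using lisoD(4)[OF L] t by (simp add: Int_absorb1)
    show "inj_on f (topspace (subtopology (ctop X) W))" using lisoD(2)[OF L] t by simp
  qed
  then show ?R using o lisoD(7)[OF L] by blast
next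
  have t: "topspace (subtopology (ctop X) W) = W"
    using openin_subset[OF assms] by (simp add: Int_absorb1)
  assume R: ?R
  then have o: "openin (ctop Y) (f ` W)"
    and h: "homeomorphic_map (subtopology (ctop X) W) (subtopology (ctop Y) (f ` W)) f" by auto
  have cont: "continuous_map (subtopology (ctop X) W) (ctop Y) f"
    using homeomorphic_imp_continuous_map[OF h] continuous_map_in_subtopology by blast
  have "inj_on f W" using homeomorphic_imp_injective_map[OF h] t by simp
  moreover have "openin (ctop Y) (f ` V)" if "V \<subseteq> W" "openin (ctop X) V" for V
    using homeomorphic_imp_open_map[OF h] that
    unfolding open_map_def openin_open_subtopology[OF o] openin_open_subtopology[OF assms] by auto
  moreover have "openin (ctop X) {x \<in> W. f x \<in> V}" if "openin (ctop Y) V" for V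
    using openin_continuous_map_preimage[OF cont that]
    unfolding t openin_open_subtopology[OF assms] by blast
  ultimately show ?L using R assms unfolding liso_def by blast
qed

lemma liso_continuous:
  assumes "liso b X Y f W"
  shows "continuous_map (subtopology (ctop X) W) (ctop Y) f"
  using assms liso_homeo_iff[OF lisoD(1)[OF assms]] homeomorphic_imp_continuous_map
    continuous_map_in_subtopology by blast

lemma liso_compose:
  assumes Y: "projective_curve Y" and f: "liso b X Y f W" and g: "liso b Y Z g W'" and W: "f ` W \<subseteq> W'"
  shows "liso b X Z (g \<circ> f) W"
  unfolding liso_def
proof (intro conjI allI impI ballI)
  show "openin (ctop X) W" by (rule lisoD(1)[OF f])
  show "inj_on (g \<circ> f) W"
    using lisoD(2)[OF f] lisoD(2)[OF g] W by (metis comp_inj_on inj_on_subset)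
  show "openin (ctop Z) ((g \<circ> f) ` V)" if "V \<subseteq> W" "openin (ctop X) V" for V
    unfolding image_comp[symmetric] using that W by (intro lisoD(5)[OF g] lisoD(5)[OF f]) auto
  show "openin (ctop X) {x \<in> W. (g \<circ> f) x \<in> V}" if "openin (ctop Z) V" for V
  proof -
    have "{x \<in> W. (g \<circ> f) x \<in> V} = {x \<in> W. f x \<in> {y \<in> W'. g y \<in> V}}" using W by auto
    then show ?thesis using lisoD(6)[OF f lisoD(6)[OF g that]] by simp
  qed
  show "lproj X Z (g \<circ> f) x" if "b" "x \<in> W" for x
    using that W
    by (intro lproj_compose[OF Y lisoD(7)[OF f] lisoD(7)[OF g] lisoD(1)[OF f] _ liso_continuous[OF f]]) auto
qed

lemma liso_inverse:
  assumes X: "projective_curve X" and f: "liso b X Y f W"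
  shows "liso b Y X (inv_into W f) (f ` W)"
  unfolding liso_def
proof (intro conjI allI impI ballI)
  note inj = lisoD(2)[OF f]
  show "openin (ctop Y) (f ` W)" using lisoD(1,5)[OF f] by simp
  show "inj_on (inv_into W f) (f ` W)" by (rule inj_on_inv_into) simp
  show "openin (ctop X) (inv_into W f ` V)" if "V \<subseteq> f ` W" "openin (ctop Y) V" for V
  proof -
    have "inv_into W f ` V = {x \<in> W. f x \<in> V}"
    proof (intro equalityI subsetI)
      fix x assume "x \<in> inv_into W f ` V"
      then show "x \<in> {x \<in> W. f x \<in> V}" using that(1) inj by auto
    next
      fix x assume "x \<in> {x \<in> W. f x \<in> V}"
      then show "x \<in> inv_into W f ` V" using inj by (auto intro!: image_eqI[of _ _ "f x"])
    qed
    then show ?thesis using lisoD(6)[OF f that(2)] by simp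
  qed
  show "openin (ctop Y) {y \<in> f ` W. inv_into W f y \<in> V}" if "openin (ctop X) V" for V
  proof -
    have "{y \<in> f ` W. inv_into W f y \<in> V} = f ` (W \<inter> V)" using inj by force
    then show ?thesis using lisoD(5)[OF f, of "W \<inter> V"] lisoD(1)[OF f] that by (simp add: openin_Int)
  qed
  fix y assume b and "y \<in> f ` W"
  then obtain x where x: "x \<in> W" "y = f x" by blast
  have g: "inv_into W f (f z) = z" if "z \<in> W" for z using inj that by simp
  show "lproj Y X (inv_into W f) y" unfolding lproj_def
  proof (intro allI impI)
    fix V \<psi> U \<phi>
    assume c: "(V, \<psi>) \<in> atlas Y" "(U, \<phi>) \<in> atlas X" "y \<in> V" "inv_into W f y \<in> U"
    have xU: "x \<in> U" "f x \<in> V" using c x g by auto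
    obtain N A where N: "openin (ctop X) N" "x \<in> N" "invertible A"
      "\<And>z. z \<in> N \<inter> U \<Longrightarrow> f z \<in> V \<Longrightarrow> \<psi> (f z) = ((*v) A) ` \<phi> z"
      using lisoD(7)[OF f \<open>b\<close> x(1), unfolded lproj_def, rule_format, OF c(2,1) xU] by blast
    have "openin (ctop X) U" using projective_curveD(2)[OF X c(2)] by (simp add: is_chart_def)
    then have op: "openin (ctop Y) (f ` (N \<inter> U \<inter> W))"
      using N(1) lisoD(1)[OF f] by (intro lisoD(5)[OF f] openin_Int) auto
    \<comment> \<open>In the two charts \<open>f\<close> is the matrix \<open>A\<close> near
      \<open>x\<close>, so the inverse matrix \<open>B\<close> describes the inverse map near
      \<open>y\<close>.\<close>
    obtain B where B: "B ** A = mat 1" "A ** B = mat 1"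
      using N(3) unfolding invertible_def by blast
    have iB: "invertible B" using B unfolding invertible_def by blast
    have "\<phi> (inv_into W f z) = ((*v) B) ` \<psi> z" if z: "z \<in> f ` (N \<inter> U \<inter> W)" "z \<in> V" for z
    proof -
      obtain u where u: "u \<in> N \<inter> U \<inter> W" "z = f u" using z(1) by blast
      then have "\<psi> z = ((*v) A) ` \<phi> u" using N(4)[of u] z(2) by auto
      then show ?thesis using u g by (simp add: image_image matrix_vector_mul_assoc B)
    qed
    then show "\<exists>N A. openin (ctop Y) N \<and> y \<in> N \<and> invertible A \<and>
        (\<forall>z\<in>N \<inter> V. inv_into W f z \<in> U \<longrightarrow> \<phi> (inv_into W f z) = ((*v) A) ` \<psi> z)"
      using op iB x N(2) xU by (intro exI[of _ "f ` (N \<inter> U \<inter> W)"] exI[of _ B]) auto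
  qed
qed

lemma liso_id:
  assumes "projective_curve X" "openin (ctop X) W"
  shows "liso b X X id W"
proof -
  have "{x \<in> W. id x \<in> V} = W \<inter> V" for V by auto
  then show ?thesis
    using assms lproj_id[OF assms(1)] openin_subset[OF assms(2)] unfolding liso_def
    by (auto simp: openin_Int)
qed

text \<open>Cofinite subsets of a Hausdorff curve are open, so the finite exceptional sets can be
  replaced by a local isomorphism on a cofinite open set with cofinite image.\<close>

lemma pw_rep_iff_liso:
  assumes X: "projective_curve X" and Y: "projective_curve Y"
  shows "pw_rep X Y f \<longleftrightarrow> (\<exists>S. cofin X S \<and> cofin Y (f ` S) \<and> liso True X Y f S)"
proof
  assume "pw_rep X Y f"
  then obtain S S' where S: "cofin X S" "cofin Y S'" "pw_iso_on X Y S S' f"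
    using pw_rep_iff[OF X Y] by blast
  then have "f ` S = S'" by (intro pw_iso_onD(2)) (auto simp: cofin_def)
  with S show "\<exists>S. cofin X S \<and> cofin Y (f ` S) \<and> liso True X Y f S"
    using liso_homeo_iff[OF openin_cofin[OF X S(1)]] openin_cofin[OF Y S(2)]
    unfolding pw_iso_on_def by blast
next
  assume "\<exists>S. cofin X S \<and> cofin Y (f ` S) \<and> liso True X Y f S"
  then obtain S where "cofin X S" "cofin Y (f ` S)" "liso True X Y f S" by blast
  then show "pw_rep X Y f"
    unfolding pw_rep_iff[OF X Y] pw_iso_on_def using liso_homeo_iff lisoD(1) by metis
qed

section \<open>Removing finitely many points from a curve\<close>

lemma lproj_from_remove_points:
  assumes X: "projective_curve X" and F: "finite F" and l: "lproj X Y f x" and x: "x \<in> points X - F"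
  shows "lproj (remove_points X F) Y f x"
  unfolding lproj_def
proof (intro allI impI)
  fix W \<phi> V \<psi>
  assume c: "(W, \<phi>) \<in> atlas (remove_points X F)" "(V, \<psi>) \<in> atlas Y" "x \<in> W" "f x \<in> V"
  then obtain U where U: "(U, \<phi>) \<in> atlas X" "W \<subseteq> U" by (auto simp: atlas_remove_points)
  then have "x \<in> U" using c by auto
  then obtain N A where N: "openin (ctop X) N" "x \<in> N" "invertible A"
    "\<And>y. y \<in> N \<inter> U \<Longrightarrow> f y \<in> V \<Longrightarrow> \<psi> (f y) = ((*v) A) ` \<phi> y"
    using l[unfolded lproj_def, rule_format, OF U(1) c(2) _ c(4)] by blast
  have "openin (ctop (remove_points X F)) (N \<inter> (points X - F))"
    using N(1) unfolding remove_points_simps openin_subtopology by blast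
  then show "\<exists>N A. openin (ctop (remove_points X F)) N \<and> x \<in> N \<and> invertible A \<and>
      (\<forall>y\<in>N \<inter> W. f y \<in> V \<longrightarrow> \<psi> (f y) = ((*v) A) ` \<phi> y)"
    using N x U by (intro exI[of _ "N \<inter> (points X - F)"] exI[of _ A]) auto
qed

lemma projective_curve_remove_points:
  assumes X: "projective_curve X" and F: "finite F"
  shows "projective_curve (remove_points X F)"
  unfolding projective_curve_def
proof (intro conjI)
  show "Hausdorff_space (ctop (remove_points X F))"
    using projective_curveD(1)[OF X] by (simp add: Hausdorff_space_subtopology)
  show ch: "\<forall>c\<in>atlas (remove_points X F). is_chart (ctop (remove_points X F)) c"
    using is_chart_remove_points[OF X] by blast
  show "(\<Union>c\<in>atlas (remove_points X F). fst c) = points (remove_points X F)"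
  proof (intro equalityI subsetI)
    fix x assume "x \<in> (\<Union>c\<in>atlas (remove_points X F). fst c)"
    then obtain W \<phi> where W: "(W, \<phi>) \<in> atlas (remove_points X F)" "x \<in> W" by force
    then have "openin (ctop X) W" "W \<inter> F = {}" by (simp_all add: atlas_remove_points)
    then have "W \<subseteq> points X - F" using openin_subset by blast
    then show "x \<in> points (remove_points X F)" using W(2) by auto
  next
    fix x assume "x \<in> points (remove_points X F)"
    then have x: "x \<in> points X" "x \<in> points X - F" by auto
    obtain U \<phi> where U: "(U, \<phi>) \<in> atlas X" "x \<in> U" using projective_curveD(3)[OF X x(1)] by blast
    obtain W where "openin (ctop X) W" "x \<in> W" "W \<subseteq> U" "W \<subseteq> points X - F" "open_interval (\<phi> ` W)"
      using small_chart[OF projective_curveD(2)[OF X U(1)] openin_cofinite[OF X F] U(2) x(2)] by blast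
    then have "(W, \<phi>) \<in> atlas (remove_points X F)" using U by (auto simp: atlas_remove_points)
    then show "x \<in> (\<Union>c\<in>atlas (remove_points X F). fst c)" using \<open>x \<in> W\<close> by force
  qed
  \<comment> \<open>Compatibility of charts is local projectivity of the identity, so it is
    inherited from \<open>X\<close> through the criterion for isomorphisms between punctured
    curves.\<close>
  have "projective_iso (remove_points X F) (remove_points X F) id"
    unfolding projective_iso_remove_points[OF X X F F] pw_iso_on_def homeomorphic_map_id
    by (intro conjI refl ballI lproj_id[OF X]) (rule DiffD1)
  then show "\<forall>c\<in>atlas (remove_points X F). \<forall>d\<in>atlas (remove_points X F). projective_in_charts id c d"
    unfolding projective_iso_def by (rule conjunct2)
qed


section \<open>Gluing\<close>

text \<open>Open subsets \<open>D i\<close> of a curve are glued along local isomorphisms; the resulting space is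
  described by the injective maps \<open>c i\<close> from \<open>D i\<close> into it.\<close>

locale gluing =
  fixes X :: "'a pcurve" and I :: "'i set" and D :: "'i \<Rightarrow> 'a set" and c :: "'i \<Rightarrow> 'a \<Rightarrow> 'b"
  assumes curve: "projective_curve X"
    and open_D: "\<And>i. i \<in> I \<Longrightarrow> openin (ctop X) (D i)"
    and inj_c: "\<And>i. i \<in> I \<Longrightarrow> inj_on (c i) (D i)"
    and overlap: "\<And>i j x y. \<lbrakk>i \<in> I; j \<in> I; x \<in> D i; y \<in> D j; c i x = c j y\<rbrakk> \<Longrightarrow>
      \<exists>f V. x \<in> V \<and> V \<subseteq> D i \<and> f x = y \<and> liso True X X f V \<and>
        (\<forall>v\<in>V. f v \<in> D j \<and> c j (f v) = c i v)"
    and separated: "\<And>p q. \<lbrakk>p \<in> (\<Union>i\<in>I. c i ` D i); q \<in> (\<Union>i\<in>I. c i ` D i); p \<noteq> q\<rbrakk> \<Longrightarrow>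
      \<exists>i\<in>I. \<exists>j\<in>I. \<exists>V W. openin (ctop X) V \<and> V \<subseteq> D i \<and> openin (ctop X) W \<and> W \<subseteq> D j \<and>
        p \<in> c i ` V \<and> q \<in> c j ` W \<and> c i ` V \<inter> c j ` W = {}"
begin

definition glued_set :: "'b set" where
  "glued_set = (\<Union>i\<in>I. c i ` D i)"

text \<open>The topology is the final one for the maps \<open>c i\<close>. A chart of
  \<open>X\<close> is first cut down to a set \<open>W\<close> inside \<open>D i\<close> with an
  interval as image, since its whole trace on \<open>D i\<close> may be disconnected, and then
  transported by \<open>c i\<close>.\<close>

definition glued :: "'b pcurve" where
  "glued =
     \<lparr>ctop = topology (\<lambda>U. U \<subseteq> glued_set \<and> (\<forall>i\<in>I. openin (ctop X) {x \<in> D i. c i x \<in> U})),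
      atlas = {(c i ` W, \<phi> \<circ> inv_into (D i) (c i)) | i W \<phi>.
        i \<in> I \<and> openin (ctop X) W \<and> W \<subseteq> D i \<and> open_interval (\<phi> ` W) \<and>
        (\<exists>U. (U, \<phi>) \<in> atlas X \<and> W \<subseteq> U)}\<rparr>"

lemma openin_glued:
  "openin (ctop glued) U \<longleftrightarrow> U \<subseteq> glued_set \<and> (\<forall>i\<in>I. openin (ctop X) {x \<in> D i. c i x \<in> U})"
proof -
  have "istopology (\<lambda>U. U \<subseteq> glued_set \<and> (\<forall>i\<in>I. openin (ctop X) {x \<in> D i. c i x \<in> U}))"
    unfolding istopology_def
  proof (intro conjI allI impI ballI)
    fix S T i
    assume S: "S \<subseteq> glued_set \<and> (\<forall>i\<in>I. openin (ctop X) {x \<in> D i. c i x \<in> S})"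
      and T: "T \<subseteq> glued_set \<and> (\<forall>i\<in>I. openin (ctop X) {x \<in> D i. c i x \<in> T})"
    show "S \<inter> T \<subseteq> glued_set" using S by auto
    assume i: "i \<in> I"
    have "{x \<in> D i. c i x \<in> S \<inter> T} = {x \<in> D i. c i x \<in> S} \<inter> {x \<in> D i. c i x \<in> T}" by auto
    then show "openin (ctop X) {x \<in> D i. c i x \<in> S \<inter> T}" using S T i by (simp add: openin_Int)
  next
    fix K i
    assume K: "\<forall>S\<in>K. S \<subseteq> glued_set \<and> (\<forall>i\<in>I. openin (ctop X) {x \<in> D i. c i x \<in> S})"
    show "\<Union>K \<subseteq> glued_set" using K by blast
    assume i: "i \<in> I"
    have "{x \<in> D i. c i x \<in> \<Union>K} = \<Union>((\<lambda>S. {x \<in> D i. c i x \<in> S}) ` K)" by auto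
    moreover have "openin (ctop X) (\<Union>((\<lambda>S. {x \<in> D i. c i x \<in> S}) ` K))"
      using K i by (intro openin_Union) auto
    ultimately show "openin (ctop X) {x \<in> D i. c i x \<in> \<Union>K}" by simp
  qed
  then show ?thesis unfolding glued_def by simp
qed

lemma points_glued: "points glued = glued_set"
proof
  show "points glued \<subseteq> glued_set" using openin_topspace[of "ctop glued"] openin_glued by blast
  have "{x \<in> D i. c i x \<in> glued_set} = D i" if "i \<in> I" for i using that by (auto simp: glued_set_def)
  then have "openin (ctop glued) glued_set" unfolding openin_glued using open_D by simp
  then show "glued_set \<subseteq> points glued" by (rule openin_subset)
qed

text \<open>Around a common point of two pieces, the set pulled back to \<open>D j\<close> contains
  the preimage of \<open>V\<close> under the transition map given by \<open>overlap\<close>, and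
  that preimage is open.\<close>

lemma openin_image_c:
  assumes i: "i \<in> I" and V: "V \<subseteq> D i" "openin (ctop X) V"
  shows "openin (ctop glued) (c i ` V)"
  unfolding openin_glued
proof (intro conjI ballI)
  show "c i ` V \<subseteq> glued_set" using i V by (auto simp: glued_set_def)
  fix j assume j: "j \<in> I"
  show "openin (ctop X) {x \<in> D j. c j x \<in> c i ` V}"
    unfolding openin_subopen[of _ "{x \<in> D j. c j x \<in> c i ` V}"]
  proof
    fix x assume "x \<in> {x \<in> D j. c j x \<in> c i ` V}"
    then obtain y where y: "x \<in> D j" "y \<in> V" "c j x = c i y" by auto
    then have "y \<in> D i" using V by auto
    then obtain f W where W: "x \<in> W" "W \<subseteq> D j" "f x = y" "liso True X X f W"
      "\<And>w. w \<in> W \<Longrightarrow> f w \<in> D i \<and> c i (f w) = c j w"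
      using overlap[OF j i y(1) _ y(3)] by blast
    have "{w \<in> W. f w \<in> V} \<subseteq> {x \<in> D j. c j x \<in> c i ` V}"
    proof
      fix w assume w: "w \<in> {w \<in> W. f w \<in> V}"
      then have "c j w = c i (f w)" using W(5) by simp
      then show "w \<in> {x \<in> D j. c j x \<in> c i ` V}" using w W(2) by auto
    qed
    then show "\<exists>T. openin (ctop X) T \<and> x \<in> T \<and> T \<subseteq> {x \<in> D j. c j x \<in> c i ` V}"
      using lisoD(6)[OF W(4) V(2)] W(1,3) y(2) by (intro exI[of _ "{w \<in> W. f w \<in> V}"]) simp
  qed
qed

text \<open>A chart of the glued space is a chart of \<open>X\<close> after the inverse of some
  \<open>c j\<close>. Read in it, \<open>c i\<close> becomes the transition map from
  \<open>D i\<close> to \<open>D j\<close>, which is locally projective by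
  \<open>overlap\<close>.\<close>

lemma lproj_c:
  assumes i: "i \<in> I" and x: "x \<in> D i"
  shows "lproj X glued (c i) x"
  unfolding lproj_def
proof (intro allI impI)
  fix U \<phi> V \<psi>
  assume U: "(U, \<phi>) \<in> atlas X" "x \<in> U" and V: "(V, \<psi>) \<in> atlas glued" "c i x \<in> V"
  from V(1) obtain j W \<phi>' U' where j: "j \<in> I" "V = c j ` W" "\<psi> = \<phi>' \<circ> inv_into (D j) (c j)"
    "openin (ctop X) W" "W \<subseteq> D j" "(U', \<phi>') \<in> atlas X" "W \<subseteq> U'" by (auto simp: glued_def)
  obtain y where y: "y \<in> W" "c i x = c j y" using V(2) j(2) by blast
  obtain f N where N: "x \<in> N" "N \<subseteq> D i" "f x = y" "liso True X X f N"
    "\<And>v. v \<in> N \<Longrightarrow> f v \<in> D j \<and> c j (f v) = c i v"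
    using overlap[OF i j(1) x subsetD[OF j(5) y(1)] y(2)] by blast
  have "f x \<in> U'" using N(3) y(1) j(7) by auto
  then obtain M A where M: "openin (ctop X) M" "x \<in> M" "invertible A"
    "\<And>v. v \<in> M \<inter> U \<Longrightarrow> f v \<in> U' \<Longrightarrow> \<phi>' (f v) = ((*v) A) ` \<phi> v"
    using lisoD(7)[OF N(4) _ N(1), unfolded lproj_def, rule_format, OF _ U(1) j(6) U(2)] by blast
  have "\<psi> (c i v) = ((*v) A) ` \<phi> v" if v: "v \<in> (M \<inter> N) \<inter> U" "c i v \<in> V" for v
  proof -
    have fv: "f v \<in> D j" "c j (f v) = c i v" using N(5) v(1) by auto
    obtain w where w: "w \<in> W" "c i v = c j w" using v(2) j(2) by blast
    then have "f v = w" using inj_onD[OF inj_c[OF j(1)], of "f v" w] fv j(5) by auto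
    then have "f v \<in> U'" using w(1) j(7) by auto
    then have "\<phi>' (f v) = ((*v) A) ` \<phi> v" using M(4) v(1) by blast
    moreover have "inv_into (D j) (c j) (c i v) = f v"
      using inv_into_f_f[OF inj_c[OF j(1)] fv(1)] fv(2) by simp
    ultimately show ?thesis using j(3) by simp
  qed
  then show "\<exists>W A. openin (ctop X) W \<and> x \<in> W \<and> invertible A \<and>
      (\<forall>y\<in>W \<inter> U. c i y \<in> V \<longrightarrow> \<psi> (c i y) = ((*v) A) ` \<phi> y)"
    using M(1-3) N(1) lisoD(1)[OF N(4)]
    by (intro exI[of _ "M \<inter> N"] exI[of _ A]) (simp add: openin_Int)
qed

lemma liso_c: "i \<in> I \<Longrightarrow> liso True X glued (c i) (D i)"
  unfolding liso_def
  using open_D inj_c openin_image_c lproj_c openin_glued by auto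

lemma projective_curve_glued: "projective_curve glued"
  unfolding projective_curve_def
proof (intro conjI ballI)
  show "Hausdorff_space (ctop glued)"
    unfolding Hausdorff_space_def points_glued
  proof (intro allI impI, elim conjE)
    fix p q assume "p \<in> glued_set" "q \<in> glued_set" "p \<noteq> q"
    then obtain i j V W where "i \<in> I" "j \<in> I" "openin (ctop X) V" "V \<subseteq> D i" "openin (ctop X) W"
      "W \<subseteq> D j" "p \<in> c i ` V" "q \<in> c j ` W" "c i ` V \<inter> c j ` W = {}"
      using separated unfolding glued_set_def by meson
    then show "\<exists>U V. openin (ctop glued) U \<and> openin (ctop glued) V \<and> p \<in> U \<and> q \<in> V \<and> disjnt U V"
      unfolding disjnt_def by (meson openin_image_c)
  qed
  show chart: "is_chart (ctop glued) d" if d: "d \<in> atlas glued" for d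
  proof -
    obtain i W \<phi> U where i: "i \<in> I" and d: "d = (c i ` W, \<phi> \<circ> inv_into (D i) (c i))"
      and W: "openin (ctop X) W" "W \<subseteq> D i" "open_interval (\<phi> ` W)" and U: "(U, \<phi>) \<in> atlas X" "W \<subseteq> U"
      using d unfolding glued_def by simp blast
    have inv: "inv_into (D i) (c i) (c i w) = w" if "w \<in> W" for w
      using inv_into_f_f[OF inj_c[OF i]] that W(2) by auto
    have "is_chart (ctop X) (W, \<phi>)"
      using is_chart_smaller[OF projective_curveD(2)[OF curve U(1)] W(1) U(2) W(3) openin_subset[OF W(1)]]
      by simp
    then have h1: "homeomorphic_map (subtopology (ctop X) W) (subtopology P1 (\<phi> ` W)) \<phi>"
      by (simp add: is_chart_def)
    have o: "openin (ctop glued) (c i ` W)" by (rule openin_image_c[OF i W(2,1)])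
    have img: "inv_into (D i) (c i) ` c i ` W = W" using inv by (simp add: image_image)
    have "liso True glued X (inv_into (D i) (c i)) (c i ` W)"
      by (rule liso_restrict[OF liso_inverse[OF curve liso_c[OF i]] o]) (use W(2) in blast)
    then have "homeomorphic_map (subtopology (ctop glued) (c i ` W)) (subtopology (ctop X) W) (inv_into (D i) (c i))"
      using liso_homeo_iff[OF o] img by metis
    from homeomorphic_map_compose[OF this h1]
    have "homeomorphic_map (subtopology (ctop glued) (c i ` W)) (subtopology P1 (\<phi> ` W)) (\<phi> \<circ> inv_into (D i) (c i))" .
    moreover have "(\<phi> \<circ> inv_into (D i) (c i)) ` c i ` W = \<phi> ` W" using inv by (simp add: image_image)
    ultimately show ?thesis using o W(3) by (simp add: d is_chart_def)
  qed
  show "(\<Union>d\<in>atlas glued. fst d) = points glued"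
  proof (intro equalityI subsetI)
    fix p assume "p \<in> (\<Union>d\<in>atlas glued. fst d)"
    then obtain d where d: "d \<in> atlas glued" "p \<in> fst d" by blast
    then have "openin (ctop glued) (fst d)" using chart[OF d(1)] by (cases d) (simp add: is_chart_def)
    then show "p \<in> points glued" using d(2) openin_subset by blast
  next
    fix p assume "p \<in> points glued"
    then obtain i x where i: "i \<in> I" "x \<in> D i" "p = c i x" by (auto simp: points_glued glued_set_def)
    then have "x \<in> points X" using openin_subset[OF open_D] by blast
    then obtain U \<phi> where U: "(U, \<phi>) \<in> atlas X" "x \<in> U" using projective_curveD(3)[OF curve] by blast
    obtain W where W: "openin (ctop X) W" "x \<in> W" "W \<subseteq> U" "W \<subseteq> D i" "open_interval (\<phi> ` W)"
      using small_chart[OF projective_curveD(2)[OF curve U(1)] open_D[OF i(1)] U(2) i(2)] by blast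
    then have "(c i ` W, \<phi> \<circ> inv_into (D i) (c i)) \<in> atlas glued"
      using U i(1) by (auto simp: glued_def)
    moreover have "p \<in> c i ` W" using i(3) W(2) by blast
    ultimately show "p \<in> (\<Union>d\<in>atlas glued. fst d)" by force
  qed
  fix d e assume d: "d \<in> atlas glued" and e: "e \<in> atlas glued"
  obtain i W \<phi> U where i: "i \<in> I" and deq: "d = (c i ` W, \<phi> \<circ> inv_into (D i) (c i))"
    and W: "openin (ctop X) W" "W \<subseteq> D i" and U: "(U, \<phi>) \<in> atlas X" "W \<subseteq> U"
    using d unfolding glued_def by simp blast
  obtain V \<psi> where eeq: "e = (V, \<psi>)" by force
  show "projective_in_charts id d e"
    unfolding deq eeq projective_in_charts_iff[OF chart[OF d, unfolded deq]]
  proof (intro ballI impI)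
    fix p assume p: "p \<in> c i ` W" "id p \<in> V"
    then obtain x where x: "x \<in> W" "p = c i x" by blast
    then have xi: "x \<in> D i" "x \<in> U" "c i x \<in> V" using W U p(2) by auto
    \<comment> \<open>In the chart coming from \<open>c i\<close>, the identity of the glued space
      reads as \<open>c i\<close> itself, so a change of charts is an instance of
      \<open>lproj_c\<close>.\<close>
    obtain N A where N: "openin (ctop X) N" "x \<in> N" "invertible A"
      "\<And>v. v \<in> N \<inter> U \<Longrightarrow> c i v \<in> V \<Longrightarrow> \<psi> (c i v) = ((*v) A) ` \<phi> v"
      using lproj_c[OF i xi(1), unfolded lproj_def, rule_format, OF U(1) e[unfolded eeq] xi(2,3)] by blast
    have "openin (ctop glued) (c i ` (N \<inter> W))"
      using N(1) W by (intro openin_image_c[OF i]) auto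
    moreover have "\<psi> (id q) = ((*v) A) ` (\<phi> \<circ> inv_into (D i) (c i)) q"
      if q: "q \<in> c i ` (N \<inter> W) \<inter> c i ` W" "id q \<in> V" for q
    proof -
      obtain v where v: "v \<in> N \<inter> W" "q = c i v" using q(1) by blast
      then have "inv_into (D i) (c i) q = v" using inv_into_f_f[OF inj_c[OF i]] W(2) by auto
      then show ?thesis using N(4)[of v] v q(2) U(2) by auto
    qed
    ultimately show "\<exists>N A. openin (ctop glued) N \<and> p \<in> N \<and> invertible A \<and>
        (\<forall>y\<in>N \<inter> c i ` W. id y \<in> V \<longrightarrow> \<psi> (id y) = ((*v) A) ` (\<phi> \<circ> inv_into (D i) (c i)) y)"
      using N(2,3) x by (intro exI[of _ "c i ` (N \<inter> W)"] exI[of _ A]) auto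
  qed
qed

text \<open>On the piece \<open>c i\<close> the map is \<open>c j\<close> after the inverse of
  \<open>c i\<close>, with the same domain on both sides; in these coordinates it is the identity,
  hence continuous, open and projective. The hypothesis \<open>bwd\<close> plays the role of
  \<open>fwd\<close> for the inverse map.\<close>

lemma projective_iso_glued:
  assumes inj: "inj_on F glued_set"
    and fwd: "\<And>i. i \<in> I \<Longrightarrow> \<exists>j\<in>I. D j = D i \<and> (\<forall>x\<in>D i. F (c i x) = c j x)"
    and bwd: "\<And>j. j \<in> I \<Longrightarrow> \<exists>i\<in>I. D i = D j \<and> (\<forall>x\<in>D j. F (c i x) = c j x)"
  shows "projective_iso glued glued F"
proof -
  have op: "openin (ctop glued) (F ` U)" if U: "openin (ctop glued) U" for U
    unfolding openin_glued
  proof (intro conjI ballI)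
    have UP: "U \<subseteq> glued_set" using U by (simp add: openin_glued)
    show "F ` U \<subseteq> glued_set"
    proof
      fix q assume "q \<in> F ` U"
      then obtain i x where i: "i \<in> I" "x \<in> D i" "q = F (c i x)" using UP by (auto simp: glued_set_def)
      then obtain j where "j \<in> I" "D j = D i" "q = c j x" using fwd by metis
      then show "q \<in> glued_set" using i(2) by (auto simp: glued_set_def)
    qed
    fix j assume j: "j \<in> I"
    then obtain i where i: "i \<in> I" "D i = D j" "\<And>x. x \<in> D j \<Longrightarrow> F (c i x) = c j x" using bwd by blast
    have "c j x \<in> F ` U \<longleftrightarrow> c i x \<in> U" if "x \<in> D j" for x
    proof -
      have "c i x \<in> glued_set" using i(1,2) that by (auto simp: glued_set_def)
      then show ?thesis using inj_on_image_mem_iff[OF inj _ UP] i(3)[OF that] by metis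
    qed
    then have "{x \<in> D j. c j x \<in> F ` U} = {x \<in> D i. c i x \<in> U}" using i(2) by auto
    then show "openin (ctop X) {x \<in> D j. c j x \<in> F ` U}" using U i(1) by (simp add: openin_glued)
  qed
  have pre: "openin (ctop glued) {p \<in> glued_set. F p \<in> U}" if U: "openin (ctop glued) U" for U
    unfolding openin_glued
  proof (intro conjI ballI)
    fix i assume i: "i \<in> I"
    then obtain j where j: "j \<in> I" "D j = D i" "\<And>x. x \<in> D i \<Longrightarrow> F (c i x) = c j x" using fwd by blast
    have "{x \<in> D i. c i x \<in> {p \<in> glued_set. F p \<in> U}} = {x \<in> D j. c j x \<in> U}"
    proof (intro Collect_cong)
      fix x
      have "c i x \<in> glued_set" if "x \<in> D i" using i that by (auto simp: glued_set_def)
      then show "x \<in> D i \<and> c i x \<in> {p \<in> glued_set. F p \<in> U} \<longleftrightarrow> x \<in> D j \<and> c j x \<in> U"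
        using j(2,3) by auto
    qed
    then show "openin (ctop X) {x \<in> D i. c i x \<in> {p \<in> glued_set. F p \<in> U}}"
      using U j(1) by (simp add: openin_glued)
  qed auto
  have loc: "lproj glued glued F p" if "p \<in> glued_set" for p
  proof -
    obtain i x where i: "i \<in> I" "x \<in> D i" "p = c i x" using \<open>p \<in> glued_set\<close> by (auto simp: glued_set_def)
    then obtain j where j: "j \<in> I" "D j = D i" "\<And>x. x \<in> D i \<Longrightarrow> F (c i x) = c j x" using fwd by blast
    have inv: "inv_into (D i) (c i) (c i x) = x" if "x \<in> D i" for x
      using inv_into_f_f[OF inj_c[OF i(1)] that] .
    then have "inv_into (D i) (c i) ` c i ` D i \<subseteq> D j" using j(2) by auto
    then have "liso True glued glued (c j \<circ> inv_into (D i) (c i)) (c i ` D i)"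
      by (rule liso_compose[OF curve liso_inverse[OF curve liso_c[OF i(1)]] liso_c[OF j(1)]])
    then have "liso True glued glued F (c i ` D i)"
      by (rule liso_cong) (use inv j(3) in auto)
    then show ?thesis using i by (intro lisoD(7)) auto
  qed
  have onto: "F ` glued_set = glued_set"
  proof
    show "F ` glued_set \<subseteq> glued_set"
      using openin_subset[OF op[OF openin_topspace]] by (simp add: points_glued)
    show "glued_set \<subseteq> F ` glued_set"
    proof
      fix q assume "q \<in> glued_set"
      then obtain j x where j: "j \<in> I" "x \<in> D j" "q = c j x" by (auto simp: glued_set_def)
      then obtain i where "i \<in> I" "D i = D j" "F (c i x) = q" using bwd by metis
      then show "q \<in> F ` glued_set" using j(2) by (auto simp: glued_set_def)
    qed
  qed
  have top: "openin (ctop glued) glued_set" using openin_topspace[of "ctop glued"] by (simp add: points_glued)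
  have "liso True glued glued F glued_set"
    unfolding liso_def using top inj op pre loc by blast
  then have "homeomorphic_map (ctop glued) (ctop glued) F"
    using liso_homeo_iff[OF top, of True glued F] onto by (simp flip: points_glued)
  then show ?thesis
    using loc projective_iso_lproj[OF projective_curveD(2)[OF projective_curve_glued]] points_glued
    by blast
qed

end


section \<open>Regular points of piecewise projective automorphisms\<close>

text \<open>For a Hausdorff curve the second condition excludes isolated points. It makes the
  continuous extension of a class over a point unique, although its representatives may differ at
  finitely many points.\<close>

locale perfect_curve =
  fixes X :: "'a pcurve"
  assumes curve: "projective_curve X"
    and infinite_open: "\<And>U. openin (ctop X) U \<Longrightarrow> U \<noteq> {} \<Longrightarrow> infinite U"
begin

abbreviation G :: "('a \<Rightarrow> 'a) set monoid" where "G \<equiv> PC_Proj X"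

sublocale PC: group "PC_Proj X" by (rule group_PC_Proj[OF curve])

section \<open>Representatives of group elements\<close>

lemma carrier_class:
  assumes "g \<in> carrier G" "f \<in> g"
  shows "pw_rep X X f" "g = pw_class X X f"
proof -
  obtain k where k: "pw_rep X X k" "g = pw_class X X k"
    using assms(1) by (auto simp: PC_Proj_def pw_isos_def)
  then show "pw_rep X X f" "g = pw_class X X f"
    using assms(2) pw_class_cong[of X k f] by (auto simp: pw_class_def)
qed

lemma ex_rep: "g \<in> carrier G \<Longrightarrow> \<exists>f. f \<in> g"
  by (auto simp: PC_Proj_def pw_isos_def pw_class_def intro: agree_refl)

lemma reps_agree: "g \<in> carrier G \<Longrightarrow> f \<in> g \<Longrightarrow> k \<in> g \<Longrightarrow> agree X f k"
  using carrier_class(2)[of g f] by (auto simp: pw_class_def)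

lemma rep_cong: "g \<in> carrier G \<Longrightarrow> f \<in> g \<Longrightarrow> agree X f k \<Longrightarrow> k \<in> g"
  using carrier_class[of g f] pw_rep_agree[OF curve curve] by (auto simp: pw_class_def)

lemma rep_mult:
  assumes "g \<in> carrier G" "h \<in> carrier G" "f \<in> g" "k \<in> h"
  shows "f \<circ> k \<in> g \<otimes>\<^bsub>G\<^esub> h"
proof -
  have "pw_rep X X (f \<circ> k)"
    using carrier_class(1) assms by (intro pw_rep_compose[OF curve curve curve]) auto
  then show ?thesis using assms by (auto simp: PC_Proj_def pw_comp_def intro: agree_refl)
qed

lemma rep_one: "id \<in> \<one>\<^bsub>G\<^esub>"
  using pw_rep_id[OF curve] by (simp add: PC_Proj_def pw_class_def)

text \<open>The partial action of the group on \<open>X\<close>, as a relation: since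
  representatives may be changed at finitely many points, \<open>z\<close> is the value at
  \<open>x\<close> of an extension of \<open>g\<close> over \<open>x\<close>. The extension is
  projective for \<open>b = True\<close> and merely a local homeomorphism for
  \<open>b = False\<close>.\<close>

definition regular :: "bool \<Rightarrow> ('a \<Rightarrow> 'a) set \<Rightarrow> 'a \<Rightarrow> 'a \<Rightarrow> bool" where
  "regular b g x z \<longleftrightarrow> (\<exists>f\<in>g. \<exists>W. x \<in> W \<and> f x = z \<and> liso b X X f W)"

lemma regular_points: "regular b g x z \<Longrightarrow> x \<in> points X \<and> z \<in> points X"
  unfolding regular_def using lisoD(3,4) by blast

lemma regular_forget: "regular b g x z \<Longrightarrow> regular False g x z"
  unfolding regular_def using liso_forget by blast

lemma regular_local:
  assumes "regular b g x z"
  obtains f W where "f \<in> g" "x \<in> W" "f x = z" "liso b X X f W" "\<And>u. u \<in> W \<Longrightarrow> regular b g u (f u)"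
  using assms unfolding regular_def by blast

text \<open>Two representatives with distinct values at \<open>x\<close> differ on a neighbourhood
  of \<open>x\<close> by the Hausdorff property; this neighbourhood is infinite, while
  representatives differ at finitely many points only. The two flags are independent, so projective
  and topological values also coincide.\<close>

lemma regular_unique:
  assumes g: "g \<in> carrier G" and 1: "regular b g x z" and 2: "regular b' g x z'"
  shows "z = z'"
proof (rule ccontr)
  assume "z \<noteq> z'"
  moreover have "z \<in> points X" "z' \<in> points X" using 1 2 regular_points by auto
  ultimately obtain U U' where U: "openin (ctop X) U" "openin (ctop X) U'" "z \<in> U" "z' \<in> U'" "disjnt U U'"
    using projective_curveD(1)[OF curve] unfolding Hausdorff_space_def by blast
  obtain f W where f: "f \<in> g" "x \<in> W" "f x = z" "liso b X X f W" using 1 unfolding regular_def by blast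
  obtain f' W' where f': "f' \<in> g" "x \<in> W'" "f' x = z'" "liso b' X X f' W'" using 2 unfolding regular_def by blast
  let ?N = "{u \<in> W. f u \<in> U} \<inter> {u \<in> W'. f' u \<in> U'}"
  have "openin (ctop X) ?N" using U f f' by (intro openin_Int lisoD(6))
  moreover have "x \<in> ?N" using U f f' by auto
  ultimately have "infinite ?N" using infinite_open by blast
  moreover have "?N \<subseteq> {u \<in> points X. f u \<noteq> f' u}"
    using lisoD(3)[OF f(4)] U(5) by (auto simp: disjnt_def)
  moreover have "finite {u \<in> points X. f u \<noteq> f' u}"
    using reps_agree[OF g f(1) f'(1)] by (simp add: agree_def)
  ultimately show False using finite_subset by blast
qed

lemma regular_one: "x \<in> points X \<Longrightarrow> regular b \<one>\<^bsub>G\<^esub> x x"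
  unfolding regular_def using rep_one liso_id[OF curve openin_topspace] by (metis id_apply)

lemma regular_mult:
  assumes g: "g \<in> carrier G" and h: "h \<in> carrier G" and 1: "regular b g y z" and 2: "regular b h x y"
  shows "regular b (g \<otimes>\<^bsub>G\<^esub> h) x z"
proof -
  obtain f W where f: "f \<in> g" "y \<in> W" "f y = z" "liso b X X f W" using 1 unfolding regular_def by blast
  obtain k V where k: "k \<in> h" "x \<in> V" "k x = y" "liso b X X k V" using 2 unfolding regular_def by blast
  have "liso b X X (f \<circ> k) {u \<in> V. k u \<in> W}"
    by (rule liso_compose[OF curve liso_restrict[OF k(4) lisoD(6)[OF k(4) lisoD(1)[OF f(4)]]] f(4)]) auto
  then show ?thesis
    using rep_mult[OF g h f(1) k(1)] f k unfolding regular_def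
    by (intro bexI[of _ "f \<circ> k"] exI[of _ "{u \<in> V. k u \<in> W}"]) auto
qed

lemma regular_inv:
  assumes g: "g \<in> carrier G" and 1: "regular b g x z"
  shows "regular b (inv\<^bsub>G\<^esub> g) z x"
proof -
  obtain f W where f: "f \<in> g" "x \<in> W" "f x = z" "liso b X X f W" using 1 unfolding regular_def by blast
  have ig: "inv\<^bsub>G\<^esub> g \<in> carrier G" using g by simp
  obtain k where k: "k \<in> inv\<^bsub>G\<^esub> g" using ex_rep[OF ig] by blast
  have "k \<circ> f \<in> \<one>\<^bsub>G\<^esub>" using rep_mult[OF ig g k f(1)] g by simp
  then have "agree X (k \<circ> f) id" using reps_agree[OF _ _ rep_one] by simp
  then have fin: "finite {u \<in> points X. k (f u) \<noteq> u}" by (simp add: agree_def)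
  \<comment> \<open>A representative \<open>k\<close> of the inverse may fail to invert
    \<open>f\<close> at finitely many points. Correcting it on the image of \<open>W\<close> stays
    in the class and gives a local inverse at \<open>z\<close>.\<close>
  define k' where "k' u = (if u \<in> f ` W then inv_into W f u else k u)" for u
  have inv: "inv_into W f (f u) = u" if "u \<in> W" for u using lisoD(2)[OF f(4)] that by simp
  have "{u \<in> points X. k u \<noteq> k' u} \<subseteq> f ` {u \<in> points X. k (f u) \<noteq> u}"
  proof
    fix u assume u: "u \<in> {u \<in> points X. k u \<noteq> k' u}"
    then obtain w where w: "w \<in> W" "u = f w" by (auto simp: k'_def split: if_splits)
    then have "k' u = w" using inv by (simp add: k'_def)
    then show "u \<in> f ` {u \<in> points X. k (f u) \<noteq> u}" using u w lisoD(3)[OF f(4)] by auto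
  qed
  then have "agree X k k'" unfolding agree_def using finite_imageI[OF fin] by (rule finite_subset)
  then have "k' \<in> inv\<^bsub>G\<^esub> g" by (rule rep_cong[OF ig k])
  moreover have "liso b X X k' (f ` W)"
    by (rule liso_cong[OF liso_inverse[OF curve f(4)]]) (simp add: k'_def)
  moreover have "z \<in> f ` W" "k' z = x" using f inv by (auto simp: k'_def)
  ultimately show ?thesis unfolding regular_def by blast
qed

text \<open>The source of the later finiteness statements: a representative is a local isomorphism
  on one cofinite set, and is itself the witness of regularity at all its points.\<close>

lemma cofin_regular:
  assumes g: "g \<in> carrier G" and f: "f \<in> g"
  shows "cofin X {x \<in> points X. regular True g x (f x)}"
proof -
  obtain S where S: "cofin X S" "liso True X X f S"
    using carrier_class(1)[OF g f] pw_rep_iff_liso[OF curve curve] by blast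
  have "S \<subseteq> {x \<in> points X. regular True g x (f x)}"
    unfolding regular_def using f S(2) lisoD(3)[OF S(2)] by blast
  then show ?thesis by (rule cofin_mono[OF S(1)]) blast
qed

end

section \<open>The universal globalization\<close>

context perfect_curve
begin

text \<open>\<open>pt g x\<close> is the class of \<open>(g, x)\<close> in the quotient of \<open>G \<times> X\<close> that identifies \<open>(g h, x)\<close> with
  \<open>(g, h x)\<close> whenever \<open>h\<close> is regular at \<open>x\<close>. The curve itself sits inside as the points \<open>pt \<one> x\<close>.\<close>

definition pt :: "('a \<Rightarrow> 'a) set \<Rightarrow> 'a \<Rightarrow> (('a \<Rightarrow> 'a) set \<times> 'a) set" where
  "pt g x = {(g', x'). g' \<in> carrier G \<and> regular True (inv\<^bsub>G\<^esub> g' \<otimes>\<^bsub>G\<^esub> g) x x'}"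

definition pts :: "(('a \<Rightarrow> 'a) set \<times> 'a) set set" where
  "pts = {pt g x | g x. g \<in> carrier G \<and> x \<in> points X}"

text \<open>Left translation of the group component. It is made extensional outside
  \<open>pts\<close> because \<open>Bij\<close> demands it.\<close>

definition act :: "('a \<Rightarrow> 'a) set \<Rightarrow> (('a \<Rightarrow> 'a) set \<times> 'a) set \<Rightarrow> (('a \<Rightarrow> 'a) set \<times> 'a) set" where
  "act h = (\<lambda>p\<in>pts. (\<lambda>(g, x). (h \<otimes>\<^bsub>G\<^esub> g, x)) ` p)"

definition base :: "(('a \<Rightarrow> 'a) set \<times> 'a) set set" where
  "base = pt \<one>\<^bsub>G\<^esub> ` points X"

lemma inv_mult_cancel:
  assumes "g \<in> carrier G" "h \<in> carrier G" "k \<in> carrier G"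
  shows "(inv\<^bsub>G\<^esub> k \<otimes>\<^bsub>G\<^esub> h) \<otimes>\<^bsub>G\<^esub> (inv\<^bsub>G\<^esub> h \<otimes>\<^bsub>G\<^esub> g) = inv\<^bsub>G\<^esub> k \<otimes>\<^bsub>G\<^esub> g"
proof -
  have "h \<otimes>\<^bsub>G\<^esub> (inv\<^bsub>G\<^esub> h \<otimes>\<^bsub>G\<^esub> g) = g" using assms by (simp flip: PC.m_assoc)
  then show ?thesis using assms by (simp add: PC.m_assoc)
qed

lemma inv_mult_left:
  assumes "g \<in> carrier G" "h \<in> carrier G" "k \<in> carrier G"
  shows "inv\<^bsub>G\<^esub> (h \<otimes>\<^bsub>G\<^esub> k) \<otimes>\<^bsub>G\<^esub> (h \<otimes>\<^bsub>G\<^esub> g) = inv\<^bsub>G\<^esub> k \<otimes>\<^bsub>G\<^esub> g"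
proof -
  have "inv\<^bsub>G\<^esub> h \<otimes>\<^bsub>G\<^esub> (h \<otimes>\<^bsub>G\<^esub> g) = g" using assms by (simp flip: PC.m_assoc)
  then show ?thesis using assms by (simp add: PC.inv_mult_group PC.m_assoc)
qed

text \<open>The relation on the right is an equivalence relation on pairs, because regularity is
  stable under identity, products and inverses; \<open>pt g x\<close> is the class of the pair
  \<open>(g, x)\<close>.\<close>

lemma pt_eq_iff:
  assumes g: "g \<in> carrier G" "g' \<in> carrier G" and x: "x' \<in> points X"
  shows "pt g x = pt g' x' \<longleftrightarrow> regular True (inv\<^bsub>G\<^esub> g' \<otimes>\<^bsub>G\<^esub> g) x x'"
proof
  assume eq: "pt g x = pt g' x'"
  have "(g', x') \<in> pt g' x'" using g x regular_one by (simp add: pt_def)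
  then show "regular True (inv\<^bsub>G\<^esub> g' \<otimes>\<^bsub>G\<^esub> g) x x'" unfolding eq[symmetric] by (simp add: pt_def)
next
  have trans: "regular True (inv\<^bsub>G\<^esub> c \<otimes>\<^bsub>G\<^esub> a) u w"
    if "a \<in> carrier G" "b \<in> carrier G" "c \<in> carrier G"
      "regular True (inv\<^bsub>G\<^esub> b \<otimes>\<^bsub>G\<^esub> a) u v" "regular True (inv\<^bsub>G\<^esub> c \<otimes>\<^bsub>G\<^esub> b) v w" for a b c u v w
    using regular_mult[OF _ _ that(5,4)] that(1-3) inv_mult_cancel[OF that(1-3)] by simp
  assume r: "regular True (inv\<^bsub>G\<^esub> g' \<otimes>\<^bsub>G\<^esub> g) x x'"
  have "inv\<^bsub>G\<^esub> (inv\<^bsub>G\<^esub> g' \<otimes>\<^bsub>G\<^esub> g) = inv\<^bsub>G\<^esub> g \<otimes>\<^bsub>G\<^esub> g'" using g by (simp add: PC.inv_mult_group)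
  then have r': "regular True (inv\<^bsub>G\<^esub> g \<otimes>\<^bsub>G\<^esub> g') x' x" using regular_inv[OF _ r] g by simp
  show "pt g x = pt g' x'"
    unfolding pt_def using trans[OF g(2,1) _ r'] trans[OF g _ r] by blast
qed

lemma pt_inj:
  assumes "g \<in> carrier G" "x \<in> points X" "y \<in> points X" "pt g x = pt g y"
  shows "x = y"
proof -
  have "regular True \<one>\<^bsub>G\<^esub> x y" using pt_eq_iff[of g g y x] assms by simp
  then show ?thesis using regular_unique[OF PC.one_closed regular_one] assms(2) by blast
qed

lemma inj_on_pt: "g \<in> carrier G \<Longrightarrow> inj_on (pt g) (points X)"
  by (rule inj_onI) (rule pt_inj)

lemma pt_one_eq:
  assumes "g \<in> carrier G" "regular True g x z"
  shows "pt g x = pt \<one>\<^bsub>G\<^esub> z"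
  using assms regular_points[OF assms(2)] by (subst pt_eq_iff) auto

lemma act_pt:
  assumes h: "h \<in> carrier G" and g: "g \<in> carrier G" and x: "x \<in> points X"
  shows "act h (pt g x) = pt (h \<otimes>\<^bsub>G\<^esub> g) x"
proof -
  have "(\<lambda>(g, x). (h \<otimes>\<^bsub>G\<^esub> g, x)) ` pt g x = pt (h \<otimes>\<^bsub>G\<^esub> g) x"
  proof (intro equalityI subsetI)
    fix q assume "q \<in> (\<lambda>(g, x). (h \<otimes>\<^bsub>G\<^esub> g, x)) ` pt g x"
    then obtain k y where "k \<in> carrier G" "regular True (inv\<^bsub>G\<^esub> k \<otimes>\<^bsub>G\<^esub> g) x y" "q = (h \<otimes>\<^bsub>G\<^esub> k, y)"
      by (auto simp: pt_def)
    then show "q \<in> pt (h \<otimes>\<^bsub>G\<^esub> g) x" using h inv_mult_left[OF g h] by (simp add: pt_def)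
  next
    fix q assume "q \<in> pt (h \<otimes>\<^bsub>G\<^esub> g) x"
    then obtain k y where k: "k \<in> carrier G" "regular True (inv\<^bsub>G\<^esub> k \<otimes>\<^bsub>G\<^esub> (h \<otimes>\<^bsub>G\<^esub> g)) x y" "q = (k, y)"
      by (auto simp: pt_def)
    have hk: "h \<otimes>\<^bsub>G\<^esub> (inv\<^bsub>G\<^esub> h \<otimes>\<^bsub>G\<^esub> k) = k" using h k(1) by (simp flip: PC.m_assoc)
    have "inv\<^bsub>G\<^esub> k \<otimes>\<^bsub>G\<^esub> (h \<otimes>\<^bsub>G\<^esub> g) = inv\<^bsub>G\<^esub> (inv\<^bsub>G\<^esub> h \<otimes>\<^bsub>G\<^esub> k) \<otimes>\<^bsub>G\<^esub> g"
      using inv_mult_left[OF g h, of "inv\<^bsub>G\<^esub> h \<otimes>\<^bsub>G\<^esub> k"] h k(1) hk by simp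
    then have "(inv\<^bsub>G\<^esub> h \<otimes>\<^bsub>G\<^esub> k, y) \<in> pt g x" using k(1,2) h by (simp add: pt_def)
    then show "q \<in> (\<lambda>(g, x). (h \<otimes>\<^bsub>G\<^esub> g, x)) ` pt g x"
      using k(3) hk by (intro image_eqI[of _ _ "(inv\<^bsub>G\<^esub> h \<otimes>\<^bsub>G\<^esub> k, y)"]) simp_all
  qed
  moreover have "pt g x \<in> pts" using g x by (auto simp: pts_def)
  ultimately show ?thesis by (simp add: act_def)
qed

section \<open>The group action on the globalization\<close>

lemma ptsE:
  assumes "p \<in> pts"
  obtains g x where "g \<in> carrier G" "x \<in> points X" "p = pt g x"
  using assms unfolding pts_def by blast

lemma act_closed: "h \<in> carrier G \<Longrightarrow> p \<in> pts \<Longrightarrow> act h p \<in> pts"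
  by (erule ptsE) (auto simp: act_pt pts_def)

lemma act_mult:
  "h \<in> carrier G \<Longrightarrow> k \<in> carrier G \<Longrightarrow> p \<in> pts \<Longrightarrow> act (h \<otimes>\<^bsub>G\<^esub> k) p = act h (act k p)"
  by (erule ptsE) (simp add: act_pt PC.m_assoc)

lemma act_one: "p \<in> pts \<Longrightarrow> act \<one>\<^bsub>G\<^esub> p = p"
  by (erule ptsE) (simp add: act_pt)

lemma act_inv:
  assumes "h \<in> carrier G" "p \<in> pts"
  shows "act (inv\<^bsub>G\<^esub> h) (act h p) = p" "act h (act (inv\<^bsub>G\<^esub> h) p) = p"
  using assms act_mult[of "inv\<^bsub>G\<^esub> h" h p] act_mult[of h "inv\<^bsub>G\<^esub> h" p] act_one by simp_all

lemma act_Bij: "h \<in> carrier G \<Longrightarrow> act h \<in> Bij pts"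
  unfolding Bij_def
  by (intro IntI CollectI bij_betwI[where g = "act (inv\<^bsub>G\<^esub> h)"])
    (simp_all add: act_closed act_inv, simp add: act_def)

lemma group_action_pts: "group_action G pts act"
proof (intro group_action.intro group_hom.intro group_hom_axioms.intro homI)
  show "group G" by (rule PC.is_group)
  show "group (BijGroup pts)" by (rule group_BijGroup)
  show "act g \<in> carrier (BijGroup pts)" if "g \<in> carrier G" for g
    using act_Bij[OF that] by (simp add: BijGroup_def)
  fix g h assume gh: "g \<in> carrier G" "h \<in> carrier G"
  show "act (g \<otimes>\<^bsub>G\<^esub> h) = act g \<otimes>\<^bsub>BijGroup pts\<^esub> act h"
  proof
    fix p show "act (g \<otimes>\<^bsub>G\<^esub> h) p = (act g \<otimes>\<^bsub>BijGroup pts\<^esub> act h) p"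
      using act_mult[OF gh] act_Bij gh
      by (cases "p \<in> pts") (simp_all add: BijGroup_def compose_def, simp add: act_def)
  qed
qed

section \<open>Commensuration and separation of the translates of the curve\<close>

lemma finite_pt_diff:
  assumes g: "g \<in> carrier G" and k: "k \<in> carrier G"
  shows "finite (pt g ` points X - pt k ` points X)"
proof -
  have gk: "inv\<^bsub>G\<^esub> k \<otimes>\<^bsub>G\<^esub> g \<in> carrier G" using g k by simp
  obtain f where f: "f \<in> inv\<^bsub>G\<^esub> k \<otimes>\<^bsub>G\<^esub> g" using ex_rep[OF gk] by blast
  \<comment> \<open>Where the quotient of \<open>g\<close> by \<open>k\<close> is regular at
    \<open>x\<close> with value \<open>f x\<close>, the points \<open>pt g x\<close> and
    \<open>pt k (f x)\<close> coincide. The difference thus comes from the finitely many points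
    outside \<open>?R\<close>.\<close>
  let ?R = "{x \<in> points X. regular True (inv\<^bsub>G\<^esub> k \<otimes>\<^bsub>G\<^esub> g) x (f x)}"
  have "pt g x \<in> pt k ` points X" if "x \<in> ?R" for x
    using that regular_points pt_eq_iff[OF g k, of "f x" x] by blast
  then have "pt g ` points X - pt k ` points X \<subseteq> pt g ` (points X - ?R)" by blast
  moreover have "finite (points X - ?R)" using cofin_regular[OF gk f] by (simp add: cofin_def)
  ultimately show ?thesis using finite_surj by blast
qed

lemma base_subset: "base \<subseteq> pts"
  unfolding base_def pts_def by blast

lemma commensurated_base: "commensurated G act pts base"
  unfolding commensurated_def
proof (intro conjI ballI base_subset)
  fix g assume g: "g \<in> carrier G"
  have "act g ` base = pt g ` points X"
    unfolding base_def image_image using g by (intro image_cong) (simp_all add: act_pt)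
  then show "finite (sym_diff base (act g ` base))"
    unfolding base_def using finite_pt_diff[OF g PC.one_closed] finite_pt_diff[OF PC.one_closed g] by simp
qed

lemma act_image_pt:
  assumes "h \<in> carrier G" "g \<in> carrier G" "V \<subseteq> points X"
  shows "act h ` pt g ` V = pt (h \<otimes>\<^bsub>G\<^esub> g) ` V"
  unfolding image_image using assms by (intro image_cong) (auto simp: act_pt)

text \<open>Existence of disjoint neighbourhoods. The globalization is given no topology of its own:
  the images under \<open>pt g\<close> of open subsets of \<open>X\<close> serve as basic open
  sets.\<close>

definition separated :: "(('a \<Rightarrow> 'a) set \<times> 'a) set \<Rightarrow> (('a \<Rightarrow> 'a) set \<times> 'a) set \<Rightarrow> bool" where
  "separated p q \<longleftrightarrow> (\<exists>g\<in>carrier G. \<exists>h\<in>carrier G. \<exists>V W. openin (ctop X) V \<and> openin (ctop X) W \<and>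
     p \<in> pt g ` V \<and> q \<in> pt h ` W \<and> pt g ` V \<inter> pt h ` W = {})"

lemma separated_act:
  assumes k: "k \<in> carrier G" and pq: "separated p q"
  shows "separated (act k p) (act k q)"
proof -
  obtain g h V W where gh: "g \<in> carrier G" "h \<in> carrier G" "openin (ctop X) V" "openin (ctop X) W"
    "p \<in> pt g ` V" "q \<in> pt h ` W" "pt g ` V \<inter> pt h ` W = {}"
    using pq unfolding separated_def by blast
  have VW: "V \<subseteq> points X" "W \<subseteq> points X" by (rule openin_subset[OF gh(3)], rule openin_subset[OF gh(4)])
  have sub: "pt g ` V \<subseteq> pts" "pt h ` W \<subseteq> pts" using gh(1,2) VW unfolding pts_def by blast+
  have "inj_on (act k) pts" using act_Bij[OF k] by (auto simp: Bij_def bij_betw_def)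
  then have "act k ` pt g ` V \<inter> act k ` pt h ` W = {}"
    using inj_on_image_Int[of "act k" pts "pt g ` V" "pt h ` W"] sub gh(7) by simp
  then have disj: "pt (k \<otimes>\<^bsub>G\<^esub> g) ` V \<inter> pt (k \<otimes>\<^bsub>G\<^esub> h) ` W = {}"
    unfolding act_image_pt[OF k gh(1) VW(1)] act_image_pt[OF k gh(2) VW(2)] .
  have "act k p \<in> pt (k \<otimes>\<^bsub>G\<^esub> g) ` V" "act k q \<in> pt (k \<otimes>\<^bsub>G\<^esub> h) ` W"
    unfolding act_image_pt[OF k gh(1) VW(1), symmetric] act_image_pt[OF k gh(2) VW(2), symmetric]
    using gh(5,6) by (simp_all only: imageI)
  then show ?thesis
    unfolding separated_def using PC.m_closed[OF k gh(1)] PC.m_closed[OF k gh(2)] gh(3,4) disj by blast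
qed

lemma separated_same:
  assumes g: "g \<in> carrier G" and p: "p \<in> pt g ` points X" "q \<in> pt g ` points X" "p \<noteq> q"
  shows "separated p q"
proof -
  obtain x y where xy: "x \<in> points X" "y \<in> points X" "p = pt g x" "q = pt g y" using p by blast
  then have "x \<noteq> y" using p by blast
  then obtain V W where V: "openin (ctop X) V" "openin (ctop X) W" "x \<in> V" "y \<in> W" "disjnt V W"
    using projective_curveD(1)[OF curve] xy unfolding Hausdorff_space_def by blast
  have "V \<subseteq> points X" "W \<subseteq> points X" using V openin_subset by auto
  then have "pt g ` V \<inter> pt g ` W = {}"
    using inj_on_image_Int[OF inj_on_pt[OF g], of V W] V(5) by (simp add: disjnt_def)
  then show ?thesis unfolding separated_def using g V xy by blast
qed

text \<open>As \<open>H\<close> contains inverses, stability under all its elements already gives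
  equality.\<close>

lemma invariantI:
  assumes H: "subgroup H G" and M: "M \<subseteq> pts" and "\<And>h p. h \<in> H \<Longrightarrow> p \<in> M \<Longrightarrow> act h p \<in> M" and h: "h \<in> H"
  shows "act h ` M = M"
proof
  show "act h ` M \<subseteq> M" using assms by blast
  show "M \<subseteq> act h ` M"
  proof
    fix p assume p: "p \<in> M"
    have hG: "h \<in> carrier G" using subgroup.mem_carrier[OF H h] .
    have "inv\<^bsub>G\<^esub> h \<in> H" using subgroup.m_inv_closed[OF H h] .
    then have "act (inv\<^bsub>G\<^esub> h) p \<in> M" using assms(3) p by blast
    moreover have "p = act h (act (inv\<^bsub>G\<^esub> h) p)" using act_inv(2)[OF hG] p M by auto
    ultimately show "p \<in> act h ` M" by blast
  qed
qed

text \<open>Two nonseparated points cannot both lie in one translate of the curve. Hence an invariant set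
  commensurate to the curve has only finitely many points that are not separated from some other
  one, and they may be discarded.\<close>

lemma ex_separated_invariant:
  assumes H: "subgroup H G" and FW: "relative_FW G H"
  obtains M where "M \<subseteq> pts" "\<And>h. h \<in> H \<Longrightarrow> act h ` M = M" "finite (sym_diff base M)"
    "\<And>p q. p \<in> M \<Longrightarrow> q \<in> M \<Longrightarrow> p \<noteq> q \<Longrightarrow> separated p q"
proof -
  have HG: "H \<subseteq> carrier G" by (rule subgroup.subset[OF H])
  \<comment> \<open>The points of the globalization do not have the type used in
    \<open>relative_FW\<close>, hence the passage through \<open>relative_FW_imp_on\<close>.\<close>
  have "\<exists>M\<subseteq>pts. (\<forall>h\<in>H. act h ` M = M) \<and> finite (sym_diff base M)"
    using relative_FW_imp_on[OF FW HG, unfolded relative_FW_on_def, rule_format,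
        OF conjI, OF group_action_pts commensurated_base] .
  then obtain M where M: "M \<subseteq> pts" "\<And>h. h \<in> H \<Longrightarrow> act h ` M = M" "finite (sym_diff base M)"
    by metis
  define N where "N = {p \<in> M. \<forall>q\<in>M. q \<noteq> p \<longrightarrow> separated p q}"
  have NM: "N \<subseteq> M" by (auto simp: N_def)
  define E where "E = M - base"
  have "\<forall>q\<in>E. \<exists>g. g \<in> carrier G \<and> q \<in> pt g ` points X"
    using M(1) unfolding E_def pts_def by blast
  then obtain t where t: "\<And>q. q \<in> E \<Longrightarrow> t q \<in> carrier G \<and> q \<in> pt (t q) ` points X" by metis
  \<comment> \<open>Let \<open>p\<close> in \<open>base\<close> be nonseparated from
    \<open>q\<close>. Then \<open>q\<close> lies outside \<open>base\<close>, hence in the finite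
    set \<open>E\<close>, and \<open>p\<close> lies outside the chosen translate containing
    \<open>q\<close>; each \<open>q\<close> leaves finitely many such \<open>p\<close>.\<close>
  have "M - N \<subseteq> E \<union> (\<Union>q\<in>E. base - pt (t q) ` points X)"
  proof
    fix p assume "p \<in> M - N"
    then obtain q where p: "p \<in> M" and q: "q \<in> M" "q \<noteq> p" "\<not> separated p q" by (auto simp: N_def)
    show "p \<in> E \<union> (\<Union>q\<in>E. base - pt (t q) ` points X)"
    proof (cases "p \<in> base")
      case True
      then have "q \<notin> base"
        using separated_same[OF PC.one_closed, of p q] q unfolding base_def by metis
      then have "q \<in> E" using q by (simp add: E_def)
      moreover have "p \<notin> pt (t q) ` points X"
        using separated_same[of "t q" p q] t[OF \<open>q \<in> E\<close>] q by metis
      ultimately show ?thesis using True by blast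
    qed (use p in \<open>simp add: E_def\<close>)
  qed
  moreover have "finite E" using M(3) by (simp add: E_def)
  moreover have "finite (base - pt (t q) ` points X)" if "q \<in> E" for q
    unfolding base_def using finite_pt_diff[OF PC.one_closed] t[OF that] by blast
  ultimately have finMN: "finite (M - N)" by (meson finite_UN_I finite_Un finite_subset)
  show ?thesis
  proof (rule that[of N])
    show "N \<subseteq> pts" using NM M(1) by blast
    show "act h ` N = N" if "h \<in> H" for h
    proof (rule invariantI[OF H \<open>N \<subseteq> pts\<close> _ that])
      fix h p assume h: "h \<in> H" and p: "p \<in> N"
      have "separated (act h p) q" if q: "q \<in> M" "q \<noteq> act h p" for q
      proof -
        obtain r where r: "r \<in> M" "q = act h r" using M(2)[OF h] q(1) by blast
        then have "separated p r" using q(2) p by (auto simp: N_def)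
        then show ?thesis using separated_act[of h p r] h HG r(2) by blast
      qed
      moreover have "act h p \<in> M" using M(2)[OF h] p NM by blast
      ultimately show "act h p \<in> N" by (simp add: N_def)
    qed
    have "sym_diff base N \<subseteq> sym_diff base M \<union> (M - N)" using NM by blast
    then show "finite (sym_diff base N)" using M(3) finMN finite_subset by blast
    show "separated p q" if "p \<in> N" "q \<in> N" "p \<noteq> q" for p q using that by (auto simp: N_def)
  qed
qed

end


section \<open>Invariant models\<close>

text \<open>Both curves have points in the same type, so the identity map can represent the
  isomorphism. Its inverse class is then also that of the identity, and conjugation keeps the
  representative.\<close>

lemma conj_class_id:
  assumes X: "projective_curve X" and Y: "projective_curve Y"
    and i: "pw_rep X Y id" and f: "pw_rep X X f"
  shows "conj_class X Y (pw_class X Y id) (pw_class X X f) = pw_class Y Y f"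
proof -
  obtain k where k: "pw_rep Y X k" "agree Y (id \<circ> k) id" using pw_rep_inverse[OF X Y i] by blast
  have i': "pw_rep Y X id" using pw_rep_agree[OF Y X k(1)] k(2) by simp
  have "pw_inverse X Y (pw_class X Y id) = pw_class Y X id"
    by (rule pw_inverse_class[OF X Y i i']) simp
  moreover have "pw_comp X Y (pw_class X Y id) (pw_class X X f) = pw_class X Y (id \<circ> f)"
    by (rule pw_comp_class[OF X X Y f i])
  moreover have "pw_comp Y Y (pw_class X Y (id \<circ> f)) (pw_class Y X id) = pw_class Y Y (id \<circ> f \<circ> id)"
    by (rule pw_comp_class[OF Y X Y i' pw_rep_compose[OF X X Y f i]])
  ultimately show ?thesis by (simp add: conj_class_def)
qed

context perfect_curve
begin

text \<open>The domain of the piece indexed by \<open>g\<close> when \<open>M\<close> is built by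
  gluing.\<close>

definition chart_dom :: "(('a \<Rightarrow> 'a) set \<times> 'a) set set \<Rightarrow> ('a \<Rightarrow> 'a) set \<Rightarrow> 'a set" where
  "chart_dom M g = {x \<in> points X. pt g x \<in> M}"

text \<open>The translate by \<open>g\<close> leaves \<open>base\<close> at finitely many points,
  and \<open>base\<close> leaves \<open>M\<close> at finitely many; injectivity of
  \<open>pt g\<close> brings this back to \<open>X\<close>. In particular the domain is
  open.\<close>

lemma cofin_chart_dom:
  assumes M: "finite (sym_diff base M)" and g: "g \<in> carrier G"
  shows "cofin X (chart_dom M g)"
proof -
  have "pt g ` (points X - chart_dom M g) \<subseteq> (pt g ` points X - base) \<union> (base - M)"
    by (auto simp: chart_dom_def)
  moreover have "finite (pt g ` points X - base)"
    unfolding base_def by (rule finite_pt_diff[OF g PC.one_closed])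
  ultimately have "finite (pt g ` (points X - chart_dom M g))"
    using M by (meson finite_Un finite_subset)
  then have "finite (points X - chart_dom M g)"
    by (rule finite_imageD) (rule inj_on_subset[OF inj_on_pt[OF g]], blast)
  then show ?thesis by (auto simp: cofin_def chart_dom_def)
qed

text \<open>The model is \<open>M\<close> with its points renamed by \<open>j\<close>, so that the piecewise isomorphism from \<open>X\<close>
  becomes the identity.\<close>

lemma ex_model:
  fixes j :: "(('a \<Rightarrow> 'a) set \<times> 'a) set \<Rightarrow> 'a"
  assumes H: "subgroup H G" and M: "M \<subseteq> pts" and inv: "\<And>h. h \<in> H \<Longrightarrow> act h ` M = M"
    and fin: "finite (sym_diff base M)"
    and sep: "\<And>p q. p \<in> M \<Longrightarrow> q \<in> M \<Longrightarrow> p \<noteq> q \<Longrightarrow> separated p q"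
    and j: "inj_on j M" and j_base: "\<And>x. x \<in> chart_dom M \<one>\<^bsub>G\<^esub> \<Longrightarrow> j (pt \<one>\<^bsub>G\<^esub> x) = x"
  obtains X' where "projective_curve X'" "points X' = j ` M"
    "\<And>U. openin (ctop X') U \<longleftrightarrow>
       U \<subseteq> j ` M \<and> (\<forall>g\<in>carrier G. openin (ctop X) {x \<in> chart_dom M g. j (pt g x) \<in> U})"
    "liso True X X' id (chart_dom M \<one>\<^bsub>G\<^esub>)" "pw_rep X X' id"
    "conj_class X X' (pw_class X X' id) ` H \<subseteq> Aut_Proj X'"
proof -
  have jj: "p = q" if "p \<in> M" "q \<in> M" "j p = j q" for p q using inj_onD[OF j that(3,1,2)] .
  have dom: "x \<in> points X" "pt g x \<in> M" if "x \<in> chart_dom M g" for g x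
    using that by (simp_all add: chart_dom_def)
  have open_dom: "openin (ctop X) (chart_dom M g)" if "g \<in> carrier G" for g
    using openin_cofin[OF curve cofin_chart_dom[OF fin that]] .
  have un: "(\<Union>g\<in>carrier G. (\<lambda>x. j (pt g x)) ` chart_dom M g) = j ` M"
  proof (intro equalityI subsetI)
    fix p assume "p \<in> j ` M"
    then obtain q where q: "q \<in> M" "p = j q" by blast
    then obtain g x where "g \<in> carrier G" "x \<in> points X" "q = pt g x" using M unfolding pts_def by blast
    then show "p \<in> (\<Union>g\<in>carrier G. (\<lambda>x. j (pt g x)) ` chart_dom M g)" using q by (auto simp: chart_dom_def)
  qed (use dom in blast)
  interpret gl: gluing X "carrier G" "chart_dom M" "\<lambda>g x. j (pt g x)"
  proof
    show "projective_curve X" by (rule curve)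
    show "openin (ctop X) (chart_dom M g)" if "g \<in> carrier G" for g by (rule open_dom[OF that])
    show "inj_on (\<lambda>x. j (pt g x)) (chart_dom M g)" if "g \<in> carrier G" for g
      by (rule inj_onI, rule pt_inj[OF that]) (simp_all add: dom jj)
  next
    fix g g' x y
    assume g: "g \<in> carrier G" "g' \<in> carrier G" and x: "x \<in> chart_dom M g" and y: "y \<in> chart_dom M g'"
      and eq: "j (pt g x) = j (pt g' y)"
    have "pt g x = pt g' y" using jj eq dom x y by blast
    then have "regular True (inv\<^bsub>G\<^esub> g' \<otimes>\<^bsub>G\<^esub> g) x y" using pt_eq_iff[OF g] dom(1) y by blast
    \<comment> \<open>The transition map from piece \<open>g\<close> to piece \<open>g'\<close> is a
      representative of the quotient of \<open>g\<close> by \<open>g'\<close>, which remains regular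
      near \<open>x\<close>.\<close>
    then obtain f W where f: "x \<in> W" "f x = y" "liso True X X f W"
      "\<And>u. u \<in> W \<Longrightarrow> regular True (inv\<^bsub>G\<^esub> g' \<otimes>\<^bsub>G\<^esub> g) u (f u)" by (rule regular_local) blast
    let ?V = "W \<inter> chart_dom M g"
    have "liso True X X f ?V"
      by (rule liso_restrict[OF f(3) openin_Int[OF lisoD(1)[OF f(3)] open_dom[OF g(1)]]]) blast
    moreover have "f v \<in> chart_dom M g' \<and> j (pt g' (f v)) = j (pt g v)" if v: "v \<in> ?V" for v
    proof -
      have fv: "f v \<in> points X" using f(4)[of v] v regular_points by blast
      then have "pt g v = pt g' (f v)" using pt_eq_iff[OF g fv] f(4)[of v] v by blast
      then show ?thesis using dom(2)[of v g] v fv by (simp add: chart_dom_def)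
    qed
    ultimately show "\<exists>f V. x \<in> V \<and> V \<subseteq> chart_dom M g \<and> f x = y \<and> liso True X X f V \<and>
        (\<forall>v\<in>V. f v \<in> chart_dom M g' \<and> j (pt g' (f v)) = j (pt g v))"
      using f(1,2) x by (intro exI[of _ f] exI[of _ ?V]) blast
  next
    fix p q
    assume "p \<in> (\<Union>g\<in>carrier G. (\<lambda>x. j (pt g x)) ` chart_dom M g)"
      "q \<in> (\<Union>g\<in>carrier G. (\<lambda>x. j (pt g x)) ` chart_dom M g)" "p \<noteq> q"
    then obtain p' q' where pq: "p' \<in> M" "p = j p'" "q' \<in> M" "q = j q'" "p' \<noteq> q'" unfolding un by blast
    then obtain g h V W where V: "g \<in> carrier G" "h \<in> carrier G" "openin (ctop X) V" "openin (ctop X) W"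
      "p' \<in> pt g ` V" "q' \<in> pt h ` W" "pt g ` V \<inter> pt h ` W = {}"
      using sep unfolding separated_def by metis
    \<comment> \<open>The separating sets are cut down to the chart domains; their images remain
      disjoint after relabelling because \<open>j\<close> is injective on \<open>M\<close>.\<close>
    have "openin (ctop X) (V \<inter> chart_dom M g)" "openin (ctop X) (W \<inter> chart_dom M h)"
      using V open_dom by (simp_all add: openin_Int)
    moreover have "V \<subseteq> points X" "W \<subseteq> points X"
      by (rule openin_subset[OF V(3)], rule openin_subset[OF V(4)])
    then have "p \<in> (\<lambda>x. j (pt g x)) ` (V \<inter> chart_dom M g)" "q \<in> (\<lambda>x. j (pt h x)) ` (W \<inter> chart_dom M h)"
      using V(5,6) pq by (auto simp: chart_dom_def)
    moreover have "(\<lambda>x. j (pt g x)) ` (V \<inter> chart_dom M g) \<inter> (\<lambda>x. j (pt h x)) ` (W \<inter> chart_dom M h) = {}"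
    proof (rule ccontr)
      assume "\<not> ?thesis"
      then obtain v w where vw: "v \<in> V" "v \<in> chart_dom M g" "w \<in> W" "w \<in> chart_dom M h"
        "j (pt g v) = j (pt h w)" by blast
      then have "pt g v = pt h w" using jj dom(2) by blast
      then show False using V(7) vw(1,3) by blast
    qed
    ultimately show "\<exists>g\<in>carrier G. \<exists>h\<in>carrier G. \<exists>V W. openin (ctop X) V \<and> V \<subseteq> chart_dom M g \<and>
        openin (ctop X) W \<and> W \<subseteq> chart_dom M h \<and>
        p \<in> (\<lambda>x. j (pt g x)) ` V \<and> q \<in> (\<lambda>x. j (pt h x)) ` W \<and>
        (\<lambda>x. j (pt g x)) ` V \<inter> (\<lambda>x. j (pt h x)) ` W = {}"
      using V(1,2) by (meson inf_le2)
  qed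
  have set: "gl.glued_set = j ` M" unfolding gl.glued_set_def by (rule un)
  note curve' = gl.projective_curve_glued
  let ?D = "chart_dom M \<one>\<^bsub>G\<^esub>"
  have lid: "liso True X gl.glued id ?D"
    by (rule liso_cong[OF gl.liso_c[OF PC.one_closed]]) (simp add: j_base)
  have points': "points gl.glued = j ` M" by (simp add: gl.points_glued set)
  have D_sub: "?D \<subseteq> points gl.glued" using lisoD(4)[OF lid] by simp
  have "j ` M - ?D \<subseteq> j ` (M - base)"
  proof
    fix p assume p: "p \<in> j ` M - ?D"
    then obtain q where q: "q \<in> M" "p = j q" by blast
    have "q \<notin> base"
    proof
      assume "q \<in> base"
      then obtain x where "x \<in> ?D" "q = pt \<one>\<^bsub>G\<^esub> x" using q(1) by (auto simp: base_def chart_dom_def)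
      then show False using j_base q(2) p by auto
    qed
    then show "p \<in> j ` (M - base)" using q by blast
  qed
  then have "finite (points gl.glued - ?D)" unfolding points' using fin finite_surj by blast
  then have cof': "cofin gl.glued ?D" using D_sub by (simp add: cofin_def)
  have cof: "cofin X ?D" by (rule cofin_chart_dom[OF fin PC.one_closed])
  have rep: "pw_rep X gl.glued id"
    unfolding pw_rep_iff_liso[OF curve curve'] using cof cof' lid
    by (intro exI[of _ ?D]) simp
  have "conj_class X gl.glued (pw_class X gl.glued id) h \<in> Aut_Proj gl.glued" if h: "h \<in> H" for h
  proof -
    have hG: "h \<in> carrier G" using subgroup.mem_carrier[OF H h] .
    obtain f where f: "f \<in> h" using ex_rep[OF hG] by blast
    note fh = carrier_class[OF hG f]
    \<comment> \<open>The action of \<open>h\<close> read through the labels. It takes piece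
      \<open>g\<close> to the piece of the product of \<open>h\<close> and \<open>g\<close>, which
      has the same domain because \<open>M\<close> is invariant.\<close>
    define F where "F p = j (act h (inv_into M j p))" for p
    have Fj: "F (j p) = j (act h p)" if "p \<in> M" for p
      using inv_into_f_f[OF j that] by (simp add: F_def)
    have actM: "act k p \<in> M" if "k \<in> H" "p \<in> M" for k p using inv[OF that(1)] that(2) by blast
    have hc: "F (j (pt g x)) = j (pt (h \<otimes>\<^bsub>G\<^esub> g) x)" if "g \<in> carrier G" "x \<in> chart_dom M g" for g x
      using Fj[OF dom(2)[OF that(2)]] act_pt[OF hG that(1) dom(1)[OF that(2)]] by simp
    have dom_mult: "chart_dom M (k \<otimes>\<^bsub>G\<^esub> g) = chart_dom M g" if k: "k \<in> H" and g: "g \<in> carrier G" for k g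
    proof -
      have kG: "k \<in> carrier G" using subgroup.mem_carrier[OF H k] .
      have "pt (k \<otimes>\<^bsub>G\<^esub> g) x \<in> M \<longleftrightarrow> pt g x \<in> M" if x: "x \<in> points X" for x
      proof
        have p: "pt g x \<in> pts" using g x unfolding pts_def by blast
        show "pt g x \<in> M" if "pt (k \<otimes>\<^bsub>G\<^esub> g) x \<in> M"
          using actM[OF subgroup.m_inv_closed[OF H k] that] act_pt[OF kG g x] act_inv(1)[OF kG p] by simp
        show "pt (k \<otimes>\<^bsub>G\<^esub> g) x \<in> M" if "pt g x \<in> M" using actM[OF k that] act_pt[OF kG g x] by simp
      qed
      then show ?thesis by (auto simp: chart_dom_def)
    qed
    have "projective_iso gl.glued gl.glued F"
    proof (rule gl.projective_iso_glued)
      show "inj_on F gl.glued_set" unfolding set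
      proof (rule inj_onI)
        fix p q assume "p \<in> j ` M" "q \<in> j ` M" and eq: "F p = F q"
        then obtain p' q' where pq: "p' \<in> M" "q' \<in> M" "p = j p'" "q = j q'" by blast
        then have "act h p' = act h q'" using eq Fj jj actM[OF h] by simp
        then have "p' = q'" using act_inv(1)[OF hG] pq M by (metis subsetD)
        then show "p = q" using pq by simp
      qed
      show "\<exists>g'\<in>carrier G. chart_dom M g' = chart_dom M g \<and> (\<forall>x\<in>chart_dom M g. F (j (pt g x)) = j (pt g' x))"
        if "g \<in> carrier G" for g
        using that hG h by (intro bexI[of _ "h \<otimes>\<^bsub>G\<^esub> g"]) (simp_all add: dom_mult hc)
      show "\<exists>g\<in>carrier G. chart_dom M g = chart_dom M g' \<and> (\<forall>x\<in>chart_dom M g'. F (j (pt g x)) = j (pt g' x))"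
        if g': "g' \<in> carrier G" for g'
      proof -
        let ?g = "inv\<^bsub>G\<^esub> h \<otimes>\<^bsub>G\<^esub> g'"
        have "h \<otimes>\<^bsub>G\<^esub> ?g = g'" using hG g' by (simp flip: PC.m_assoc)
        moreover have "chart_dom M ?g = chart_dom M g'"
          by (rule dom_mult[OF subgroup.m_inv_closed[OF H h] g'])
        moreover have "?g \<in> carrier G" using hG g' by simp
        ultimately show ?thesis using hc[of ?g] by metis
      qed
    qed
    \<comment> \<open>Where \<open>h\<close> is regular at \<open>x\<close> with value
      \<open>f x\<close>, \<open>pt h x\<close> is the base point of \<open>f x\<close>. Labels
      being the identity on the base, \<open>F\<close> and \<open>f\<close> agree at almost every
      point, so \<open>F\<close> represents the conjugate of \<open>h\<close>.\<close>
    moreover have "agree gl.glued f F"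
    proof (rule agreeI)
      let ?R = "{x \<in> points X. regular True h x (f x)}"
      have "cofin X (?R \<inter> ?D)" using cofin_Int[OF cofin_regular[OF hG f] cof] .
      \<comment> \<open>The identity is viewed as an isomorphism from \<open>?D\<close> in
        \<open>X\<close> to \<open>?D\<close> in the model, in order to transport
        cofiniteness.\<close>
      then have "cofin gl.glued (id ` (?R \<inter> ?D))"
        using cofin_image[of X gl.glued ?D "id ` ?D" id "?R \<inter> ?D"] cof cof'
          liso_homeo_iff[OF lisoD(1)[OF lid], of True gl.glued id] lid
        by (simp add: pw_iso_on_def)
      then show "cofin gl.glued (?R \<inter> ?D)" by simp
      fix x assume x: "x \<in> ?R \<inter> ?D"
      then have xD: "x \<in> ?D" and r: "regular True h x (f x)" by blast+
      have e: "pt h x = pt \<one>\<^bsub>G\<^esub> (f x)" by (rule pt_one_eq[OF hG r])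
      have "chart_dom M h = ?D" using dom_mult[OF h PC.one_closed] hG by simp
      then have "pt h x \<in> M" using dom(2) xD by blast
      then have "f x \<in> ?D" using e regular_points[OF r] by (simp add: chart_dom_def)
      then have "j (pt h x) = f x" using e j_base by simp
      then show "f x = F x" using hc[OF PC.one_closed xD] j_base[OF xD] hG by simp
    qed
    ultimately show ?thesis
      unfolding fh(2) conj_class_id[OF curve curve' rep fh(1)] Aut_Proj_def
      using pw_class_cong by blast
  qed
  then show thesis
    using that[OF curve' points' _ lid rep] gl.openin_glued unfolding set by blast
qed

text \<open>Base points are labelled by the points of \<open>X\<close> they come from, and the
  finitely many other points of \<open>M\<close> by fresh elements outside \<open>X\<close>. The
  model thus lives in the point type of \<open>X\<close>.\<close>

lemma ex_labels:
  assumes M: "M \<subseteq> pts" "finite (M - base)" and inf: "infinite (UNIV - points X)"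
  obtains j :: "(('a \<Rightarrow> 'a) set \<times> 'a) set \<Rightarrow> 'a" where "inj_on j M"
    "\<And>x. x \<in> points X \<Longrightarrow> j (pt \<one>\<^bsub>G\<^esub> x) = x"
proof -
  obtain B where B: "B \<subseteq> UNIV - points X" "finite B" "card B = card (M - base)"
    using infinite_arbitrarily_large[OF inf] by blast
  obtain e where e: "bij_betw e (M - base) B"
    using finite_same_card_bij[OF M(2) B(2)] B(3) by auto
  define d where "d = inv_into (points X) (pt \<one>\<^bsub>G\<^esub>)"
  have d: "d (pt \<one>\<^bsub>G\<^esub> x) = x" if "x \<in> points X" for x
    unfolding d_def using inv_into_f_f[OF inj_on_pt[OF PC.one_closed] that] .
  have dB: "d p \<in> points X" "pt \<one>\<^bsub>G\<^esub> (d p) = p" if "p \<in> base" for p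
    using that d by (auto simp: base_def)
  have eB: "e p \<notin> points X" if "p \<in> M" "p \<notin> base" for p
    using e that B(1) by (auto simp: bij_betw_def)
  define j where "j p = (if p \<in> base then d p else e p)" for p
  have "inj_on j M"
  proof (rule inj_onI)
    fix p q assume pq: "p \<in> M" "q \<in> M" "j p = j q"
    show "p = q"
    proof (cases "p \<in> base")
      case True
      then have "j q \<in> points X" using pq(3) dB(1)[of p] by (simp add: j_def)
      then have "q \<in> base" using eB[OF pq(2)] by (simp add: j_def split: if_splits)
      then show ?thesis using True pq(3) dB(2) by (metis j_def)
    next
      case False
      then have "j q \<notin> points X" using pq(1,3) eB[of p] by (simp add: j_def)
      then have "q \<notin> base" using dB(1)[of q] by (simp add: j_def split: if_splits)
      then show ?thesis using False pq inj_onD[OF bij_betw_imp_inj_on[OF e], of p q] by (simp add: j_def)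
    qed
  qed
  moreover have "j (pt \<one>\<^bsub>G\<^esub> x) = x" if "x \<in> points X" for x
    using d[OF that] that by (simp add: j_def base_def)
  ultimately show thesis by (rule that)
qed

end

section \<open>Topological regularity\<close>

context perfect_curve
begin

text \<open>A partial projection of the globalization to \<open>X\<close>, sending the class of
  \<open>(g, x)\<close> to the value at \<open>x\<close> of the topological extension of
  \<open>g\<close>. By \<open>topval_pt\<close> it does not depend on the pair.\<close>

definition topval :: "(('a \<Rightarrow> 'a) set \<times> 'a) set \<Rightarrow> 'a \<Rightarrow> bool" where
  "topval p z \<longleftrightarrow> (\<exists>g\<in>carrier G. \<exists>x. p = pt g x \<and> regular False g x z)"

text \<open>Two pairs with the same class differ by a projectively regular factor. Such a factor is
  also topologically regular and can be composed with the extension.\<close>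

lemma topval_pt:
  assumes g: "g \<in> carrier G" and x: "x \<in> points X"
  shows "topval (pt g x) z \<longleftrightarrow> regular False g x z"
proof
  assume "topval (pt g x) z"
  then obtain g' x' where g': "g' \<in> carrier G" "pt g x = pt g' x'" "regular False g' x' z"
    unfolding topval_def by blast
  then have "regular True (inv\<^bsub>G\<^esub> g' \<otimes>\<^bsub>G\<^esub> g) x x'"
    using pt_eq_iff[OF g g'(1)] regular_points by blast
  from regular_mult[OF g'(1) _ g'(3) regular_forget[OF this]]
  have "regular False (g' \<otimes>\<^bsub>G\<^esub> (inv\<^bsub>G\<^esub> g' \<otimes>\<^bsub>G\<^esub> g)) x z" using g g'(1) by simp
  moreover have "g' \<otimes>\<^bsub>G\<^esub> (inv\<^bsub>G\<^esub> g' \<otimes>\<^bsub>G\<^esub> g) = g" using g g'(1) by (simp flip: PC.m_assoc)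
  ultimately show "regular False g x z" by simp
qed (use g in \<open>auto simp: topval_def\<close>)

lemma topval_unique: "topval p z \<Longrightarrow> topval p w \<Longrightarrow> z = w"
  by (metis topval_def topval_pt regular_points regular_unique)

lemma topval_base: "x \<in> points X \<Longrightarrow> topval (pt \<one>\<^bsub>G\<^esub> x) x"
  by (simp add: topval_pt regular_one)

lemma topval_act:
  assumes h: "h \<in> carrier G" and r: "regular False h z w" and p: "topval p z"
  shows "topval (act h p) w"
proof -
  obtain g x where g: "g \<in> carrier G" "p = pt g x" "regular False g x z" using p unfolding topval_def by blast
  then have "act h p = pt (h \<otimes>\<^bsub>G\<^esub> g) x" using act_pt[OF h g(1)] regular_points by blast
  then show ?thesis using regular_mult[OF h g(1) r g(3)] PC.m_closed[OF h g(1)] unfolding topval_def by blast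
qed

text \<open>If the points \<open>pt g v\<close> and \<open>pt h w\<close> have the same value, the
  quotient of \<open>g\<close> by \<open>h\<close> extends to a local homeomorphism taking
  \<open>v\<close> to \<open>w\<close>. It is projectively regular outside a finite set, so any two
  basic neighbourhoods of the two points share a point.\<close>

lemma topval_not_separated:
  assumes p: "topval p z" and q: "topval q z"
  shows "\<not> separated p q"
proof
  assume "separated p q"
  then obtain g h V W where gh: "g \<in> carrier G" "h \<in> carrier G" "openin (ctop X) V" "openin (ctop X) W"
    "p \<in> pt g ` V" "q \<in> pt h ` W" "pt g ` V \<inter> pt h ` W = {}"
    unfolding separated_def by blast
  have VW: "V \<subseteq> points X" "W \<subseteq> points X" by (rule openin_subset[OF gh(3)], rule openin_subset[OF gh(4)])
  obtain v w where v: "v \<in> V" "p = pt g v" and w: "w \<in> W" "q = pt h w" using gh(5,6) by blast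
  have rv: "regular False g v z" using p v VW topval_pt[OF gh(1)] by blast
  have rw: "regular False h w z" using q w VW topval_pt[OF gh(2)] by blast
  let ?k = "inv\<^bsub>G\<^esub> h \<otimes>\<^bsub>G\<^esub> g"
  have kG: "?k \<in> carrier G" using gh(1,2) by simp
  have "regular False ?k v w"
    using regular_mult[OF _ gh(1) regular_inv[OF gh(2) rw] rv] gh(2) by simp
  then obtain f N where f: "f \<in> ?k" "v \<in> N" "f v = w" "liso False X X f N" by (rule regular_local) blast
  let ?O = "V \<inter> {u \<in> N. f u \<in> W}"
  have "openin (ctop X) ?O" using gh(3) lisoD(6)[OF f(4) gh(4)] by (rule openin_Int)
  moreover have "v \<in> ?O" using f v w by simp
  ultimately have "infinite ?O" using infinite_open by blast
  moreover have "finite (points X - {u \<in> points X. regular True ?k u (f u)})"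
    using cofin_regular[OF kG f(1)] by (simp add: cofin_def)
  ultimately have "\<not> ?O \<subseteq> points X - {u \<in> points X. regular True ?k u (f u)}"
    using finite_subset by blast
  then obtain u where u: "u \<in> ?O" "regular True ?k u (f u)" using VW(1) by blast
  have "pt g u = pt h (f u)" using pt_eq_iff[OF gh(1,2)] u regular_points[OF u(2)] by blast
  then show False using u(1) gh(7) by blast
qed

lemma PC0_regular:
  assumes h: "h \<in> carrier G" and f: "f \<in> h" "homeomorphic_map (ctop X) (ctop X) f" and z: "z \<in> points X"
  shows "regular False h z (f z)"
proof -
  have "f ` points X = points X" using homeomorphic_imp_surjective_map[OF f(2)] .
  then have "liso False X X f (points X)" using f(2) by (simp add: liso_homeo_iff)
  then show ?thesis unfolding regular_def using f(1) z by blast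
qed

section \<open>Assembling the models\<close>

theorem invariant_model:
  assumes H: "subgroup H G" and FW: "relative_FW G H" and inf: "infinite (UNIV - points X)"
  shows "\<exists>(X' :: 'a pcurve) \<Phi>. projective_curve X' \<and> \<Phi> \<in> pw_isos X X' \<and>
    conj_class X X' \<Phi> ` H \<subseteq> Aut_Proj X'"
proof -
  obtain M where M: "M \<subseteq> pts" "\<And>h. h \<in> H \<Longrightarrow> act h ` M = M" "finite (sym_diff base M)"
    "\<And>p q. p \<in> M \<Longrightarrow> q \<in> M \<Longrightarrow> p \<noteq> q \<Longrightarrow> separated p q"
    by (rule ex_separated_invariant[OF H FW]) blast
  have "finite (M - base)" using M(3) by simp
  then obtain j :: "(('a \<Rightarrow> 'a) set \<times> 'a) set \<Rightarrow> 'a" where j: "inj_on j M"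
    "\<And>x. x \<in> points X \<Longrightarrow> j (pt \<one>\<^bsub>G\<^esub> x) = x"
    using ex_labels[OF M(1) _ inf] by blast
  have j': "j (pt \<one>\<^bsub>G\<^esub> x) = x" if "x \<in> chart_dom M \<one>\<^bsub>G\<^esub>" for x
    using that j(2) by (simp add: chart_dom_def)
  obtain X' where "projective_curve X'" "pw_rep X X' id"
    "conj_class X X' (pw_class X X' id) ` H \<subseteq> Aut_Proj X'"
    by (rule ex_model[OF H M j(1) j'])
  then show ?thesis unfolding pw_isos_def by blast
qed

text \<open>Topological values serve as labels. They realize the model on a cofinite set
  \<open>S\<close> of points of \<open>X\<close>, with the subspace topology but possibly another
  projective structure, and \<open>F\<close> is the complement of \<open>S\<close>.\<close>

theorem invariant_model_PC0:
  assumes H: "subgroup H G" and FW: "relative_FW G H" and PC0: "H \<subseteq> PC0_Proj X"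
  shows "\<exists>(X' :: 'a pcurve) \<Phi> F. projective_curve X' \<and> \<Phi> \<in> pw_isos X X' \<and>
    conj_class X X' \<Phi> ` H \<subseteq> Aut_Proj X' \<and>
    finite F \<and> F \<subseteq> points X \<and> PC0_invariant X H F \<and>
    (\<exists>f\<in>\<Phi>. pw_projective_homeo (remove_points X F) X' f)"
proof -
  obtain M0 where M0: "M0 \<subseteq> pts" "\<And>h. h \<in> H \<Longrightarrow> act h ` M0 = M0" "finite (sym_diff base M0)"
    "\<And>p q. p \<in> M0 \<Longrightarrow> q \<in> M0 \<Longrightarrow> p \<noteq> q \<Longrightarrow> separated p q"
    by (rule ex_separated_invariant[OF H FW]) blast
  have HG: "h \<in> carrier G" if "h \<in> H" for h using subgroup.mem_carrier[OF H that] .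
  \<comment> \<open>Only points with a topological value are kept. All points of \<open>base\<close>
    have one, so the symmetric difference with \<open>base\<close> does not grow.\<close>
  define M where "M = {p \<in> M0. \<exists>z. topval p z}"
  define val where "val p = (THE z. topval p z)" for p
  have val_eq: "val p = z" if "topval p z" for p z
    unfolding val_def using that topval_unique by (intro the_equality) blast+
  have M: "M \<subseteq> pts" using M0(1) by (auto simp: M_def)
  have topval_M: "topval p (val p)" if "p \<in> M" for p using that val_eq by (auto simp: M_def)
  have actM: "act h p \<in> M \<and> topval (act h p) w"
    if "h \<in> H" "p \<in> M" "topval p z" "regular False h z w" for h p z w
    using topval_act[OF HG[OF that(1)] that(4,3)] M0(2)[OF that(1)] that(2) by (auto simp: M_def)
  have inv: "act h ` M = M" if "h \<in> H" for h
  proof (rule invariantI[OF H M _ that])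
    fix h p assume h: "h \<in> H" and p: "p \<in> M"
    \<comment> \<open>A homeomorphism representing \<open>h\<close> is topologically regular at
      every point, so it carries the value of \<open>p\<close> to a value of the translated
      point.\<close>
    obtain f where f: "f \<in> h" "homeomorphic_map (ctop X) (ctop X) f"
      using h PC0 by (auto simp: PC0_Proj_def)
    obtain z where z: "topval p z" using p by (auto simp: M_def)
    then have "z \<in> points X" unfolding topval_def using regular_points by blast
    then show "act h p \<in> M" using actM[OF h p z PC0_regular[OF HG[OF h] f]] by blast
  qed
  have "sym_diff base M \<subseteq> sym_diff base M0" using topval_base by (auto simp: M_def base_def)
  then have fin: "finite (sym_diff base M)" using M0(3) finite_subset by blast
  have sep: "separated p q" if "p \<in> M" "q \<in> M" "p \<noteq> q" for p q
    using M0(4)[of p q] that by (simp add: M_def)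
  \<comment> \<open>Distinct points of \<open>M\<close> are separated, whereas points with a common
    value never are.\<close>
  have val_inj: "inj_on val M"
    by (rule inj_onI) (metis topval_M sep topval_not_separated)
  have val_base: "val (pt \<one>\<^bsub>G\<^esub> x) = x" if "x \<in> chart_dom M \<one>\<^bsub>G\<^esub>" for x
    using that topval_base val_eq by (simp add: chart_dom_def)
  obtain X' where X': "projective_curve X'" "points X' = val ` M"
    and op: "\<And>U. openin (ctop X') U \<longleftrightarrow>
       U \<subseteq> val ` M \<and> (\<forall>g\<in>carrier G. openin (ctop X) {x \<in> chart_dom M g. val (pt g x) \<in> U})"
    and lid: "liso True X X' id (chart_dom M \<one>\<^bsub>G\<^esub>)" and rep: "pw_rep X X' id"
    and conj: "conj_class X X' (pw_class X X' id) ` H \<subseteq> Aut_Proj X'"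
    by (rule ex_model[OF H M inv fin sep val_inj val_base]) blast+
  let ?D = "chart_dom M \<one>\<^bsub>G\<^esub>"
  define S where "S = val ` M"
  have cofD: "cofin X ?D" by (rule cofin_chart_dom[OF fin PC.one_closed])
  have DS: "?D \<subseteq> S" using val_base by (force simp: S_def chart_dom_def)
  have SX: "S \<subseteq> points X"
    using topval_M regular_points unfolding S_def topval_def by blast
  have cofS: "cofin X S" by (rule cofin_mono[OF cofD DS SX])
  have reg: "regular False g x (val (pt g x))" if "g \<in> carrier G" "x \<in> chart_dom M g" for g x
    using topval_M[of "pt g x"] topval_pt[OF that(1), of x] that(2) by (simp add: chart_dom_def)
  have val_pt: "val (pt g x) = z" if "g \<in> carrier G" "regular False g x z" for g x z
    using val_eq topval_pt[OF that(1)] regular_points[OF that(2)] that(2) by blast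
  have open_dom: "openin (ctop X) (chart_dom M g)" if "g \<in> carrier G" for g
    using openin_cofin[OF curve cofin_chart_dom[OF fin that]] .
  \<comment> \<open>Near a point of the piece \<open>g\<close>, \<open>val (pt g u)\<close> equals
    \<open>f u\<close> for a local homeomorphism \<open>f\<close> of \<open>X\<close>. Openness of
    \<open>f\<close> gives one inclusion of the topologies, continuity the other.\<close>
  have top: "ctop X' = subtopology (ctop X) S"
    unfolding topology_eq openin_open_subtopology[OF openin_cofin[OF curve cofS]]
  proof (intro allI iffI)
    fix U assume U: "openin (ctop X') U"
    then have US: "U \<subseteq> S" by (simp add: op S_def)
    have "openin (ctop X) U"
      unfolding openin_subopen[of _ U]
    proof
      fix z assume z: "z \<in> U"
      then obtain p where p: "p \<in> M" "z = val p" using US by (auto simp: S_def)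
      then obtain g x where g: "g \<in> carrier G" "x \<in> points X" "p = pt g x" using M unfolding pts_def by blast
      then have x: "x \<in> chart_dom M g" using p by (simp add: chart_dom_def)
      have "regular False g x z" using reg[OF g(1) x] g p by simp
      then obtain f W where f: "x \<in> W" "f x = z" "liso False X X f W"
        "\<And>u. u \<in> W \<Longrightarrow> regular False g u (f u)" by (rule regular_local) blast
      let ?N = "W \<inter> {u \<in> chart_dom M g. val (pt g u) \<in> U}"
      have "openin (ctop X) ?N" using lisoD(1)[OF f(3)] U g(1) by (intro openin_Int) (auto simp: op)
      then have "openin (ctop X) (f ` ?N)" by (intro lisoD(5)[OF f(3)]) auto
      moreover have "x \<in> ?N" using f(1) x z g(3) p(2) by simp
      then have "z \<in> f ` ?N" using f(2) by blast
      moreover have "f ` ?N \<subseteq> U" using val_pt[OF g(1) f(4)] by auto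
      ultimately show "\<exists>T. openin (ctop X) T \<and> z \<in> T \<and> T \<subseteq> U" by blast
    qed
    then show "openin (ctop X) U \<and> U \<subseteq> S" using US by blast
  next
    fix U assume U: "openin (ctop X) U \<and> U \<subseteq> S"
    show "openin (ctop X') U" unfolding op
    proof (intro conjI ballI)
      show "U \<subseteq> val ` M" using U by (simp add: S_def)
      fix g assume g: "g \<in> carrier G"
      show "openin (ctop X) {x \<in> chart_dom M g. val (pt g x) \<in> U}"
        unfolding openin_subopen[of _ "{x \<in> chart_dom M g. val (pt g x) \<in> U}"]
      proof
        fix x assume x: "x \<in> {x \<in> chart_dom M g. val (pt g x) \<in> U}"
        then have "regular False g x (val (pt g x))" using reg[OF g] by blast
        then obtain f W where f: "x \<in> W" "f x = val (pt g x)" "liso False X X f W"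
          "\<And>u. u \<in> W \<Longrightarrow> regular False g u (f u)" by (rule regular_local) blast
        let ?N = "chart_dom M g \<inter> {u \<in> W. f u \<in> U}"
        have "openin (ctop X) ?N" using open_dom[OF g] lisoD(6)[OF f(3)] U by (intro openin_Int) auto
        moreover have "x \<in> ?N" using f(1,2) x by auto
        moreover have "?N \<subseteq> {x \<in> chart_dom M g. val (pt g x) \<in> U}" using val_pt[OF g f(4)] by auto
        ultimately show "\<exists>T. openin (ctop X) T \<and> x \<in> T \<and> T \<subseteq> {x \<in> chart_dom M g. val (pt g x) \<in> U}"
          by blast
      qed
    qed
  qed
  define F where "F = points X - S"
  have F: "finite F" "F \<subseteq> points X" "points X - F = S"
    using cofS SX by (auto simp: F_def cofin_def)
  let ?R = "remove_points X F"
  have R: "projective_curve ?R" by (rule projective_curve_remove_points[OF curve F(1)])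
  have topR: "ctop ?R = ctop X'" using F(3) top by simp
  have "PC0_invariant X H F"
    unfolding PC0_invariant_def
  proof (intro ballI impI)
    fix h f assume h: "h \<in> H" and f: "f \<in> h" "homeomorphic_map (ctop X) (ctop X) f"
    have r: "regular False h z (f z)" if "z \<in> points X" for z using PC0_regular[OF HG[OF h] f that] .
    \<comment> \<open>Values move equivariantly, so regular images under \<open>H\<close> of points
      of \<open>S\<close> stay in \<open>S\<close>. Applied to \<open>h\<close> and to its inverse,
      this shows that \<open>S\<close> and its complement \<open>F\<close> are invariant.\<close>
    have move: "w \<in> S" if "k \<in> H" "z \<in> S" "regular False k z w" for k z w
    proof -
      obtain p where p: "p \<in> M" "z = val p" using \<open>z \<in> S\<close> by (auto simp: S_def)
      then have "act k p \<in> M \<and> topval (act k p) w"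
        using actM[OF that(1) p(1) topval_M[OF p(1)]] that(3) by blast
      then show ?thesis using val_eq by (auto simp: S_def)
    qed
    have iff: "f z \<in> S \<longleftrightarrow> z \<in> S" if z: "z \<in> points X" for z
      using move[OF h _ r[OF z]] move[OF subgroup.m_inv_closed[OF H h] _ regular_inv[OF HG[OF h] r[OF z]]]
      by blast
    have onto: "f ` points X = points X" using homeomorphic_imp_surjective_map[OF f(2)] .
    show "f ` F = F"
    proof (intro equalityI subsetI)
      fix w assume "w \<in> f ` F"
      then show "w \<in> F" using iff onto by (auto simp: F_def)
    next
      fix w assume w: "w \<in> F"
      then obtain z where "z \<in> points X" "w = f z" using onto by (auto simp: F_def)
      then show "w \<in> f ` F" using w iff by (auto simp: F_def)
    qed
  qed
  moreover have "pw_projective_homeo ?R X' id"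
    unfolding pw_projective_homeo_def
  proof
    show "homeomorphic_map (ctop ?R) (ctop X') id" unfolding topR homeomorphic_map_id ..
    \<comment> \<open>The identity is a homeomorphism on all of \<open>S\<close>, but its
      projectivity is known only on the cofinite set \<open>?D\<close>; the structures may differ at
      the remaining points.\<close>
    have "liso True ?R X' id ?D"
      unfolding liso_def topR
    proof (intro conjI allI impI ballI)
      show "openin (ctop X') ?D" using lisoD(1,5)[OF lid] by simp
      show "openin (ctop X') {x \<in> ?D. id x \<in> V}" if "openin (ctop X') V" for V
      proof -
        have "{x \<in> ?D. id x \<in> V} = ?D \<inter> V" by auto
        then show ?thesis using openin_Int[OF \<open>openin (ctop X') ?D\<close> that] by simp
      qed
      show "lproj ?R X' id x" if "x \<in> ?D" for x
        using that DS F(3) by (intro lproj_from_remove_points[OF curve F(1) lisoD(7)[OF lid]]) auto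
    qed auto
    moreover have "finite (S - ?D)"
      using cofD SX finite_subset[of "S - ?D" "points X - ?D"] unfolding cofin_def by blast
    then have "cofin ?R ?D" "cofin X' (id ` ?D)"
      unfolding cofin_def remove_points_simps F(3) X'(2) S_def[symmetric] using DS SX by (auto simp: Int_absorb1)
    ultimately show "pw_rep ?R X' id" unfolding pw_rep_iff_liso[OF R X'(1)] by blast
  qed
  moreover have "id \<in> pw_class X X' id" using rep by (simp add: pw_class_def)
  moreover have "pw_class X X' id \<in> pw_isos X X'" using rep unfolding pw_isos_def by blast
  ultimately show ?thesis using X'(1) conj F(1,2) by blast
qed

end

section \<open>The circle\<close>

lemma perfect_curve_circle: "perfect_curve circle"
proof
  show "projective_curve circle" by (rule projective_curve_circle)
  fix U assume U: "openin (ctop circle) U" "U \<noteq> {}"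
  then obtain x where x: "coset x \<in> U" by (auto simp: openin_circle)
  have "open (coset -` U)" "x \<in> coset -` U" using U(1) x by (simp_all add: openin_circle)
  then obtain r where r: "r > 0" "ball x r \<subseteq> coset -` U" by (meson openE)
  \<comment> \<open>The bound 1/2 keeps the interval of length \<open>2 * s\<close> within one
    period, so that \<open>coset\<close> is injective on it.\<close>
  define s where "s = min r (1/2)"
  have s: "0 < s" "s \<le> r" "s \<le> 1/2" using r(1) by (auto simp: s_def)
  have "{x - s<..<x + s} \<subseteq> coset -` U" using r(2) s(2) by (auto simp: ball_eq_greaterThanLessThan)
  then have "coset ` {x - s<..<x + s} \<subseteq> U" by blast
  moreover have "inj_on coset {x - s<..<x + s}" by (rule inj_on_coset) (use s in simp)
  moreover have "infinite {x - s<..<x + s}" using s(1) by (simp add: infinite_Ioo)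
  ultimately show "infinite U" using finite_imageD finite_subset by metis
qed

text \<open>Provides the fresh labels in the point type of the circle: a coset has more than one
  element, so no singleton of a real number is a point.\<close>

lemma infinite_non_cosets: "infinite (UNIV - points circle)"
proof -
  have "{t} \<notin> points circle" for t
  proof
    assume "{t} \<in> points circle"
    then obtain x where x: "{t} = coset x" by (auto simp: points_circle)
    have "x + of_int k \<in> coset x" for k :: int by (auto simp: coset_def)
    from this[of 0] this[of 1] show False unfolding x[symmetric] by simp
  qed
  then have "range (\<lambda>t::real. {t}) \<subseteq> UNIV - points circle" by blast
  moreover have "infinite (range (\<lambda>t::real. {t}))"
    using infinite_UNIV_char_0 by (auto dest!: finite_imageD simp: inj_on_def)
  ultimately show ?thesis using finite_subset by blast
qed

theorem theorem1p6:
  assumes "subgroup H (PC_Proj circle)"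
    and "relative_FW (PC_Proj circle) H"
  shows "(\<exists>(X' :: real set pcurve) \<Phi>.
            projective_curve X' \<and> \<Phi> \<in> pw_isos circle X' \<and>
            conj_class circle X' \<Phi> ` H \<subseteq> Aut_Proj X') \<and>
         (H \<subseteq> PC0_Proj circle \<longrightarrow>
          (\<exists>(X' :: real set pcurve) \<Phi> F.
            projective_curve X' \<and> \<Phi> \<in> pw_isos circle X' \<and>
            conj_class circle X' \<Phi> ` H \<subseteq> Aut_Proj X' \<and>
            finite F \<and> F \<subseteq> points circle \<and> PC0_invariant circle H F \<and>
            (\<exists>f\<in>\<Phi>. pw_projective_homeo (remove_points circle F) X' f)))"
proof -
  interpret perfect_curve circle by (rule perfect_curve_circle)
  show ?thesis
    using invariant_model[OF assms infinite_non_cosets] invariant_model_PC0[OF assms] by blast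
qed

end
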